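(* Let $d\ge2$, let $\Gamma=(V,\mathcal E)$ be a $\mathbb Z^d$-periodic graph with fundamental graph $\Gamma_f$ on the vertices $v_1,\ldots,v_\nu$, and let $H_t=\Delta+tQ$ on $\ell^2(V)$, where the real $\mathbb Z^d$-periodic potential $Q$ satisfies $q_j\ne q_k$ for all $j\neq k$, $j,k\in\{1,\ldots,\nu\}$ ($q_j=Q(v_j)$), and $t$ is a real coupling constant. Number the vertices so that $q_1<q_2<\ldots<q_\nu$. Then each eigenvalue $\lambda_n(\vartheta,t)$ of the Floquet matrix $H_t(\vartheta)$ and each spectral band $\sigma_n(H_t)$, $n=1,\ldots,\nu$, satisfy, as $t\to\infty$ and uniformly in $\vartheta\in\mathbb T^d$, $$\lambda_n(\vartheta,t)=tq_n+\Delta_{nn}(\vartheta)-\frac1t\sum_{\substack{j=1\\ j\ne n}}^\nu\frac{|\Delta_{jn}(\vartheta)|^2}{q_j-q_n}+\frac{O(1)}{t^2},$$ $$|\sigma_n(H_t)|=|\Delta_{nn}(\mathbb T^d)|+O(1/t).$$ In particular, $$|\sigma(H_t)|=C+O(1/t),\qquad C=\sum_{n=1}^\nu|\Delta_{nn}(\mathbb T^d)|,$$ and $C>0$ if there are bridge-loops on $\Gamma_f$, while $C=0$ if there are no bridge-loops on $\Gamma_f$. Here $|\cdot|$ of a set is Lebesgue measure (length).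
   Context: A $\mathbb Z^d$-periodic graph $\Gamma=(V,\mathcal E)$ ($d\ge2$) is a connected graph embedded in $\mathbb R^d$, possibly with loops and multiple edges, with vertex set $V$ and set $\mathcal E$ of unoriented edges, such that: any bounded domain of $\mathbb R^d$ contains finitely many vertices; every vertex has finite degree (number of incident edges, a loop counted twice); and there is a basis $a_1,\ldots,a_d$ of $\mathbb R^d$ (the periods) with $\Gamma+a_s=\Gamma$ for $s=1,\ldots,d$. Coordinates are taken with some origin and axes along $a_1,\ldots,a_d$, so that $\Gamma+m=\Gamma$ for all $m\in\mathbb Z^d$. Each unoriented edge gives two oriented edges $(u,v)$ and $(v,u)$ (an unoriented loop gives two oriented loops); $\mathcal A$ is the set of oriented edges. The fundamental graph is $\Gamma_f=\Gamma/\mathbb Z^d$; it is finite, its vertices are identified with $V\cap[0,1)^d=\{v_1,\ldots,v_\nu\}$, and $\mathcal A_f=\mathcal A/\mathbb Z^d$ is its set of oriented edges. Every $v\in V$ is uniquely $v=[v]+\tilde v$ with $[v]\in\mathbb Z^d$, $\tilde v\in V\cap[0,1)^d$. The index of $\mathbf e=(u,v)\in\mathcal A$ is $\tau(\mathbf e)=[v]-[u]\in\mathbb Z^d$; it is $\mathbb Z^d$-translation invariant and defines the index of the corresponding edge of $\mathcal A_f$. Edges of $\mathcal A_f$ with nonzero index are called bridges; a bridge-loop is a bridge of the form $(v_n,v_n)$. $(\Delta f)(v)=\sum_{(v,u)_e\in\mathcal E}(f(v)-f(u))$ on $\ell^2(V)$; $Q$ is multiplication by a real function with $Q(v+m)=Q(v)$,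 $m\in\mathbb Z^d$. The Floquet matrices, for $\vartheta\in\mathbb T^d=\mathbb R^d/(2\pi\mathbb Z)^d$, are $H_t(\vartheta)=\Delta(\vartheta)+t\,\mathrm{diag}(q_1,\ldots,q_\nu)$, $\Delta_{jk}(\vartheta)=\varkappa_j\delta_{jk}-\sum_{\mathbf e=(v_j,v_k)\in\mathcal A_f}e^{i\langle\tau(\mathbf e),\vartheta\rangle}$, $\varkappa_j=\deg v_j$. Its eigenvalues are $\lambda_1(\vartheta,t)\le\ldots\le\lambda_\nu(\vartheta,t)$ (with multiplicity), the spectral bands are $\sigma_n(H_t)=\lambda_n(\mathbb T^d,t)$, and $\sigma(H_t)=\bigcup_n\sigma_n(H_t)$. *)

theory Defs
  imports
    "HOL-Analysis.Analysis"
    "HOL-Library.Landau_Symbols"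
    "HOL-Computational_Algebra.Computational_Algebra"
    "Jordan_Normal_Form.Char_Poly"
begin

(* From here on the dollar sign is component access in the type real ^ 'd, and
   only the double dollar refers to the matrices of Jordan_Normal_Form. *)
no_notation Matrix.vec_index (infixl "$" 100)

text \<open>A graph drawn in \<open>\<real>\<^sup>d\<close>, together with the periods \<open>a\<^sub>1, \<dots>, a\<^sub>d\<close> and the origin
  used for coordinates. An edge is the point set of the curve that draws it, so that distinct
  (possibly parallel) edges are distinct sets, and translating an edge is translating a set.\<close>

record ('d::finite) pgraph =
  verts :: "(real ^ 'd) set"
  edges :: "(real ^ 'd) set set"
  period :: "'d \<Rightarrow> real ^ 'd"
  origin :: "real ^ 'd"

definition ends :: "('d::finite) pgraph \<Rightarrow> (real ^ 'd) set \<Rightarrow> (real ^ 'd) set" where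
  "ends G e = e \<inter> verts G"

text \<open>Edges are arcs, or simple closed curves (loops), with endpoints in the vertex set and
  no vertex in their interior. Different edges are allowed to cross away from the vertices:
  otherwise every graph with \<open>d = 2\<close> would be planar.\<close>

definition zd_periodic_graph :: "('d::finite) pgraph \<Rightarrow> bool" where
  "zd_periodic_graph G \<longleftrightarrow>
     CARD('d) \<ge> 2 \<and>
     verts G \<noteq> {} \<and>
     (\<forall>e\<in>edges G. \<exists>g. simple_path g \<and> path_image g = e \<and>
                      e \<inter> verts G = {pathstart g, pathfinish g}) \<and>
     (\<forall>u\<in>verts G. \<forall>v\<in>verts G. (u, v) \<in> {(x, y). \<exists>e\<in>edges G. ends G e = {x, y}}\<^sup>*) \<and>
     (\<forall>B. bounded B \<longrightarrow> finite (B \<inter> verts G)) \<and>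
     (\<forall>v\<in>verts G. finite {e \<in> edges G. v \<in> ends G e}) \<and>
     inj (period G) \<and> independent (range (period G)) \<and>
     (\<forall>s. (\<lambda>x. x + period G s) ` verts G = verts G \<and>
          (\<lambda>e. (\<lambda>x. x + period G s) ` e) ` edges G = edges G)"

text \<open>A loop is counted twice.\<close>

definition degree_at :: "('d::finite) pgraph \<Rightarrow> real ^ 'd \<Rightarrow> nat" where
  "degree_at G v = card {e \<in> edges G. v \<in> ends G e} + card {e \<in> edges G. ends G e = {v}}"

definition lattice_vec :: "('d::finite) pgraph \<Rightarrow> int ^ 'd \<Rightarrow> real ^ 'd" where
  "lattice_vec G m = (\<Sum>s\<in>UNIV. of_int (m $ s) *\<^sub>R period G s)"

definition coord :: "('d::finite) pgraph \<Rightarrow> real ^ 'd \<Rightarrow> real ^ 'd" where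
  "coord G x = (THE c. x = origin G + (\<Sum>s\<in>UNIV. (c $ s) *\<^sub>R period G s))"

definition int_part :: "('d::finite) pgraph \<Rightarrow> real ^ 'd \<Rightarrow> int ^ 'd" where
  "int_part G v = (\<chi> s. \<lfloor>coord G v $ s\<rfloor>)"

definition frac_part :: "('d::finite) pgraph \<Rightarrow> real ^ 'd \<Rightarrow> real ^ 'd" where
  "frac_part G v = v - lattice_vec G (int_part G v)"

definition fund_verts :: "('d::finite) pgraph \<Rightarrow> (real ^ 'd) set" where
  "fund_verts G = {v \<in> verts G. \<forall>s. 0 \<le> coord G v $ s \<and> coord G v $ s < 1}"

text \<open>An oriented edge \<open>(e, u, v, b)\<close> is the edge \<open>e\<close> run from \<open>u\<close> to \<open>v\<close>. The tag \<open>b\<close> is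
  forced to be \<open>False\<close> unless \<open>e\<close> is a loop, in which case it distinguishes the two orientations.\<close>

type_synonym 'd oedge = "(real ^ 'd) set \<times> (real ^ 'd) \<times> (real ^ 'd) \<times> bool"

definition oriented_edges :: "('d::finite) pgraph \<Rightarrow> 'd oedge set" where
  "oriented_edges G = {(e, u, v, b). e \<in> edges G \<and> ends G e = {u, v} \<and> (b \<longrightarrow> u = v)}"

fun oedge_shift :: "real ^ ('d::finite) \<Rightarrow> 'd oedge \<Rightarrow> 'd oedge" where
  "oedge_shift x (e, u, v, b) = ((\<lambda>y. y + x) ` e, u + x, v + x, b)"

fun oedge_index :: "('d::finite) pgraph \<Rightarrow> 'd oedge \<Rightarrow> int ^ 'd" where
  "oedge_index G (e, u, v, b) = int_part G v - int_part G u"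

fun oedge_tail :: "('d::finite) oedge \<Rightarrow> real ^ 'd" where
  "oedge_tail (e, u, v, b) = u"

fun oedge_head :: "('d::finite) oedge \<Rightarrow> real ^ 'd" where
  "oedge_head (e, u, v, b) = v"

text \<open>The oriented edges of the fundamental graph are the orbits of oriented edges under the
  lattice. Index, tail and head of an orbit are the common values on its members.\<close>

definition fund_oedges :: "('d::finite) pgraph \<Rightarrow> 'd oedge set set" where
  "fund_oedges G = oriented_edges G //
     {(x, y). x \<in> oriented_edges G \<and> y \<in> oriented_edges G \<and>
              (\<exists>m. y = oedge_shift (lattice_vec G m) x)}"

definition fund_index :: "('d::finite) pgraph \<Rightarrow> 'd oedge set \<Rightarrow> int ^ 'd" where
  "fund_index G c = the_elem (oedge_index G ` c)"

definition fund_tail :: "('d::finite) pgraph \<Rightarrow> 'd oedge set \<Rightarrow> real ^ 'd" where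
  "fund_tail G c = the_elem ((\<lambda>x. frac_part G (oedge_tail x)) ` c)"

definition fund_head :: "('d::finite) pgraph \<Rightarrow> 'd oedge set \<Rightarrow> real ^ 'd" where
  "fund_head G c = the_elem ((\<lambda>x. frac_part G (oedge_head x)) ` c)"

definition bridges :: "('d::finite) pgraph \<Rightarrow> 'd oedge set set" where
  "bridges G = {c \<in> fund_oedges G. fund_index G c \<noteq> 0}"

definition bridge_loops :: "('d::finite) pgraph \<Rightarrow> 'd oedge set set" where
  "bridge_loops G = {c \<in> bridges G. fund_tail G c = fund_head G c}"

text \<open>The Schroedinger operator on \<open>\<ell>\<^sup>2(V)\<close>. Elements of \<open>\<ell>\<^sup>2(V)\<close> are extended by zero
  outside \<open>V\<close>.\<close>

definition l2 :: "'a set \<Rightarrow> ('a \<Rightarrow> complex) set" where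
  "l2 V = {f. (\<forall>v. v \<notin> V \<longrightarrow> f v = 0) \<and> (\<lambda>v. (cmod (f v))\<^sup>2) summable_on V}"

definition l2norm :: "'a set \<Rightarrow> ('a \<Rightarrow> complex) \<Rightarrow> real" where
  "l2norm V f = sqrt (\<Sum>\<^sub>\<infinity>v\<in>V. (cmod (f v))\<^sup>2)"

definition l2_spectrum :: "'a set \<Rightarrow> (('a \<Rightarrow> complex) \<Rightarrow> ('a \<Rightarrow> complex)) \<Rightarrow> complex set" where
  "l2_spectrum V T = {z. \<not> (bij_betw (\<lambda>f v. T f v - z * f v) (l2 V) (l2 V) \<and>
      (\<exists>C. \<forall>f\<in>l2 V. l2norm V f \<le> C * l2norm V (\<lambda>v. T f v - z * f v)))}"

definition laplacian :: "('d::finite) pgraph \<Rightarrow> (real ^ 'd \<Rightarrow> complex) \<Rightarrow> real ^ 'd \<Rightarrow> complex" where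
  "laplacian G f v = (\<Sum>(e, u) \<in> {(e, u). e \<in> edges G \<and> ends G e = {v, u}}. f v - f u)"

definition periodic_potential :: "('d::finite) pgraph \<Rightarrow> (real ^ 'd \<Rightarrow> real) \<Rightarrow> bool" where
  "periodic_potential G Q \<longleftrightarrow> (\<forall>v\<in>verts G. \<forall>m. Q (v + lattice_vec G m) = Q v)"

definition schroedinger ::
    "('d::finite) pgraph \<Rightarrow> (real ^ 'd \<Rightarrow> real) \<Rightarrow> real \<Rightarrow> (real ^ 'd \<Rightarrow> complex) \<Rightarrow> real ^ 'd \<Rightarrow> complex"
  where
  "schroedinger G Q t f v =
     (if v \<in> verts G then laplacian G f v + of_real (t * Q v) * f v else 0)"

text \<open>The operator is self-adjoint, so its spectrum is regarded as a set of reals.\<close>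

definition schroedinger_spectrum ::
    "('d::finite) pgraph \<Rightarrow> (real ^ 'd \<Rightarrow> real) \<Rightarrow> real \<Rightarrow> real set" where
  "schroedinger_spectrum G Q t =
     {x. complex_of_real x \<in> l2_spectrum (verts G) (schroedinger G Q t)}"

text \<open>Floquet matrices, with respect to a numbering \<open>w 0, \<dots>, w (\<nu> - 1)\<close> of the vertices in the
  fundamental cell. All numberings start at \<open>0\<close>. The quasimomentum ranges over \<open>real ^ 'd\<close>,
  everything being \<open>2\<pi>\<close>-periodic in each component.\<close>

definition floquet_laplacian ::
    "('d::finite) pgraph \<Rightarrow> (nat \<Rightarrow> real ^ 'd) \<Rightarrow> real ^ 'd \<Rightarrow> complex mat" where
  "floquet_laplacian G w \<theta> =
     Matrix.mat (card (fund_verts G)) (card (fund_verts G)) (\<lambda>(j, k).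
       (if j = k then of_nat (degree_at G (w j)) else 0) -
       (\<Sum>c \<in> {c \<in> fund_oedges G. fund_tail G c = w j \<and> fund_head G c = w k}.
          exp (\<i> * of_real (\<Sum>s\<in>UNIV. of_int (fund_index G c $ s) * \<theta> $ s))))"

definition floquet_matrix ::
    "('d::finite) pgraph \<Rightarrow> (real ^ 'd \<Rightarrow> real) \<Rightarrow> (nat \<Rightarrow> real ^ 'd) \<Rightarrow> real ^ 'd \<Rightarrow> real \<Rightarrow> complex mat"
  where
  "floquet_matrix G Q w \<theta> t =
     floquet_laplacian G w \<theta> +
     of_real t \<cdot>\<^sub>m mat_diag (card (fund_verts G)) (\<lambda>j. of_real (Q (w j)))"

text \<open>The \<open>n\<close>-th smallest eigenvalue (from \<open>n = 0\<close>), counted with multiplicity, of a matrix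
  all of whose eigenvalues are real.\<close>

definition nth_eigenvalue :: "complex mat \<Rightarrow> nat \<Rightarrow> real" where
  "nth_eigenvalue A n = sorted_list_of_multiset (image_mset Re (proots (char_poly A))) ! n"

definition band_function ::
    "('d::finite) pgraph \<Rightarrow> (real ^ 'd \<Rightarrow> real) \<Rightarrow> (nat \<Rightarrow> real ^ 'd) \<Rightarrow> nat \<Rightarrow> real ^ 'd \<Rightarrow> real \<Rightarrow> real"
  where
  "band_function G Q w n \<theta> t = nth_eigenvalue (floquet_matrix G Q w \<theta> t) n"

definition spectral_band ::
    "('d::finite) pgraph \<Rightarrow> (real ^ 'd \<Rightarrow> real) \<Rightarrow> (nat \<Rightarrow> real ^ 'd) \<Rightarrow> nat \<Rightarrow> real \<Rightarrow> real set"
  where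
  "spectral_band G Q w n t = range (\<lambda>\<theta>. band_function G Q w n \<theta> t)"

text \<open>The range of a diagonal entry of the Floquet Laplacian; these entries are real.\<close>

definition diag_range :: "('d::finite) pgraph \<Rightarrow> (nat \<Rightarrow> real ^ 'd) \<Rightarrow> nat \<Rightarrow> real set" where
  "diag_range G w n = range (\<lambda>\<theta>. Re (floquet_laplacian G w \<theta> $$ (n, n)))"

end

theory Submission
  imports Defs "Jordan_Normal_Form.Schur_Decomposition"
begin

text \<open>A normalized vector with residual \<open>\<delta>\<close> with respect to a Hermitian matrix and a number \<open>\<mu>\<close> forces an
  eigenvalue within \<open>\<delta>\<close> of \<open>\<mu>\<close>. Applied to the unit vectors, this puts an eigenvalue of
  \<open>H\<^sub>t(\<theta>)\<close> near each \<open>t q\<^sub>n\<close>; for large \<open>t\<close> these neighbourhoods are disjoint, so that each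
  contains exactly one eigenvalue, the \<open>n\<close>-th. Applied to the truncated perturbation series of the
  eigenvector it gives the expansion, and applied to an eigenvector at a nearby \<open>\<theta>\<close> it gives
  continuity. The bands are therefore disjoint intervals, and their lengths are those of the ranges
  of \<open>\<Delta>\<^sub>n\<^sub>n\<close> up to \<open>O(1 / t)\<close>.

  A real number is in the spectrum of the operator if and only if it is an eigenvalue of some
  Floquet matrix: damped Bloch waves are approximate eigenfunctions, and away from the eigenvalues
  the Fourier transform of finitely supported functions bounds the inverse.\<close>

section \<open>Hermitian matrices\<close>

text \<open>Uniformity in \<theta> costs nothing extra: the estimates see the Floquet Laplacian only
  through a bound \<open>R\<close> on its entries, and the potential only through the smallest gap
  between the \<open>q j\<close>. A residual yields the existence of a nearby eigenvalue, but
  neither its uniqueness nor its place in the order. That information comes from the gaps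
  \<open>t * (q k - q j)\<close>, which outgrow every fixed radius, so each residual is paired with
  a separation valid from some \<open>t0\<close> on.

  The length of the spectrum concerns an operator on an infinite dimensional space, and both
  inclusions between its spectrum and the union of the bands are required. The harder one asks for
  surjectivity of \<open>T - x\<close>: a solution with finitely supported right-hand side is in
  general not finitely supported, whereas the Fourier estimates are available for finite supports.
  The finite range of \<open>T\<close> carries such estimates over to all of l2, and compactness of
  the torus makes the distance from \<open>x\<close> to the eigenvalues uniform in \<theta>.\<close>

definition hermitian_mat :: "nat \<Rightarrow> complex mat \<Rightarrow> bool" where
  "hermitian_mat n A \<longleftrightarrow> A \<in> carrier_mat n n \<and> (\<forall>i<n. \<forall>j<n. A $$ (j, i) = cnj (A $$ (i, j)))"

text \<open>A vector is a function on \<open>nat\<close> of which only the values below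
  \<open>n\<close> count. Equations between vectors are therefore stated for \<open>i < n\<close>,
  and the congruence lemmas discard the other values.\<close>

definition act :: "nat \<Rightarrow> complex mat \<Rightarrow> (nat \<Rightarrow> complex) \<Rightarrow> nat \<Rightarrow> complex" where
  "act n A x i = (\<Sum>j<n. A $$ (i, j) * x j)"

definition cip :: "nat \<Rightarrow> (nat \<Rightarrow> complex) \<Rightarrow> (nat \<Rightarrow> complex) \<Rightarrow> complex" where
  "cip n x y = (\<Sum>i<n. x i * cnj (y i))"

definition nsq :: "nat \<Rightarrow> (nat \<Rightarrow> complex) \<Rightarrow> real" where
  "nsq n x = (\<Sum>i<n. (cmod (x i))\<^sup>2)"

lemma hermitian_carrier: "hermitian_mat n A \<Longrightarrow> A \<in> carrier_mat n n"
  by (simp add: hermitian_mat_def)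

lemma cip_cong: "(\<And>i. i < n \<Longrightarrow> x i = x' i) \<Longrightarrow> (\<And>i. i < n \<Longrightarrow> y i = y' i) \<Longrightarrow> cip n x y = cip n x' y'"
  unfolding cip_def by (intro sum.cong) auto

lemma act_cong: "(\<And>j. j < n \<Longrightarrow> x j = x' j) \<Longrightarrow> act n A x i = act n A x' i"
  unfolding act_def by (intro sum.cong) auto

lemma nsq_cong: "(\<And>i. i < n \<Longrightarrow> x i = x' i) \<Longrightarrow> nsq n x = nsq n x'"
  unfolding nsq_def by (intro sum.cong) auto

lemma nsq_nonneg: "0 \<le> nsq n x"
  unfolding nsq_def by (intro sum_nonneg) auto

lemma nsq_eq_0_iff: "nsq n x = 0 \<longleftrightarrow> (\<forall>i<n. x i = 0)"
  unfolding nsq_def by (subst sum_nonneg_eq_0_iff) auto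

lemma cip_self: "cip n x x = of_real (nsq n x)"
  unfolding cip_def nsq_def of_real_sum by (intro sum.cong refl) (metis complex_norm_square)

lemma cip_sum_left: "cip n (\<lambda>i. \<Sum>s\<in>S. f s i) y = (\<Sum>s\<in>S. cip n (f s) y)"
  unfolding cip_def by (subst sum.swap) (simp add: sum_distrib_right)

lemma cip_sum_right: "cip n x (\<lambda>i. \<Sum>s\<in>S. f s i) = (\<Sum>s\<in>S. cip n x (f s))"
  unfolding cip_def by (subst sum.swap) (simp add: sum_distrib_left)

lemma cip_scale_left: "cip n (\<lambda>i. c * x i) y = c * cip n x y"
  unfolding cip_def by (simp add: sum_distrib_left mult.assoc)

lemma cip_scale_right: "cip n x (\<lambda>i. c * y i) = cnj c * cip n x y"
  unfolding cip_def by (simp add: sum_distrib_left mult_ac)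

lemma cip_diff_left: "cip n (\<lambda>i. x i - x' i) y = cip n x y - cip n x' y"
  unfolding cip_def by (simp add: sum_subtractf algebra_simps)

lemma act_diff: "act n A (\<lambda>i. x i - y i) i = act n A x i - act n A y i"
  unfolding act_def by (simp add: sum_subtractf algebra_simps)

lemma act_scale: "act n A (\<lambda>i. c * x i) i = c * act n A x i"
  unfolding act_def by (simp add: sum_distrib_left mult_ac)

lemma act_sum: "act n A (\<lambda>i. \<Sum>s\<in>S. f s i) i = (\<Sum>s\<in>S. act n A (f s) i)"
  unfolding act_def by (subst sum.swap) (simp add: sum_distrib_left)

lemma act_mult:
  assumes "P \<in> carrier_mat n n" "B \<in> carrier_mat n n" "i < n"
  shows "act n (P * B) x i = act n P (act n B x) i"
proof -
  have "act n (P * B) x i = (\<Sum>j<n. (\<Sum>k<n. P $$ (i, k) * B $$ (k, j)) * x j)"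
    unfolding act_def using assms
    by (intro sum.cong refl) (auto simp: scalar_prod_def atLeast0LessThan intro!: sum.cong)
  also have "\<dots> = (\<Sum>k<n. \<Sum>j<n. P $$ (i, k) * B $$ (k, j) * x j)"
    by (subst sum.swap) (simp add: sum_distrib_right)
  finally show ?thesis
    unfolding act_def by (simp add: sum_distrib_left mult.assoc)
qed

lemma act_one: "i < n \<Longrightarrow> act n (1\<^sub>m n) x i = x i"
  unfolding act_def
  by (subst sum.cong[OF refl, of _ _ "\<lambda>j. if i = j then x j else 0"]) auto

lemma eigenvalue_iff_act:
  assumes A: "A \<in> carrier_mat n n"
  shows "eigenvalue A k \<longleftrightarrow> (\<exists>x. (\<exists>i<n. x i \<noteq> 0) \<and> (\<forall>i<n. act n A x i = k * x i))"
proof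
  assume "eigenvalue A k"
  then obtain v where v: "v \<in> carrier_vec n" "v \<noteq> 0\<^sub>v n" "A *\<^sub>v v = k \<cdot>\<^sub>v v"
    using A unfolding eigenvalue_def eigenvector_def by auto
  have "\<exists>i<n. vec_index v i \<noteq> 0"
    using v(1,2) by (metis carrier_vecD eq_vecI index_zero_vec(1) index_zero_vec(2))
  moreover have "act n A (vec_index v) i = k * vec_index v i" if "i < n" for i
  proof -
    have "act n A (vec_index v) i = vec_index (A *\<^sub>v v) i"
      using A v(1) that by (auto simp: act_def scalar_prod_def atLeast0LessThan intro!: sum.cong)
    then show ?thesis using v(1) that unfolding v(3) by auto
  qed
  ultimately show "\<exists>x. (\<exists>i<n. x i \<noteq> 0) \<and> (\<forall>i<n. act n A x i = k * x i)" by blast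
next
  assume "\<exists>x. (\<exists>i<n. x i \<noteq> 0) \<and> (\<forall>i<n. act n A x i = k * x i)"
  then obtain x i where x: "i < n" "x i \<noteq> 0" "\<forall>i<n. act n A x i = k * x i" by blast
  have "Matrix.vec n x \<noteq> 0\<^sub>v n"
    using x(1,2) by (metis index_vec index_zero_vec(1))
  moreover have "A *\<^sub>v Matrix.vec n x = k \<cdot>\<^sub>v Matrix.vec n x"
  proof (rule eq_vecI)
    show "dim_vec (A *\<^sub>v Matrix.vec n x) = dim_vec (k \<cdot>\<^sub>v Matrix.vec n x)" using A by auto
    fix i assume "i < dim_vec (k \<cdot>\<^sub>v Matrix.vec n x)"
    then have i: "i < n" by auto
    have "vec_index (A *\<^sub>v Matrix.vec n x) i = act n A x i"
      using A i by (auto simp: act_def scalar_prod_def atLeast0LessThan intro!: sum.cong)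
    then show "vec_index (A *\<^sub>v Matrix.vec n x) i = vec_index (k \<cdot>\<^sub>v Matrix.vec n x) i"
      using x(3) i by auto
  qed
  ultimately show "eigenvalue A k"
    using A unfolding eigenvalue_def eigenvector_def by (intro exI[of _ "Matrix.vec n x"]) auto
qed

lemma cip_act:
  assumes "hermitian_mat n A"
  shows "cip n (act n A x) y = cip n x (act n A y)"
proof -
  have "cip n (act n A x) y = (\<Sum>i<n. \<Sum>j<n. A $$ (i, j) * x j * cnj (y i))"
    unfolding cip_def act_def by (simp add: sum_distrib_right)
  also have "\<dots> = (\<Sum>j<n. \<Sum>i<n. A $$ (i, j) * x j * cnj (y i))"
    by (rule sum.swap)
  also have "\<dots> = (\<Sum>j<n. \<Sum>i<n. x j * cnj (A $$ (j, i) * y i))"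
  proof (intro sum.cong refl)
    fix j i assume "j \<in> {..<n}" "i \<in> {..<n}"
    then have "A $$ (i, j) = cnj (A $$ (j, i))" using assms unfolding hermitian_mat_def by blast
    then show "A $$ (i, j) * x j * cnj (y i) = x j * cnj (A $$ (j, i) * y i)" by simp
  qed
  finally show ?thesis
    unfolding cip_def act_def by (simp add: sum_distrib_left)
qed

lemma hermitian_eigenvalue_cnj:
  assumes "hermitian_mat n A" "\<forall>i<n. act n A x i = k * x i" "i < n" "x i \<noteq> 0"
  shows "cnj k = k"
proof -
  have "k * cip n x x = cip n (act n A x) x"
    using assms(2) unfolding cip_scale_left[symmetric] by (intro cip_cong) auto
  also have "\<dots> = cnj k * cip n x x"
    unfolding cip_act[OF assms(1)] cip_scale_right[symmetric]
    using assms(2) by (intro cip_cong) auto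
  finally have "k = cnj k \<or> cip n x x = 0" by auto
  then show ?thesis
    using assms(3,4) unfolding cip_self by (auto simp: nsq_eq_0_iff)
qed

lemma hermitian_eigenvalue_real:
  assumes "hermitian_mat n A" "eigenvalue A k"
  shows "of_real (Re k) = k"
  using assms hermitian_eigenvalue_cnj[OF assms(1)] hermitian_carrier[OF assms(1)]
  by (metis Reals_cnj_iff eigenvalue_iff_act of_real_Re)

lemma hermitian_eigenvectors_orthogonal:
  assumes "hermitian_mat n A" "\<forall>i<n. act n A x i = s * x i" "\<forall>i<n. act n A y i = r * y i" "s \<noteq> r"
  shows "cip n x y = 0"
proof (cases "\<forall>i<n. y i = 0")
  case True
  then show ?thesis by (simp add: cip_def)
next
  case False
  then have r: "cnj r = r" using hermitian_eigenvalue_cnj assms(1,3) by blast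
  have "s * cip n x y = cip n (act n A x) y"
    using assms(2) unfolding cip_scale_left[symmetric] by (intro cip_cong) auto
  also have "\<dots> = cnj r * cip n x y"
    unfolding cip_act[OF assms(1)] cip_scale_right[symmetric]
    using assms(3) by (intro cip_cong) auto
  finally show ?thesis using assms(4) r by auto
qed

text \<open>A spectral decomposition of \<open>x\<close> in which each component is indexed by its
  own eigenvalue. Components with different indices are then orthogonal, and no basis inside an
  eigenspace has to be chosen. Components may vanish, so an element of \<open>S\<close> need not be
  an eigenvalue.\<close>

definition eigen_sum :: "nat \<Rightarrow> complex mat \<Rightarrow> (nat \<Rightarrow> complex) \<Rightarrow> complex set \<Rightarrow> (complex \<Rightarrow> nat \<Rightarrow> complex) \<Rightarrow> bool" where
  "eigen_sum n A x S y \<longleftrightarrow> finite S \<and> (\<forall>i<n. x i = (\<Sum>s\<in>S. y s i)) \<and>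
     (\<forall>s\<in>S. \<forall>i<n. act n A (y s) i = s * y s i)"

text \<open>If \<open>(A - u) x\<close> is a sum of eigenvectors, dividing the component at \<open>s\<close> by \<open>s - u\<close> solves
  for \<open>x\<close>; there is no component at \<open>u\<close>, because the range of \<open>A - u\<close> is orthogonal to its kernel.\<close>

lemma eigen_sum_step:
  assumes A: "hermitian_mat n A"
    and "eigen_sum n A (\<lambda>i. act n A x i - u * x i) S y"
  shows "\<exists>S z. eigen_sum n A x S z"
proof -
  have fin: "finite S" and sum: "\<And>i. i < n \<Longrightarrow> act n A x i - u * x i = (\<Sum>s\<in>S. y s i)"
    and ev: "\<And>s i. s \<in> S \<Longrightarrow> i < n \<Longrightarrow> act n A (y s) i = s * y s i"
    using assms(2) unfolding eigen_sum_def by auto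
  have y0: "y u i = 0" if u: "u \<in> S" and i: "i < n" for i
  proof (rule ccontr)
    assume "y u i \<noteq> 0"
    then have real: "cnj u = u" using hermitian_eigenvalue_cnj[OF A, of "y u" u i] ev u i by auto
    have "cip n (\<lambda>i. \<Sum>s\<in>S. y s i) (y u) = (\<Sum>s\<in>S. cip n (y s) (y u))"
      by (rule cip_sum_left)
    also have "\<dots> = (\<Sum>s\<in>S. if s = u then cip n (y u) (y u) else 0)"
      using hermitian_eigenvectors_orthogonal[OF A, of "y _" _ "y u" u] ev u
      by (intro sum.cong) auto
    also have "\<dots> = cip n (y u) (y u)" using fin u by simp
    finally have "cip n (y u) (y u) = cip n (\<lambda>i. act n A x i - u * x i) (y u)"
      using cip_cong[of n "\<lambda>i. \<Sum>s\<in>S. y s i" "\<lambda>i. act n A x i - u * x i" "y u" "y u"] sum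
      by simp
    also have "\<dots> = cip n x (act n A (y u)) - u * cip n x (y u)"
      by (simp add: cip_diff_left cip_scale_left cip_act[OF A])
    also have "cip n x (act n A (y u)) = cip n x (\<lambda>i. u * y u i)"
      using ev u by (intro cip_cong) auto
    also have "\<dots> = u * cip n x (y u)" by (simp add: cip_scale_right real)
    finally have "nsq n (y u) = 0" by (simp add: cip_self)
    with \<open>y u i \<noteq> 0\<close> i show False by (simp add: nsq_eq_0_iff)
  qed
  \<comment> \<open>Division determines \<open>x\<close> only up to the kernel of A - u, so the
    component at \<open>u\<close> is defined as the remainder. That this remainder is an eigenvector
    is the computation \<open>zu\<close>.\<close>
  define z where "z s = (if s = u then (\<lambda>i. x i - (\<Sum>r\<in>S - {u}. y r i / (r - u)))
    else (\<lambda>i. (1 / (s - u)) * y s i))" for s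
  have zs: "act n A (z s) i = s * z s i" if "s \<in> S - {u}" "i < n" for s i
    using that ev unfolding z_def by (simp add: act_scale del: times_divide_eq_left)
  have zu: "act n A (z u) i = u * z u i" if i: "i < n" for i
  proof -
    have "act n A (z u) i = act n A x i - (\<Sum>r\<in>S-{u}. act n A (\<lambda>i. (1 / (r - u)) * y r i) i)"
      unfolding z_def by (simp add: act_diff act_sum)
    also have "(\<Sum>r\<in>S-{u}. act n A (\<lambda>i. (1 / (r - u)) * y r i) i)
        = (\<Sum>r\<in>S-{u}. y r i + u * (y r i / (r - u)))"
    proof (rule sum.cong[OF refl])
      fix r assume r: "r \<in> S - {u}"
      then have "r - u \<noteq> 0" by auto
      then show "act n A (\<lambda>i. (1 / (r - u)) * y r i) i = y r i + u * (y r i / (r - u))"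
        using r i ev[of r i] by (subst act_scale) (auto simp: field_simps)
    qed
    also have "\<dots> = (\<Sum>r\<in>S-{u}. y r i) + u * (\<Sum>r\<in>S-{u}. y r i / (r - u))"
      by (simp add: sum.distrib sum_distrib_left)
    also have "(\<Sum>r\<in>S-{u}. y r i) = (\<Sum>r\<in>S. y r i)"
      using fin y0 i by (intro sum.mono_neutral_left) auto
    also have "\<dots> = act n A x i - u * x i" using sum i by simp
    finally show ?thesis unfolding z_def by (simp add: algebra_simps)
  qed
  have "eigen_sum n A x (insert u S) z"
    unfolding eigen_sum_def
  proof (intro conjI allI impI ballI)
    show "finite (insert u S)" using fin by simp
    fix i assume i: "i < n"
    have "(\<Sum>s\<in>insert u S. z s i) = z u i + (\<Sum>s\<in>S-{u}. z s i)"
      using fin by (simp add: sum.insert_remove)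
    also have "(\<Sum>s\<in>S-{u}. z s i) = (\<Sum>r\<in>S-{u}. y r i / (r - u))"
      by (intro sum.cong) (auto simp: z_def)
    finally show "x i = (\<Sum>s\<in>insert u S. z s i)" by (simp add: z_def)
  next
    fix s i assume "s \<in> insert u S" "i < n"
    then show "act n A (z s) i = s * z s i" using zs zu by (cases "s = u") auto
  qed
  then show ?thesis by blast
qed

text \<open>The Schur form supplies a flag: if \<open>y\<close> lives on the first k + 1
  coordinates, then B - u with u = B(k, k) sends it into the first k, because B is upper triangular.
  By induction (A - u) P y is decomposed, and \<open>eigen_sum_step\<close> lifts this to P y.
  Orthogonality is supplied there too, so an invertible \<open>P\<close> suffices.\<close>

theorem hermitian_eigen_sum:
  assumes A: "hermitian_mat n A"
  shows "\<exists>S y. eigen_sum n A x S y"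
proof -
  note Ac = hermitian_carrier[OF A]
  obtain es where "char_poly A = (\<Prod>a\<leftarrow>es. [:- a, 1:])"
    using char_poly_factorized[OF Ac] by blast
  from schur_decomposition_exists[OF Ac this]
  obtain B where "B \<in> carrier_mat n n" and tri: "upper_triangular B" and "similar_mat A B" by blast
  then obtain P Q where sim: "similar_mat_wit A B P Q" unfolding similar_mat_def by blast
  note D = similar_mat_witD2[OF Ac sim]
  have B: "B \<in> carrier_mat n n" and P: "P \<in> carrier_mat n n" and Q: "Q \<in> carrier_mat n n"
    and PQ: "P * Q = 1\<^sub>m n" and QP: "Q * P = 1\<^sub>m n" and AB: "A = P * B * Q" using D by auto
  have AP: "A * P = P * B"
  proof -
    have "A * P = P * B * (Q * P)"
      unfolding AB by (rule assoc_mult_mat[of _ n n _ n _ n]) (use P B Q in auto)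
    then show ?thesis using P B by (simp add: QP)
  qed
  have main: "\<exists>S z. eigen_sum n A (act n P y) S z" if "k \<le> n" "\<forall>i<n. k \<le> i \<longrightarrow> y i = 0" for k y
    using that
  proof (induction k arbitrary: y)
    case 0
    then have "eigen_sum n A (act n P y) {} (\<lambda>_ _. 0)"
      by (auto simp: eigen_sum_def act_def intro!: sum.neutral)
    then show ?case by blast
  next
    case (Suc k)
    define u where "u = B $$ (k, k)"
    define y' where "y' = (\<lambda>i. act n B y i - u * y i)"
    have "y' i = 0" if i: "i < n" "k \<le> i" for i
    proof -
      have "act n B y i = (\<Sum>j<n. if j = k then B $$ (i, k) * y k else 0)"
        unfolding act_def
      proof (intro sum.cong refl)
        fix j assume "j \<in> {..<n}"
        then show "B $$ (i, j) * y j = (if j = k then B $$ (i, k) * y k else 0)"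
          using i Suc.prems tri B unfolding upper_triangular_def
          by (cases "j < i"; cases "j = k") auto
      qed
      also have "\<dots> = B $$ (i, k) * y k" using Suc.prems by simp
      also have "\<dots> = u * y i"
        using i Suc.prems tri B unfolding upper_triangular_def u_def by (cases "i = k") auto
      finally show ?thesis by (simp add: y'_def)
    qed
    with Suc.IH[of y'] Suc.prems obtain S z where z: "eigen_sum n A (act n P y') S z" by auto
    have "act n P y' i = act n A (act n P y) i - u * act n P y i" if i: "i < n" for i
    proof -
      have "act n A (act n P y) i = act n P (act n B y) i"
        using act_mult[OF Ac P i] act_mult[OF P B i] AP by simp
      then show ?thesis unfolding y'_def by (simp add: act_diff act_scale)
    qed
    then have "eigen_sum n A (\<lambda>i. act n A (act n P y) i - u * act n P y i) S z"
      using z unfolding eigen_sum_def by auto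
    from eigen_sum_step[OF A this] show ?case .
  qed
  obtain S z where "eigen_sum n A (act n P (act n Q x)) S z"
    using main[of n "act n Q x"] by auto
  moreover have "act n P (act n Q x) i = x i" if "i < n" for i
    using act_mult[OF P Q that, of x] PQ act_one[OF that] by simp
  ultimately have "eigen_sum n A x S z" unfolding eigen_sum_def by auto
  then show ?thesis by blast
qed

text \<open>Pythagoras for the orthogonal components. The sum with weights \<open>g\<close> is g(A)
  x in the sense of functional calculus; it serves with g(s) equal to 1, to s - \<mu> and to 1 - (s
  - \<mu>)^2 / M.\<close>

lemma nsq_eigen_sum:
  assumes A: "hermitian_mat n A" and S: "eigen_sum n A x S y"
  shows "nsq n (\<lambda>i. \<Sum>s\<in>S. g s * y s i) = (\<Sum>s\<in>S. (cmod (g s))\<^sup>2 * nsq n (y s))"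
proof -
  have fin: "finite S" and ev: "\<And>s. s \<in> S \<Longrightarrow> \<forall>i<n. act n A (y s) i = s * y s i"
    using S unfolding eigen_sum_def by auto
  have "complex_of_real (nsq n (\<lambda>i. \<Sum>s\<in>S. g s * y s i))
      = (\<Sum>s\<in>S. \<Sum>r\<in>S. g s * (cnj (g r) * cip n (y s) (y r)))"
    by (simp add: cip_self[symmetric] cip_sum_left cip_sum_right cip_scale_left cip_scale_right
        sum_distrib_left)
  also have "\<dots> = (\<Sum>s\<in>S. \<Sum>r\<in>S. if r = s then g s * (cnj (g s) * cip n (y s) (y s)) else 0)"
    using hermitian_eigenvectors_orthogonal[OF A ev ev] by (intro sum.cong refl) auto
  also have "\<dots> = (\<Sum>s\<in>S. g s * (cnj (g s) * cip n (y s) (y s)))" using fin by simp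
  also have "\<dots> = of_real (\<Sum>s\<in>S. (cmod (g s))\<^sup>2 * nsq n (y s))"
    proof -
      have "g s * (cnj (g s) * cip n (y s) (y s)) = of_real ((cmod (g s))\<^sup>2 * nsq n (y s))" for s
        unfolding of_real_mult complex_norm_square cip_self by (simp add: mult_ac)
      then show ?thesis by simp
    qed
  finally show ?thesis by (simp only: of_real_eq_iff)
qed

lemma nsq_eigen_sum_1:
  assumes A: "hermitian_mat n A" and S: "eigen_sum n A x S y"
  shows "nsq n x = (\<Sum>s\<in>S. nsq n (y s))"
proof -
  have "nsq n x = nsq n (\<lambda>i. \<Sum>s\<in>S. 1 * y s i)"
    using S unfolding eigen_sum_def by (intro nsq_cong) auto
  then show ?thesis using nsq_eigen_sum[OF assms, of "\<lambda>_. 1"] by simp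
qed

lemma eigen_sum_eigenvalue:
  assumes A: "hermitian_mat n A" and S: "eigen_sum n A x S y" and "s \<in> S" "nsq n (y s) \<noteq> 0"
  shows "eigenvalue A s" "of_real (Re s) = s"
proof -
  obtain i where "i < n" "y s i \<noteq> 0" using assms(4) unfolding nsq_eq_0_iff by blast
  moreover have "\<forall>i<n. act n A (y s) i = s * y s i" using S assms(3) by (simp add: eigen_sum_def)
  ultimately show "eigenvalue A s"
    by (subst eigenvalue_iff_act[OF hermitian_carrier[OF A]], intro exI[of _ "y s"]) auto
  then show "of_real (Re s) = s" using hermitian_eigenvalue_real[OF A] by blast
qed

lemma act_eigen_sum:
  assumes S: "eigen_sum n A x S y" and "i < n"
  shows "act n A x i - \<mu> * x i = (\<Sum>s\<in>S. (s - \<mu>) * y s i)"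
proof -
  have "act n A x i = act n A (\<lambda>i. \<Sum>s\<in>S. y s i) i"
    using S unfolding eigen_sum_def by (intro act_cong) auto
  then show ?thesis
    using assms unfolding eigen_sum_def
    by (simp add: act_sum sum_subtractf sum_distrib_left algebra_simps)
qed

lemma act_eigen_sum_square:
  assumes S: "eigen_sum n A x S y" and "i < n"
  shows "act n A (\<lambda>i. act n A x i - \<mu> * x i) i - \<mu> * (act n A x i - \<mu> * x i)
    = (\<Sum>s\<in>S. (s - \<mu>)\<^sup>2 * y s i)"
proof -
  have "eigen_sum n A (\<lambda>i. act n A x i - \<mu> * x i) S (\<lambda>s i. (s - \<mu>) * y s i)"
    using act_eigen_sum[OF S] S unfolding eigen_sum_def by (auto simp: act_scale)
  from act_eigen_sum[OF this \<open>i < n\<close>, of \<mu>] show ?thesis by (simp add: power2_eq_square mult.assoc)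
qed

text \<open>If every eigenvalue were farther than \<delta> from \<mu>, then A - \<mu> would stretch
  each nonzero component of \<open>x\<close> by more than \<delta>, and the residual would be too
  large. The number \<mu> is complex because the approximate eigenvalue of the expansion is written
  with a complex diagonal entry.\<close>

theorem hermitian_residual:
  assumes A: "hermitian_mat n A" and x: "nsq n x \<noteq> 0" and "0 \<le> \<delta>"
    and res: "nsq n (\<lambda>i. act n A x i - \<mu> * x i) \<le> \<delta>\<^sup>2 * nsq n x"
  shows "\<exists>l::real. eigenvalue A (of_real l) \<and> cmod (of_real l - \<mu>) \<le> \<delta>"
proof (rule ccontr)
  assume far: "\<not> ?thesis"
  obtain S y where S: "eigen_sum n A x S y" using hermitian_eigen_sum[OF A] by blast
  have fin: "finite S" using S unfolding eigen_sum_def by auto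
  have "nsq n (\<lambda>i. act n A x i - \<mu> * x i) = nsq n (\<lambda>i. \<Sum>s\<in>S. (s - \<mu>) * y s i)"
    using act_eigen_sum[OF S] by (intro nsq_cong) auto
  then have eq: "nsq n (\<lambda>i. act n A x i - \<mu> * x i) = (\<Sum>s\<in>S. (cmod (s - \<mu>))\<^sup>2 * nsq n (y s))"
    by (simp add: nsq_eigen_sum[OF A S])
  have gt: "\<delta>\<^sup>2 * nsq n (y s) < (cmod (s - \<mu>))\<^sup>2 * nsq n (y s)" if "s \<in> S" "nsq n (y s) \<noteq> 0" for s
  proof -
    have "eigenvalue A (of_real (Re s))" "of_real (Re s) = s"
      using eigen_sum_eigenvalue[OF A S that] by auto
    then have "\<delta> < cmod (s - \<mu>)" using far by (metis not_le)
    then have "\<delta>\<^sup>2 < (cmod (s - \<mu>))\<^sup>2" using \<open>0 \<le> \<delta>\<close> by (intro power_strict_mono) auto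
    then show ?thesis using that nsq_nonneg[of n "y s"] by simp
  qed
  have "\<exists>s\<in>S. nsq n (y s) \<noteq> 0"
    using x nsq_eigen_sum_1[OF A S] by (metis sum.neutral)
  then have "(\<Sum>s\<in>S. \<delta>\<^sup>2 * nsq n (y s)) < (\<Sum>s\<in>S. (cmod (s - \<mu>))\<^sup>2 * nsq n (y s))"
    using gt fin by (intro sum_strict_mono_ex1) (auto, metis less_imp_le mult_zero_right order_refl)
  then show False
    using res unfolding eq nsq_eigen_sum_1[OF A S] by (simp add: sum_distrib_left)
qed

text \<open>The norm of g(A) is at most a bound for |g| on the spectrum. Testing real arguments is
  enough, since a component whose index is not a real eigenvalue vanishes.\<close>

lemma eigen_sum_bound:
  assumes A: "hermitian_mat n A" and S: "eigen_sum n A x S y" and "0 \<le> K"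
    and g: "\<And>l::real. eigenvalue A (of_real l) \<Longrightarrow> cmod (g (of_real l)) \<le> K"
  shows "nsq n (\<lambda>i. \<Sum>s\<in>S. g s * y s i) \<le> K\<^sup>2 * nsq n x"
proof -
  have "(cmod (g s))\<^sup>2 * nsq n (y s) \<le> K\<^sup>2 * nsq n (y s)" if s: "s \<in> S" for s
  proof (cases "nsq n (y s) = 0")
    case False
    have "cmod (g s) \<le> K" using g[of "Re s"] eigen_sum_eigenvalue[OF A S s False] by simp
    then show ?thesis by (intro mult_right_mono power_mono) (auto simp: nsq_nonneg)
  qed simp
  then show ?thesis
    unfolding nsq_eigen_sum[OF A S] nsq_eigen_sum_1[OF A S] sum_distrib_left by (rule sum_mono)
qed

lemma hermitian_bound:
  assumes A: "hermitian_mat n A" and "0 \<le> K"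
    and g: "\<And>l::real. eigenvalue A (of_real l) \<Longrightarrow> cmod (of_real l - \<mu>) \<le> K"
  shows "nsq n (\<lambda>i. act n A x i - \<mu> * x i) \<le> K\<^sup>2 * nsq n x"
proof -
  obtain S y where S: "eigen_sum n A x S y" using hermitian_eigen_sum[OF A] by blast
  have "nsq n (\<lambda>i. act n A x i - \<mu> * x i) = nsq n (\<lambda>i. \<Sum>s\<in>S. (s - \<mu>) * y s i)"
    using act_eigen_sum[OF S] by (intro nsq_cong) auto
  with eigen_sum_bound[OF A S \<open>0 \<le> K\<close>, of "\<lambda>s. s - \<mu>"] g show ?thesis by simp
qed

text \<open>The vector on the left is (1 - (A - \<mu>)^2 / M) x written out with \<open>act\<close>,
  so functional calculus applies with the scalar 1 - (s - \<mu>)^2 / M.\<close>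

lemma hermitian_contraction:
  assumes A: "hermitian_mat n A" and "0 \<le> \<rho>"
    and g: "\<And>l::real. eigenvalue A (of_real l) \<Longrightarrow> cmod (1 - (of_real l - \<mu>)\<^sup>2 / M) \<le> \<rho>"
  shows "nsq n (\<lambda>i. x i - (act n A (\<lambda>i. act n A x i - \<mu> * x i) i - \<mu> * (act n A x i - \<mu> * x i)) / M)
    \<le> \<rho>\<^sup>2 * nsq n x"
proof -
  obtain S y where S: "eigen_sum n A x S y" using hermitian_eigen_sum[OF A] by blast
  have "x i - (act n A (\<lambda>i. act n A x i - \<mu> * x i) i - \<mu> * (act n A x i - \<mu> * x i)) / M
      = (\<Sum>s\<in>S. (1 - (s - \<mu>)\<^sup>2 / M) * y s i)" if "i < n" for i
    unfolding act_eigen_sum_square[OF S that] using that S unfolding eigen_sum_def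
    by (simp add: left_diff_distrib sum_subtractf sum_divide_distrib)
  then have "nsq n (\<lambda>i. x i - (act n A (\<lambda>i. act n A x i - \<mu> * x i) i - \<mu> * (act n A x i - \<mu> * x i)) / M)
      = nsq n (\<lambda>i. \<Sum>s\<in>S. (1 - (s - \<mu>)\<^sup>2 / M) * y s i)"
    by (intro nsq_cong) auto
  with eigen_sum_bound[OF A S \<open>0 \<le> \<rho>\<close>, of "\<lambda>s. 1 - (s - \<mu>)\<^sup>2 / M"] g
  show ?thesis by simp
qed

text \<open>Cauchy-Schwarz in every row. The resulting operator norm bound n R is crude but depends
  only on the size of the entries.\<close>

lemma nsq_act_le:
  assumes "\<And>i j. i < n \<Longrightarrow> j < n \<Longrightarrow> cmod (A $$ (i, j)) \<le> R" "0 \<le> R"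
  shows "nsq n (act n A x) \<le> (real n * R)\<^sup>2 * nsq n x"
proof -
  have "(cmod (act n A x i))\<^sup>2 \<le> real n * R\<^sup>2 * nsq n x" if i: "i < n" for i
  proof -
    have "cmod (act n A x i) \<le> (\<Sum>j<n. R * cmod (x j))"
      unfolding act_def using assms i
      by (intro sum_norm_le) (auto simp: norm_mult intro!: mult_right_mono)
    then have "(cmod (act n A x i))\<^sup>2 \<le> (R * (\<Sum>j<n. cmod (x j)))\<^sup>2"
      by (intro power_mono) (auto simp: sum_distrib_left)
    also have "\<dots> = R\<^sup>2 * (\<Sum>j<n. cmod (x j))\<^sup>2" by (simp add: power_mult_distrib)
    also have "\<dots> \<le> R\<^sup>2 * ((\<Sum>j<n. (cmod (x j))\<^sup>2) * real n)"
      using sum_squared_le_sum_of_squares[of "\<lambda>j. cmod (x j)" "{..<n}"]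
      by (intro mult_left_mono) (auto simp: mult.commute)
    finally show ?thesis by (simp add: nsq_def mult_ac)
  qed
  then have "nsq n (act n A x) \<le> (\<Sum>i<n. real n * R\<^sup>2 * nsq n x)"
    unfolding nsq_def[of n "act n A x"] by (intro sum_mono) auto
  also have "\<dots> = (real n * R)\<^sup>2 * nsq n x" by (simp add: power2_eq_square)
  finally show ?thesis .
qed

lemma eigenvalue_norm_le:
  assumes A: "A \<in> carrier_mat n n" and "eigenvalue A k"
    and R: "\<And>i j. i < n \<Longrightarrow> j < n \<Longrightarrow> cmod (A $$ (i, j)) \<le> R" "0 \<le> R"
  shows "cmod k \<le> real n * R"
proof -
  obtain x where x: "nsq n x \<noteq> 0" and ev: "\<forall>i<n. act n A x i = k * x i"
    using assms(2) unfolding eigenvalue_iff_act[OF A] nsq_eq_0_iff by auto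
  have "(cmod k)\<^sup>2 * nsq n x = nsq n (act n A x)"
    unfolding nsq_def using ev by (simp add: sum_distrib_left norm_mult power_mult_distrib)
  also have "\<dots> \<le> (real n * R)\<^sup>2 * nsq n x" by (rule nsq_act_le[OF R])
  finally have "(cmod k)\<^sup>2 \<le> (real n * R)\<^sup>2" using x nsq_nonneg[of n x] by simp
  then show ?thesis using R(2) by (simp add: power2_le_iff_abs_le)
qed

section \<open>Ordered eigenvalues and their localization\<close>

definition eigenvalue_list :: "complex mat \<Rightarrow> real list" where
  "eigenvalue_list A = sorted_list_of_multiset (image_mset Re (proots (char_poly A)))"

lemma nth_eigenvalue_list: "nth_eigenvalue A n = eigenvalue_list A ! n"
  by (simp add: nth_eigenvalue_def eigenvalue_list_def)

lemma sorted_eigenvalue_list: "sorted (eigenvalue_list A)"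
  by (simp add: eigenvalue_list_def)

lemma length_eigenvalue_list:
  assumes "A \<in> carrier_mat n n"
  shows "length (eigenvalue_list A) = n"
proof -
  have "length (eigenvalue_list A) = size (image_mset Re (proots (char_poly A)))"
    by (metis eigenvalue_list_def mset_sorted_list_of_multiset size_mset)
  then show ?thesis using degree_monic_char_poly[OF assms] by (simp add: size_proots_complex)
qed

lemma set_eigenvalue_list:
  assumes A: "hermitian_mat n A"
  shows "set (eigenvalue_list A) = {l. eigenvalue A (of_real l)}"
proof -
  note Ac = hermitian_carrier[OF A]
  have "char_poly A \<noteq> 0" using degree_monic_char_poly[OF Ac] by force
  then have "set (eigenvalue_list A) = Re ` {k. eigenvalue A k}"
    by (simp add: eigenvalue_list_def eigenvalue_root_char_poly[OF Ac])
  also have "\<dots> = {l. eigenvalue A (of_real l)}"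
    using hermitian_eigenvalue_real[OF A] by (force simp: image_iff)
  finally show ?thesis .
qed

text \<open>Upward induction from 0 gives \<open>k \<le> p k\<close>, and downward induction from n
  - 1 gives the reverse inequality; the second induction runs over the distance from n - 1.\<close>

lemma strict_mono_self_map:
  fixes p :: "nat \<Rightarrow> nat"
  assumes "\<And>i j. i < j \<Longrightarrow> j < n \<Longrightarrow> p i < p j" "\<And>i. i < n \<Longrightarrow> p i < n" "i < n"
  shows "p i = i"
proof -
  have ge: "k \<le> p k" if "k < n" for k
    using that
  proof (induction k)
    case (Suc k)
    then show ?case using assms(1)[of k "Suc k"] by simp
  qed simp
  have "p (n - 1 - k) \<le> n - 1 - k" if "k < n" for k
    using that
  proof (induction k)
    case 0
    then show ?case using assms(2)[of "n - 1"] by simp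
  next
    case (Suc k)
    then have "n - 1 - Suc k < n - 1 - k" "n - 1 - k < n" by auto
    with Suc assms(1)[of "n - 1 - Suc k" "n - 1 - k"] show ?case by linarith
  qed
  from this[of "n - 1 - i"] ge[OF assms(3)] assms(3) show ?thesis by simp
qed

text \<open>The intervals of radius \<open>r\<close> about the \<open>c i\<close> are disjoint and
  ordered, so the positions of list entries chosen in them increase strictly with \<open>i\<close>.
  A strictly increasing self-map of the positions is the identity, which turns mere existence of
  nearby entries into a statement about the i-th one.\<close>

lemma sorted_localization:
  fixes xs :: "real list" and c :: "nat \<Rightarrow> real"
  assumes "sorted xs" "length xs = n"
    and near: "\<And>i. i < n \<Longrightarrow> \<exists>k<n. \<bar>xs ! k - c i\<bar> \<le> r"
    and gap: "\<And>i j. i < j \<Longrightarrow> j < n \<Longrightarrow> c i + 2 * r < c j" and "i < n"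
  shows "\<bar>xs ! i - c i\<bar> \<le> r"
proof -
  obtain p where p: "\<And>i. i < n \<Longrightarrow> p i < n" "\<And>i. i < n \<Longrightarrow> \<bar>xs ! p i - c i\<bar> \<le> r"
  proof -
    have "\<forall>i. \<exists>k. i < n \<longrightarrow> k < n \<and> \<bar>xs ! k - c i\<bar> \<le> r" using near by blast
    from choice[OF this] show ?thesis using that by blast
  qed
  have "p i < p j" if "i < j" "j < n" for i j
  proof (rule ccontr)
    assume "\<not> p i < p j"
    then have "xs ! p j \<le> xs ! p i"
      using assms(1,2) p(1)[of i] that by (intro sorted_nth_mono) auto
    then show False using p(2)[of i] p(2)[of j] that gap[of i j] by linarith
  qed
  then have "p i = i" using strict_mono_self_map[of n p] p(1) assms(5) by blast
  then show ?thesis using p(2)[OF assms(5)] by simp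
qed

section \<open>Strong coupling\<close>

lemma increasing_gap:
  fixes q :: "nat \<Rightarrow> real"
  assumes "\<And>j k. j < k \<Longrightarrow> k < n \<Longrightarrow> q j < q k"
  shows "\<exists>g>0. \<forall>j k. j < k \<longrightarrow> k < n \<longrightarrow> q j + g \<le> q k"
proof -
  \<comment> \<open>The extra 1 keeps \<open>D\<close> nonempty when there is no pair
    \<open>j < k\<close>.\<close>
  define D where "D = insert 1 ((\<lambda>(j, k). q k - q j) ` {(j, k). j < k \<and> k < n})"
  have "{(j, k). j < k \<and> k < n} \<subseteq> {..<n} \<times> {..<n}" by auto
  then have "finite {(j, k). j < k \<and> k < n}" by (rule finite_subset) auto
  then have fin: "finite D" unfolding D_def by (intro finite.insertI finite_imageI)
  have "Min D > 0" using fin assms by (subst Min_gr_iff) (auto simp: D_def)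
  moreover have "q j + Min D \<le> q k" if "j < k" "k < n" for j k
    using Min_le[OF fin, of "q k - q j"] that by (force simp: D_def)
  ultimately show ?thesis by blast
qed

text \<open>The parameter type carries no structure, and \<open>R\<close> and \<open>q\<close> do
  not depend on \<theta>. Every constant obtained here is therefore automatically uniform in the
  parameter.\<close>

locale strong_coupling =
  fixes A :: "'x \<Rightarrow> complex mat" and n :: nat and q :: "nat \<Rightarrow> real" and R :: real
  assumes hermitian: "hermitian_mat n (A \<theta>)"
    and bounded: "i < n \<Longrightarrow> j < n \<Longrightarrow> cmod (A \<theta> $$ (i, j)) \<le> R"
    and R0: "0 \<le> R"
    and increasing: "j < k \<Longrightarrow> k < n \<Longrightarrow> q j < q k"
begin

definition H :: "'x \<Rightarrow> real \<Rightarrow> complex mat" where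
  "H \<theta> t = A \<theta> + of_real t \<cdot>\<^sub>m mat_diag n (\<lambda>j. of_real (q j))"

lemma H_index:
  assumes "i < n" "j < n"
  shows "H \<theta> t $$ (i, j) = A \<theta> $$ (i, j) + (if i = j then of_real (t * q j) else 0)"
  using assms hermitian_carrier[OF hermitian[of \<theta>]] by (auto simp: H_def mat_diag_def)

lemma H_hermitian: "hermitian_mat n (H \<theta> t)"
proof -
  have "H \<theta> t \<in> carrier_mat n n"
    using hermitian_carrier[OF hermitian[of \<theta>]] by (auto simp: H_def mat_diag_def)
  moreover have "H \<theta> t $$ (j, i) = cnj (H \<theta> t $$ (i, j))" if "i < n" "j < n" for i j
  proof -
    have "A \<theta> $$ (j, i) = cnj (A \<theta> $$ (i, j))" using that hermitian unfolding hermitian_mat_def by blast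
    then show ?thesis using that by (simp add: H_index)
  qed
  ultimately show ?thesis unfolding hermitian_mat_def by blast
qed

lemma H_act:
  assumes "i < n"
  shows "act n (H \<theta> t) x i = act n (A \<theta>) x i + of_real (t * q i) * x i"
proof -
  have "act n (H \<theta> t) x i = (\<Sum>j<n. A \<theta> $$ (i, j) * x j + (if j = i then of_real (t * q i) * x i else 0))"
    unfolding act_def using assms by (intro sum.cong refl) (auto simp: H_index algebra_simps)
  then show ?thesis using assms by (simp add: act_def sum.distrib)
qed

text \<open>At \<open>t * q k\<close>, the k-th unit vector has the k-th column of
  \<open>A \<theta>\<close> as its residual: the diagonal part cancels exactly, for every
  \<open>t\<close>. The norm of that column is at most sqrt n R, coarsened here to n R.\<close>

lemma eigenvalue_near_diagonal:
  assumes "k < n"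
  shows "\<exists>l. eigenvalue (H \<theta> t) (of_real l) \<and> \<bar>l - t * q k\<bar> \<le> real n * R"
proof -
  define e where "e i = (if i = k then 1 else 0 :: complex)" for i
  have act_e: "act n (A \<theta>) e i = A \<theta> $$ (i, k)" for i
  proof -
    have "act n (A \<theta>) e i = (\<Sum>j<n. if j = k then A \<theta> $$ (i, k) else 0)"
      unfolding act_def e_def by (intro sum.cong) auto
    then show ?thesis using assms by simp
  qed
  have nsq_e: "nsq n e = 1"
  proof -
    have "nsq n e = (\<Sum>j<n. if j = k then 1 else 0)"
      unfolding nsq_def e_def by (intro sum.cong) auto
    then show ?thesis using assms by simp
  qed
  have "nsq n (\<lambda>i. act n (H \<theta> t) e i - of_real (t * q k) * e i) = nsq n (\<lambda>i. A \<theta> $$ (i, k))"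
    by (intro nsq_cong) (auto simp: H_act act_e e_def)
  also have "\<dots> \<le> (\<Sum>i<n. R\<^sup>2)"
    unfolding nsq_def using bounded[OF _ assms] by (intro sum_mono power_mono) auto
  also have "\<dots> \<le> (real n * R)\<^sup>2 * nsq n e"
  proof -
    have "real n * R\<^sup>2 \<le> real n * real n * R\<^sup>2" using assms by (intro mult_right_mono) auto
    then show ?thesis by (simp add: nsq_e power2_eq_square mult_ac)
  qed
  finally have "\<exists>l::real. eigenvalue (H \<theta> t) (of_real l) \<and> cmod (of_real l - of_real (t * q k)) \<le> real n * R"
    using nsq_e R0 by (intro hermitian_residual[OF H_hermitian, of e]) auto
  then show ?thesis unfolding of_real_diff[symmetric] norm_of_real .
qed

lemma eigenvalue_nth:
  assumes "eigenvalue (H \<theta> t) (of_real l)"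
  shows "\<exists>k<n. l = eigenvalue_list (H \<theta> t) ! k"
  using assms set_eigenvalue_list[OF H_hermitian]
    length_eigenvalue_list[OF hermitian_carrier[OF H_hermitian]]
  by (metis in_set_conv_nth mem_Collect_eq)

lemma nth_eigenvalue_eigenvalue:
  assumes "k < n"
  shows "eigenvalue (H \<theta> t) (of_real (nth_eigenvalue (H \<theta> t) k))"
  using assms set_eigenvalue_list[OF H_hermitian]
    length_eigenvalue_list[OF hermitian_carrier[OF H_hermitian]]
  unfolding nth_eigenvalue_list by (metis nth_mem mem_Collect_eq)

text \<open>The radius \<open>r\<close> is left to the caller, since eigenvalues produced by
  different trial vectors are located near \<open>t * q k\<close> with different precision. The last
  property is the uniqueness that a residual alone cannot give: an eigenvalue found within
  \<open>r\<close> of \<open>t * q k\<close> must be the k-th.\<close>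

lemma strong_coupling_separation:
  obtains t0 where "1 \<le> t0"
    and "\<And>t i j. t0 \<le> t \<Longrightarrow> i < j \<Longrightarrow> j < n \<Longrightarrow> t * q i + 2 * r < t * q j"
    and "\<And>t \<theta> k. t0 \<le> t \<Longrightarrow> k < n \<Longrightarrow> \<bar>nth_eigenvalue (H \<theta> t) k - t * q k\<bar> \<le> real n * R"
    and "\<And>t \<theta> k l. t0 \<le> t \<Longrightarrow> k < n \<Longrightarrow> eigenvalue (H \<theta> t) (of_real l) \<Longrightarrow>
      \<bar>l - t * q k\<bar> \<le> r \<Longrightarrow> l = nth_eigenvalue (H \<theta> t) k"
proof -
  obtain g where g: "g > 0" "\<And>j k. j < k \<Longrightarrow> k < n \<Longrightarrow> q j + g \<le> q k"
    using increasing_gap[of n q] increasing by blast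
  define r' where "r' = max r (real n * R)"
  have r'0: "0 \<le> r'" using R0 by (simp add: r'_def le_max_iff_disj)
  define t0 where "t0 = max 1 ((2 * r' + 1) / g)"
  have gap: "t * q i + 2 * r' < t * q j" if "t0 \<le> t" "i < j" "j < n" for t i j
  proof -
    have t: "t > 0" "(2 * r' + 1) / g \<le> t" using that(1) by (auto simp: t0_def)
    then have "2 * r' + 1 \<le> t * g" using g(1) by (simp add: pos_divide_le_eq)
    also have "\<dots> \<le> t * (q j - q i)" using g(2)[OF that(2,3)] t by (intro mult_left_mono) auto
    finally show ?thesis by (simp add: algebra_simps)
  qed
  have near: "\<bar>nth_eigenvalue (H \<theta> t) k - t * q k\<bar> \<le> real n * R" if "t0 \<le> t" "k < n" for t \<theta> k
    unfolding nth_eigenvalue_list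
  proof (rule sorted_localization[where n = n])
    show "sorted (eigenvalue_list (H \<theta> t))" by (rule sorted_eigenvalue_list)
    show "length (eigenvalue_list (H \<theta> t)) = n"
      by (rule length_eigenvalue_list[OF hermitian_carrier[OF H_hermitian]])
    show "\<exists>k<n. \<bar>eigenvalue_list (H \<theta> t) ! k - t * q i\<bar> \<le> real n * R" if "i < n" for i
      using eigenvalue_near_diagonal[OF that, of \<theta> t] eigenvalue_nth by metis
    show "t * q i + 2 * (real n * R) < t * q j" if "i < j" "j < n" for i j
      using gap[OF \<open>t0 \<le> t\<close> that] by (simp add: r'_def)
  qed (use that in auto)
  show thesis
  proof (rule that[of t0])
    show "1 \<le> t0" by (simp add: t0_def)
    show "t * q i + 2 * r < t * q j" if "t0 \<le> t" "i < j" "j < n" for t i j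
      using gap[OF that] by (simp add: r'_def)
    show "\<bar>nth_eigenvalue (H \<theta> t) k - t * q k\<bar> \<le> real n * R" if "t0 \<le> t" "k < n" for t \<theta> k
      by (rule near[OF that])
    fix t \<theta> k l assume t: "t0 \<le> t" and k: "k < n"
      and "eigenvalue (H \<theta> t) (of_real l)" and l: "\<bar>l - t * q k\<bar> \<le> r"
    then obtain j where j: "j < n" "l = nth_eigenvalue (H \<theta> t) j"
      using eigenvalue_nth unfolding nth_eigenvalue_list by blast
    have "\<bar>t * q j - t * q k\<bar> \<le> 2 * r'"
      using near[OF t j(1), of \<theta>] l j(2) by (simp add: r'_def)
    then have "j = k"
      using gap[OF t, of j k] gap[OF t, of k j] j(1) k by (cases j k rule: linorder_cases) auto
    then show "l = nth_eigenvalue (H \<theta> t) k" using j by simp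
  qed
qed

text \<open>The vectors \<open>y\<close> and \<open>z\<close> below are the first two coefficients of the formal perturbation
  series \<open>e\<^sub>k + y / t + z / t\<^sup>2\<close> of the eigenvector; truncation leaves a residual \<open>O(1 / t\<^sup>2)\<close>.\<close>

theorem eigenvalue_expansion:
  "\<exists>K\<ge>0. \<exists>t0\<ge>1. \<forall>t\<ge>t0. \<forall>\<theta>. \<forall>k<n.
     cmod (of_real (nth_eigenvalue (H \<theta> t) k) - (of_real (t * q k) + A \<theta> $$ (k, k) -
       of_real (1 / t * (\<Sum>j\<in>{..<n} - {k}. (cmod (A \<theta> $$ (j, k)))\<^sup>2 / (q j - q k))))) \<le> K / t\<^sup>2"
proof -
  obtain g where g: "g > 0" "\<And>j k. j < k \<Longrightarrow> k < n \<Longrightarrow> q j + g \<le> q k"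
    using increasing_gap[of n q] increasing by blast
  have gap: "g \<le> \<bar>q j - q k\<bar>" if "j < n" "k < n" "j \<noteq> k" for j k
    using g(2)[of j k] g(2)[of k j] that by (cases j k rule: linorder_cases) auto
  \<comment> \<open>\<open>Y\<close> and \<open>Z\<close> bound the entries of the two correction
    vectors, \<open>S\<close> bounds the second order coefficient of the eigenvalue, and
    \<open>W\<close> bounds the residual entries multiplied by t^2.\<close>
  define Y Z S W where "Y = R / g" and "Z = (real n * R * Y + R * Y) / g"
    and "S = real n * (R\<^sup>2 / g)" and "W = real n * R * Z + R * Z + S * Y + S * Z"
  have nonneg: "0 \<le> Y" "0 \<le> Z" "0 \<le> S" "0 \<le> W"
    using R0 g(1) by (auto simp: Y_def Z_def S_def W_def)
  \<comment> \<open>The eigenvalue found will lie within n W of \<mu>, and \<mu> differs from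
    \<open>t * q k\<close> by at most R + S.\<close>
  define r where "r = real n * W + R + S"
  obtain t0 where t0: "1 \<le> t0"
    and uniq: "\<And>t \<theta> k l. t0 \<le> t \<Longrightarrow> k < n \<Longrightarrow> eigenvalue (H \<theta> t) (of_real l) \<Longrightarrow>
      \<bar>l - t * q k\<bar> \<le> r \<Longrightarrow> l = nth_eigenvalue (H \<theta> t) k"
    by (rule strong_coupling_separation[of r], rule that, assumption+)
  have act_le: "cmod (act n (A \<theta>) x i) \<le> real n * R * B"
    if "i < n" "\<And>j. j < n \<Longrightarrow> cmod (x j) \<le> B" for \<theta> x i B
  proof -
    have "cmod (act n (A \<theta>) x i) \<le> (\<Sum>j<n. R * B)"
      unfolding act_def using that bounded[OF that(1), of _ \<theta>] R0
      by (intro sum_norm_le) (auto simp: norm_mult intro!: mult_mono)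
    then show ?thesis by simp
  qed
  have main: "cmod (of_real (nth_eigenvalue (H \<theta> t) k) - (of_real (t * q k) + A \<theta> $$ (k, k) -
       of_real (1 / t * (\<Sum>j\<in>{..<n} - {k}. (cmod (A \<theta> $$ (j, k)))\<^sup>2 / (q j - q k)))))
       \<le> real n * W / t\<^sup>2" if t: "t0 \<le> t" and k: "k < n" for t \<theta> k
  proof -
    define a where "a = A \<theta>"
    define s where "s = (\<Sum>j\<in>{..<n} - {k}. (cmod (a $$ (j, k)))\<^sup>2 / (q j - q k))"
    \<comment> \<open>The trial vector is normalized to have k-th entry exactly 1, whence
      \<open>y k = z k = 0\<close>. For i different from k, the orders 1 and 1/t of the eigenvalue
      equation read (q i - q k) y i + a(i, k) = 0 and (q i - q k) z i + (a y) i - a(k, k) y i =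
      0.\<close>
    define y where "y i = (if i = k then 0 else - a $$ (i, k) / of_real (q i - q k))" for i
    define z where "z i = (if i = k then 0 else
      - (act n a y i - a $$ (k, k) * y i) / of_real (q i - q k))" for i
    define x where "x i = (if i = k then 1 else 0) + y i / of_real t + z i / of_real (t\<^sup>2)" for i
    define \<mu> where "\<mu> = of_real (t * q k) + a $$ (k, k) - of_real (1 / t * s)"
    have t1: "t \<ge> 1" and tpos: "t > 0" using t t0 by auto
    have a_le: "cmod (a $$ (i, j)) \<le> R" if "i < n" "j < n" for i j
      using bounded[OF that] by (simp add: a_def)
    have y_le: "cmod (y i) \<le> Y" if "i < n" for i
      using a_le[OF that k] gap[OF that k] g(1) R0 nonneg
      by (auto simp: y_def Y_def norm_divide simp flip: of_real_diff intro!: frac_le)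
    have z_le: "cmod (z i) \<le> Z" if i: "i < n" for i
    proof (cases "i = k")
      case False
      have "cmod (act n a y i - a $$ (k, k) * y i) \<le> cmod (act n a y i) + cmod (a $$ (k, k) * y i)"
        by (rule norm_triangle_ineq4)
      also have "\<dots> \<le> real n * R * Y + R * Y"
        using act_le[where \<theta>=\<theta>, OF i y_le] a_le[OF k k] y_le[OF i] R0
        by (intro add_mono) (auto simp: norm_mult a_def intro!: mult_mono)
      finally show ?thesis
        using False gap[OF i k] g(1) nonneg R0
        by (auto simp: z_def Z_def norm_divide norm_minus_commute simp flip: of_real_diff intro!: frac_le)
    qed (use nonneg in \<open>simp add: z_def\<close>)
    have s_le: "\<bar>s\<bar> \<le> S"
    proof -
      have "\<bar>s\<bar> \<le> (\<Sum>j\<in>{..<n} - {k}. R\<^sup>2 / g)"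
        unfolding s_def using a_le k gap g(1)
        by (intro order_trans[OF sum_abs] sum_mono) (auto simp: abs_div intro!: frac_le power_mono)
      also have "\<dots> \<le> (\<Sum>j<n. R\<^sup>2 / g)" using g(1) by (intro sum_mono2) auto
      finally show ?thesis by (simp add: S_def)
    qed
    have y_eq: "of_real (q i - q k) * y i = - (if i = k then 0 else a $$ (i, k))" if "i < n" for i
      using gap[OF that k] g(1) by (auto simp: y_def)
    have z_eq: "of_real (q i - q k) * z i = - (if i = k then 0 else act n a y i - a $$ (k, k) * y i)"
      if "i < n" for i
      using gap[OF that k] g(1) by (auto simp: z_def)
    \<comment> \<open>This is the equation of order 1/t in row \<open>k\<close>, where the factor q
      i - q k vanishes and \<open>z\<close> cannot help: it forces the second order coefficient of
      the eigenvalue. Hermitian symmetry produces the squared moduli.\<close>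
    have act_y: "act n a y k = - of_real s"
    proof -
      have "act n a y k = (\<Sum>j\<in>{..<n} - {k}. a $$ (k, j) * y j)"
        unfolding act_def by (intro sum.mono_neutral_right) (auto simp: y_def)
      also have "\<dots> = (\<Sum>j\<in>{..<n} - {k}. - of_real ((cmod (a $$ (j, k)))\<^sup>2 / (q j - q k)))"
      proof (intro sum.cong refl)
        fix j assume j: "j \<in> {..<n} - {k}"
        then have "a $$ (k, j) = cnj (a $$ (j, k))"
          using hermitian k unfolding a_def hermitian_mat_def by blast
        then show "a $$ (k, j) * y j = - of_real ((cmod (a $$ (j, k)))\<^sup>2 / (q j - q k))"
          using j by (simp only: of_real_divide complex_norm_square) (simp add: y_def mult_ac)
      qed
      finally show ?thesis by (simp add: s_def sum_negf)
    qed
    \<comment> \<open>What survives after the orders t, 1 and 1/t have cancelled, multiplied by t^2.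
      The term divided by \<open>t\<close> is the product of the second order coefficient with
      \<open>z\<close>.\<close>
    define E where "E i = act n a z i - a $$ (k, k) * z i + of_real s * y i + of_real s * z i / of_real t" for i
    have res: "act n (H \<theta> t) x i - \<mu> * x i = E i / of_real (t\<^sup>2)" if i: "i < n" for i
    proof -
      define d where "d = (if i = k then 1 else 0 :: complex)"
      define \<tau> where "\<tau> = complex_of_real t"
      have \<tau>: "\<tau> \<noteq> 0" using tpos by (simp add: \<tau>_def)
      have "act n a x i = a $$ (i, k) + act n a y i / \<tau> + act n a z i / \<tau>\<^sup>2"
      proof -
        have "act n a x i = (\<Sum>j<n. (if j = k then a $$ (i, k) else 0) + a $$ (i, j) * y j / \<tau>
            + a $$ (i, j) * z j / \<tau>\<^sup>2)"
          unfolding act_def x_def \<tau>_def by (intro sum.cong refl) (auto simp: algebra_simps)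
        then show ?thesis
          using k by (simp add: sum.distrib act_def sum_divide_distrib)
      qed
      then have "act n (H \<theta> t) x i - \<mu> * x i =
          a $$ (i, k) + act n a y i / \<tau> + act n a z i / \<tau>\<^sup>2
          + (\<tau> * of_real (q i - q k) - a $$ (k, k) + of_real s / \<tau>) * (d + y i / \<tau> + z i / \<tau>\<^sup>2)"
        using i by (simp add: H_act \<mu>_def a_def[symmetric] x_def \<tau>_def[symmetric] d_def algebra_simps)
      also have "\<dots> = a $$ (i, k) + \<tau> * of_real (q i - q k) * d + of_real (q i - q k) * y i - a $$ (k, k) * d
          + (act n a y i + of_real s * d + of_real (q i - q k) * z i - a $$ (k, k) * y i) / \<tau>
          + (act n a z i - a $$ (k, k) * z i + of_real s * y i + of_real s * z i / \<tau>) / \<tau>\<^sup>2"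
        using \<tau> by (simp add: field_simps power2_eq_square)
      also have "\<dots> = E i / of_real (t\<^sup>2)"
        unfolding y_eq[OF i] z_eq[OF i] E_def
        by (cases "i = k") (auto simp: d_def y_def z_def act_y \<tau>_def)
      finally show ?thesis .
    qed
    have E_le: "cmod (E i) \<le> W" if i: "i < n" for i
    proof -
      have "cmod (E i) \<le> cmod (act n a z i) + cmod (a $$ (k, k) * z i) + cmod (of_real s * y i)
          + cmod (of_real s * z i / of_real t)"
        unfolding E_def
        by (intro order_trans[OF norm_triangle_ineq] order_trans[OF norm_triangle_ineq4] add_mono order_refl)
      also have "\<dots> \<le> real n * R * Z + R * Z + S * Y + S * Z"
      proof (intro add_mono)
        show "cmod (act n a z i) \<le> real n * R * Z" using act_le[where \<theta>=\<theta>, OF i z_le] by (simp add: a_def)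
        show "cmod (a $$ (k, k) * z i) \<le> R * Z"
          unfolding norm_mult using a_le[OF k k] z_le[OF i] R0 by (intro mult_mono) auto
        show "cmod (of_real s * y i) \<le> S * Y"
          unfolding norm_mult norm_of_real using s_le y_le[OF i] nonneg by (intro mult_mono) auto
        have "cmod (of_real s * z i / of_real t) \<le> cmod (of_real s * z i) / 1"
          unfolding norm_divide norm_of_real using t1 by (intro divide_left_mono) auto
        also have "\<dots> \<le> S * Z"
          unfolding norm_mult norm_of_real div_by_1 using s_le z_le[OF i] nonneg by (intro mult_mono) auto
        finally show "cmod (of_real s * z i / of_real t) \<le> S * Z" .
      qed
      finally show ?thesis by (simp add: W_def)
    qed
    \<comment> \<open>The k-th entry of \<open>x\<close> equals 1, so the residual needs no
      normalization that depends on \<open>t\<close>.\<close>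
    have nsq_x: "1 \<le> nsq n x"
    proof -
      have "1 = (cmod (x k))\<^sup>2" by (simp add: x_def y_def z_def)
      also have "\<dots> \<le> nsq n x" unfolding nsq_def using k by (intro member_le_sum) auto
      finally show ?thesis .
    qed
    have "nsq n (\<lambda>i. act n (H \<theta> t) x i - \<mu> * x i) = nsq n (\<lambda>i. E i / of_real (t\<^sup>2))"
      using res by (intro nsq_cong) auto
    also have "\<dots> \<le> (\<Sum>i<n. (W / t\<^sup>2)\<^sup>2)"
      unfolding nsq_def norm_divide norm_of_real using E_le
      by (intro sum_mono power_mono) (auto intro!: divide_right_mono)
    also have "\<dots> \<le> (real n * W / t\<^sup>2)\<^sup>2 * 1"
      using k by (auto simp: power_divide power_mult_distrib power2_eq_square[of "real n"]
          intro!: divide_right_mono mult_right_mono)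
    also have "\<dots> \<le> (real n * W / t\<^sup>2)\<^sup>2 * nsq n x" using nsq_x by (intro mult_left_mono) auto
    finally obtain l :: real where l: "eigenvalue (H \<theta> t) (of_real l)"
      and close: "cmod (of_real l - \<mu>) \<le> real n * W / t\<^sup>2"
      using hermitian_residual[OF H_hermitian, of x "real n * W / t\<^sup>2" \<theta> t \<mu>] nsq_x nonneg by auto
    have "\<bar>l - t * q k\<bar> \<le> r"
    proof -
      have "cmod (of_real (l - t * q k)) \<le> cmod (of_real l - \<mu>) + cmod (a $$ (k, k)) + cmod (of_real (1 / t * s))"
      proof -
        have "complex_of_real (l - t * q k) = (of_real l - \<mu>) + a $$ (k, k) - of_real (1 / t * s)"
          by (simp add: \<mu>_def)
        then show ?thesis
          by (metis (no_types) norm_triangle_ineq4 norm_triangle_ineq add_right_mono order_trans)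
      qed
      also have "cmod (of_real l - \<mu>) \<le> real n * W"
        using t1 nonneg by (intro order_trans[OF close]) (auto simp: divide_le_eq_1 mult_le_cancel_left1 intro!: divide_left_mono[of 1 _ "_ * _", simplified])
      also have "cmod (a $$ (k, k)) \<le> R" by (rule a_le[OF k k])
      also have "cmod (of_real (1 / t * s)) \<le> S"
      proof -
        have "\<bar>s\<bar> / t \<le> \<bar>s\<bar> / 1" using t1 by (intro divide_left_mono) auto
        then show ?thesis using s_le t1 unfolding norm_of_real by (simp add: abs_mult)
      qed
      finally show ?thesis unfolding r_def norm_of_real by simp
    qed
    then have "l = nth_eigenvalue (H \<theta> t) k" by (rule uniq[OF t k l])
    with close show ?thesis by (simp add: \<mu>_def s_def a_def)
  qed
  have "0 \<le> real n * W" using nonneg by simp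
  then show ?thesis using main t0 by blast
qed

end

context strong_coupling
begin

lemma diagonal_real:
  assumes "k < n"
  shows "of_real (Re (A \<theta> $$ (k, k))) = A \<theta> $$ (k, k)"
proof -
  have "A \<theta> $$ (k, k) = cnj (A \<theta> $$ (k, k))"
    using hermitian assms unfolding hermitian_mat_def by blast
  then show ?thesis by (metis Reals_cnj_iff of_real_Re)
qed

text \<open>The second order sum is at most S / t with S independent of \<theta>, so it goes into
  the error. Real diagonal entries allow a statement about real functions, as the comparison of band
  lengths requires.\<close>

lemma eigenvalue_first_order:
  "\<exists>K\<ge>0. \<exists>t0\<ge>1. \<forall>t\<ge>t0. \<forall>\<theta>. \<forall>k<n.
     \<bar>nth_eigenvalue (H \<theta> t) k - (t * q k + Re (A \<theta> $$ (k, k)))\<bar> \<le> K / t"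
proof -
  obtain K t0 where K: "K \<ge> 0" "t0 \<ge> 1" and main: "\<And>t \<theta> k. t0 \<le> t \<Longrightarrow> k < n \<Longrightarrow>
     cmod (of_real (nth_eigenvalue (H \<theta> t) k) - (of_real (t * q k) + A \<theta> $$ (k, k) -
       of_real (1 / t * (\<Sum>j\<in>{..<n} - {k}. (cmod (A \<theta> $$ (j, k)))\<^sup>2 / (q j - q k))))) \<le> K / t\<^sup>2"
    using eigenvalue_expansion by blast
  obtain g where g: "g > 0" "\<And>j k. j < k \<Longrightarrow> k < n \<Longrightarrow> q j + g \<le> q k"
    using increasing_gap[of n q] increasing by blast
  have gap: "g \<le> \<bar>q j - q k\<bar>" if "j < n" "k < n" "j \<noteq> k" for j k
    using g(2)[of j k] g(2)[of k j] that by (cases j k rule: linorder_cases) auto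
  define S where "S = real n * (R\<^sup>2 / g)"
  have S0: "0 \<le> S" using g(1) by (simp add: S_def)
  have "\<bar>nth_eigenvalue (H \<theta> t) k - (t * q k + Re (A \<theta> $$ (k, k)))\<bar> \<le> (K + S) / t"
    if t: "t0 \<le> t" and k: "k < n" for t \<theta> k
  proof -
    have t1: "1 \<le> t" using t K by simp
    define s where "s = (\<Sum>j\<in>{..<n} - {k}. (cmod (A \<theta> $$ (j, k)))\<^sup>2 / (q j - q k))"
    have "\<bar>s\<bar> \<le> (\<Sum>j\<in>{..<n} - {k}. R\<^sup>2 / g)"
      unfolding s_def using bounded[OF _ k] k gap g(1)
      by (intro order_trans[OF sum_abs] sum_mono) (auto simp: abs_div intro!: frac_le power_mono)
    also have "\<dots> \<le> (\<Sum>j<n. R\<^sup>2 / g)" using g(1) by (intro sum_mono2) auto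
    finally have s_le: "\<bar>s\<bar> \<le> S" by (simp add: S_def)
    have "complex_of_real (nth_eigenvalue (H \<theta> t) k) - (of_real (t * q k) + A \<theta> $$ (k, k) - of_real (1 / t * s))
        = of_real (nth_eigenvalue (H \<theta> t) k - (t * q k + Re (A \<theta> $$ (k, k)) - 1 / t * s))"
      by (subst diagonal_real[OF k, symmetric]) simp
    with main[OF t k, of \<theta>]
    have "cmod (of_real (nth_eigenvalue (H \<theta> t) k - (t * q k + Re (A \<theta> $$ (k, k)) - 1 / t * s))) \<le> K / t\<^sup>2"
      unfolding s_def[symmetric] by (simp only:)
    then have "\<bar>nth_eigenvalue (H \<theta> t) k - (t * q k + Re (A \<theta> $$ (k, k)) - 1 / t * s)\<bar> \<le> K / t\<^sup>2"
      unfolding norm_of_real .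
    also have "K / t\<^sup>2 \<le> K / t"
      using t1 K(1) by (intro divide_left_mono) (auto simp: power2_eq_square mult_le_cancel_left1)
    finally have "\<bar>nth_eigenvalue (H \<theta> t) k - (t * q k + Re (A \<theta> $$ (k, k)))\<bar> \<le> K / t + \<bar>1 / t * s\<bar>"
      by linarith
    also have "\<bar>1 / t * s\<bar> \<le> S / t" using s_le t1 by (auto simp: abs_mult intro!: divide_right_mono)
    finally show ?thesis by (simp add: add_divide_distrib)
  qed
  then show ?thesis using K S0 by (intro exI[of _ "K + S"] conjI exI[of _ t0]) auto
qed

end

section \<open>Continuity in the parameter and lengths of bands\<close>

locale continuous_strong_coupling = strong_coupling A n q R
  for A :: "'x::metric_space \<Rightarrow> complex mat" and n q R +
  assumes continuous: "i < n \<Longrightarrow> j < n \<Longrightarrow> continuous_on UNIV (\<lambda>\<theta>. A \<theta> $$ (i, j))"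
begin

lemma nth_eigenvalue_continuous:
  "\<exists>t0. \<forall>t\<ge>t0. \<forall>k<n. continuous_on UNIV (\<lambda>\<theta>. nth_eigenvalue (H \<theta> t) k)"
proof -
  \<comment> \<open>The k-th eigenvalue at \<theta> is within n R of \<open>t * q k\<close>, and an
    entrywise change by at most 1 moves it by at most n. Hence the nearby eigenvalue at \<theta>'
    stays in the range where it is recognized as the k-th.\<close>
  define r where "r = real n * R + real n"
  obtain t0 where t0: "1 \<le> t0"
    and near: "\<And>t \<theta> k. t0 \<le> t \<Longrightarrow> k < n \<Longrightarrow> \<bar>nth_eigenvalue (H \<theta> t) k - t * q k\<bar> \<le> real n * R"
    and uniq: "\<And>t \<theta> k l. t0 \<le> t \<Longrightarrow> k < n \<Longrightarrow> eigenvalue (H \<theta> t) (of_real l) \<Longrightarrow>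
      \<bar>l - t * q k\<bar> \<le> r \<Longrightarrow> l = nth_eigenvalue (H \<theta> t) k"
    by (rule strong_coupling_separation[of r], rule that, assumption+)
  have step: "\<bar>nth_eigenvalue (H \<theta>' t) k - nth_eigenvalue (H \<theta> t) k\<bar> \<le> real n * \<epsilon>"
    if t: "t0 \<le> t" and k: "k < n" and \<epsilon>: "0 \<le> \<epsilon>" "\<epsilon> \<le> 1"
      and close: "\<And>i j. i < n \<Longrightarrow> j < n \<Longrightarrow> cmod (A \<theta>' $$ (i, j) - A \<theta> $$ (i, j)) \<le> \<epsilon>" for t k \<theta> \<theta>' \<epsilon>
  proof -
    define l where "l = nth_eigenvalue (H \<theta> t) k"
    obtain x where x: "nsq n x \<noteq> 0" and ev: "\<forall>i<n. act n (H \<theta> t) x i = of_real l * x i"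
      using nth_eigenvalue_eigenvalue[OF k, of \<theta> t]
      unfolding eigenvalue_iff_act[OF hermitian_carrier[OF H_hermitian]] nsq_eq_0_iff l_def by auto
    \<comment> \<open>The diagonal potential cancels between the two parameters, so \<open>D\<close>
      applied to the eigenvector at \<theta> is the whole residual at \<theta>', independently of
      \<open>t\<close>.\<close>
    define D where "D = Matrix.mat n n (\<lambda>(i, j). A \<theta>' $$ (i, j) - A \<theta> $$ (i, j))"
    have "act n (H \<theta>' t) x i - of_real l * x i = act n D x i" if i: "i < n" for i
    proof -
      have "act n D x i = act n (A \<theta>') x i - act n (A \<theta>) x i"
        using i unfolding act_def sum_subtractf[symmetric]
        by (intro sum.cong) (auto simp: D_def left_diff_distrib)
      moreover have "act n (H \<theta>' t) x i - of_real l * x i = act n (H \<theta>' t) x i - act n (H \<theta> t) x i"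
        using i ev by simp
      ultimately show ?thesis by (simp add: H_act[OF i])
    qed
    then have "nsq n (\<lambda>i. act n (H \<theta>' t) x i - of_real l * x i) = nsq n (act n D x)"
      by (intro nsq_cong) auto
    also have "\<dots> \<le> (real n * \<epsilon>)\<^sup>2 * nsq n x"
      using close \<epsilon>(1) by (intro nsq_act_le) (auto simp: D_def)
    finally obtain l' :: real where l': "eigenvalue (H \<theta>' t) (of_real l')"
      and c: "cmod (of_real l' - of_real l) \<le> real n * \<epsilon>"
      using hermitian_residual[OF H_hermitian x, of "real n * \<epsilon>" \<theta>' t "of_real l"] \<epsilon>(1) by auto
    from c have close': "\<bar>l' - l\<bar> \<le> real n * \<epsilon>" unfolding of_real_diff[symmetric] norm_of_real .
    moreover have "real n * \<epsilon> \<le> real n" using \<epsilon> by (simp add: mult_left_le)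
    ultimately have "\<bar>l' - t * q k\<bar> \<le> r"
      using near[OF t k, of \<theta>] by (simp add: l_def r_def)
    then have "l' = nth_eigenvalue (H \<theta>' t) k" by (rule uniq[OF t k l'])
    with close' show ?thesis by (simp add: l_def)
  qed
  have "continuous_on UNIV (\<lambda>\<theta>. nth_eigenvalue (H \<theta> t) k)" if t: "t0 \<le> t" and k: "k < n" for t k
    unfolding continuous_on_def
  proof (intro ballI tendstoI)
    fix \<theta> and e :: real assume e: "0 < e"
    define \<epsilon> where "\<epsilon> = min 1 (e / (2 * real n))"
    have \<epsilon>: "0 < \<epsilon>" "\<epsilon> \<le> 1" "real n * \<epsilon> < e"
    proof -
      show "0 < \<epsilon>" "\<epsilon> \<le> 1" using e k by (auto simp: \<epsilon>_def)
      have "real n * \<epsilon> \<le> real n * (e / (2 * real n))" by (intro mult_left_mono) (auto simp: \<epsilon>_def)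
      also have "\<dots> < e" using e k by simp
      finally show "real n * \<epsilon> < e" .
    qed
    have "\<forall>\<^sub>F \<theta>' in at \<theta>. dist (A \<theta>' $$ (i, j)) (A \<theta> $$ (i, j)) < \<epsilon>" if "i < n" "j < n" for i j
      using continuous[OF that] \<epsilon>(1) unfolding continuous_on_def by (auto intro: tendstoD)
    then have "\<forall>\<^sub>F \<theta>' in at \<theta>. \<forall>i\<in>{..<n}. \<forall>j\<in>{..<n}. dist (A \<theta>' $$ (i, j)) (A \<theta> $$ (i, j)) < \<epsilon>"
      by (intro eventually_ball_finite ballI finite_lessThan) auto
    then show "\<forall>\<^sub>F \<theta>' in at \<theta>. dist (nth_eigenvalue (H \<theta>' t) k) (nth_eigenvalue (H \<theta> t) k) < e"
    proof eventually_elim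
      case (elim \<theta>')
      have "\<bar>nth_eigenvalue (H \<theta>' t) k - nth_eigenvalue (H \<theta> t) k\<bar> \<le> real n * \<epsilon>"
        using elim \<epsilon> by (intro step[OF t k]) (auto simp: dist_norm intro: less_imp_le)
      then show ?case using \<epsilon>(3) by (simp add: dist_real_def)
    qed
  qed
  then show ?thesis by blast
qed

end

text \<open>The set lies between the open and the closed interval with endpoints
  \<open>Inf S\<close> and \<open>Sup S\<close>, and these two have the same length. Lengths are
  thereby reduced to suprema and infima, which are stable under uniform perturbation.\<close>

lemma connected_measure_eq:
  fixes S :: "real set"
  assumes "connected S" "bounded S" "S \<noteq> {}"
  shows "S \<in> lmeasurable" "measure lebesgue S = Sup S - Inf S"
proof -
  have bdd: "bdd_above S" "bdd_below S"
    using assms(2) by (auto simp: bounded_imp_bdd_above bounded_imp_bdd_below)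
  have sub: "S \<subseteq> {Inf S..Sup S}" using bdd by (auto intro: cInf_lower cSup_upper)
  have sup: "{Inf S<..<Sup S} \<subseteq> S"
  proof
    fix x assume "x \<in> {Inf S<..<Sup S}"
    then obtain a b where ab: "a \<in> S" "a < x" "b \<in> S" "x < b"
      using assms(3) bdd by (auto simp: cInf_less_iff less_cSup_iff)
    then show "x \<in> S"
      using connectedD_interval[OF assms(1) ab(1) ab(3), of x] by simp
  qed
  have "is_interval S" using assms(1) by (simp add: is_interval_connected_1)
  then show meas: "S \<in> lmeasurable"
    using assms(2) real_interval_borel_measurable[of S]
    by (intro bounded_set_imp_lmeasurable sets_completionI_sets) auto
  have le: "Inf S \<le> Sup S" using assms(3) bdd by (intro cInf_le_cSup)
  have "measure lebesgue {Inf S<..<Sup S} \<le> measure lebesgue S"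
    using sup meas by (intro measure_mono_fmeasurable) (auto simp: fmeasurableD)
  moreover have "measure lebesgue S \<le> measure lebesgue {Inf S..Sup S}"
    using sub meas by (intro measure_mono_fmeasurable) (auto simp: fmeasurableD)
  ultimately show "measure lebesgue S = Sup S - Inf S" using le by (simp add: content_real)
qed

text \<open>Apart from the common shift \<open>c\<close>, supremum and infimum each move by at most
  \<epsilon>; the two endpoints account for the factor 2.\<close>

lemma measure_range_diff_le:
  fixes f g :: "'x \<Rightarrow> real"
  assumes "connected (range f)" "connected (range g)" "bounded (range g)"
    and close: "\<And>x. \<bar>f x - (c + g x)\<bar> \<le> \<epsilon>"
  shows "\<bar>measure lebesgue (range f) - measure lebesgue (range g)\<bar> \<le> 2 * \<epsilon>"
proof -
  obtain B where B: "\<And>x. \<bar>g x\<bar> \<le> B" using assms(3) by (auto simp: bounded_iff)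
  have "bounded (range f)"
    unfolding bounded_iff
  proof (intro exI[of _ "\<bar>c\<bar> + B + \<epsilon>"] ballI)
    fix y assume "y \<in> range f"
    then obtain x where "y = f x" by blast
    with close[of x] B[of x] show "norm y \<le> \<bar>c\<bar> + B + \<epsilon>" by simp
  qed
  note f = connected_measure_eq(2)[OF assms(1) this] and g = connected_measure_eq(2)[OF assms(2,3)]
  have bg: "bdd_above (range g)" "bdd_below (range g)"
    using assms(3) by (auto simp: bounded_imp_bdd_above bounded_imp_bdd_below)
  have bf: "bdd_above (range f)" "bdd_below (range f)"
    using \<open>bounded (range f)\<close> by (auto simp: bounded_imp_bdd_above bounded_imp_bdd_below)
  have 1: "Sup (range f) \<le> c + Sup (range g) + \<epsilon>"
  proof (rule cSUP_least)
    fix x show "f x \<le> c + Sup (range g) + \<epsilon>"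
      using close[of x] cSUP_upper[OF UNIV_I bg(1), of x] by linarith
  qed simp
  have 2: "Sup (range g) \<le> Sup (range f) - c + \<epsilon>"
  proof (rule cSUP_least)
    fix x show "g x \<le> Sup (range f) - c + \<epsilon>"
      using close[of x] cSUP_upper[OF UNIV_I bf(1), of x] by linarith
  qed simp
  have 3: "c + Inf (range g) - \<epsilon> \<le> Inf (range f)"
  proof (rule cINF_greatest)
    fix x show "c + Inf (range g) - \<epsilon> \<le> f x"
      using close[of x] cINF_lower[OF bg(2) UNIV_I, of x] by linarith
  qed simp
  have 4: "Inf (range f) - c - \<epsilon> \<le> Inf (range g)"
  proof (rule cINF_greatest)
    fix x show "Inf (range f) - c - \<epsilon> \<le> g x"
      using close[of x] cINF_lower[OF bf(2) UNIV_I, of x] by linarith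
  qed simp
  show ?thesis using 1 2 3 4 f g by simp
qed

context continuous_strong_coupling
begin

lemma range_diagonal:
  assumes "connected (UNIV :: 'x set)" "k < n"
  shows "connected (range (\<lambda>\<theta>. Re (A \<theta> $$ (k, k))))" "bounded (range (\<lambda>\<theta>. Re (A \<theta> $$ (k, k))))"
proof -
  have "continuous_on UNIV (\<lambda>\<theta>. Re (A \<theta> $$ (k, k)))"
    using continuous[OF assms(2,2)] by (intro continuous_intros)
  then show "connected (range (\<lambda>\<theta>. Re (A \<theta> $$ (k, k))))"
    using assms(1) by (rule connected_continuous_image)
  show "bounded (range (\<lambda>\<theta>. Re (A \<theta> $$ (k, k))))"
    unfolding bounded_iff using bounded[OF assms(2,2)] abs_Re_le_cmod
    by (intro exI[of _ R]) (auto intro: order_trans)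
qed

text \<open>Each band lies within n R of \<open>t * q k\<close>, so for large \<open>t\<close> the
  bands are disjoint and their lengths add up. Connectedness of the parameter space and continuity
  make each band an interval, which allows its length to be compared with that of the diagonal
  range.\<close>

theorem band_measures:
  assumes conn: "connected (UNIV :: 'x set)"
  shows "\<exists>K\<ge>0. \<exists>t0\<ge>1. \<forall>t\<ge>t0.
    (\<forall>k<n. \<bar>measure lebesgue (range (\<lambda>\<theta>. nth_eigenvalue (H \<theta> t) k)) -
        measure lebesgue (range (\<lambda>\<theta>. Re (A \<theta> $$ (k, k))))\<bar> \<le> K / t) \<and>
    measure lebesgue (\<Union>k<n. range (\<lambda>\<theta>. nth_eigenvalue (H \<theta> t) k)) =
      (\<Sum>k<n. measure lebesgue (range (\<lambda>\<theta>. nth_eigenvalue (H \<theta> t) k)))"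
proof -
  obtain K t1 where K: "K \<ge> 0" "t1 \<ge> 1" and first: "\<And>t \<theta> k. t1 \<le> t \<Longrightarrow> k < n \<Longrightarrow>
     \<bar>nth_eigenvalue (H \<theta> t) k - (t * q k + Re (A \<theta> $$ (k, k)))\<bar> \<le> K / t"
    using eigenvalue_first_order by blast
  obtain t2 where cont: "\<And>t k. t2 \<le> t \<Longrightarrow> k < n \<Longrightarrow> continuous_on UNIV (\<lambda>\<theta>. nth_eigenvalue (H \<theta> t) k)"
    using nth_eigenvalue_continuous by blast
  obtain t3 where near: "\<And>t \<theta> k. t3 \<le> t \<Longrightarrow> k < n \<Longrightarrow> \<bar>nth_eigenvalue (H \<theta> t) k - t * q k\<bar> \<le> real n * R"
    and gap: "\<And>t i j. t3 \<le> t \<Longrightarrow> i < j \<Longrightarrow> j < n \<Longrightarrow> t * q i + 2 * (real n * R) < t * q j"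
    by (rule strong_coupling_separation[of "real n * R"], rule that, assumption+)
  have "(\<forall>k<n. \<bar>measure lebesgue (range (\<lambda>\<theta>. nth_eigenvalue (H \<theta> t) k)) -
        measure lebesgue (range (\<lambda>\<theta>. Re (A \<theta> $$ (k, k))))\<bar> \<le> (2 * K) / t) \<and>
    measure lebesgue (\<Union>k<n. range (\<lambda>\<theta>. nth_eigenvalue (H \<theta> t) k)) =
      (\<Sum>k<n. measure lebesgue (range (\<lambda>\<theta>. nth_eigenvalue (H \<theta> t) k)))"
    if t: "max t1 (max t2 t3) \<le> t" for t
  proof -
    define f where "f k \<theta> = nth_eigenvalue (H \<theta> t) k" for k \<theta>
    have conn_f: "connected (range (f k))" if "k < n" for k
      using cont[OF _ that] t conn unfolding f_def by (intro connected_continuous_image) auto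
    have near_f: "\<bar>f k \<theta> - t * q k\<bar> \<le> real n * R" if "k < n" for k \<theta>
      using near[OF _ that] t unfolding f_def by auto
    have bdd_f: "bounded (range (f k))" if "k < n" for k
      unfolding bounded_iff
    proof (intro exI[of _ "\<bar>t * q k\<bar> + real n * R"] ballI)
      fix y assume "y \<in> range (f k)"
      then obtain \<theta> where "y = f k \<theta>" by blast
      with near_f[OF that, of \<theta>] show "norm y \<le> \<bar>t * q k\<bar> + real n * R" by simp
    qed
    have "\<bar>measure lebesgue (range (f k)) - measure lebesgue (range (\<lambda>\<theta>. Re (A \<theta> $$ (k, k))))\<bar> \<le> 2 * (K / t)"
      if k: "k < n" for k
      using first[OF _ k] t unfolding f_def
      by (intro measure_range_diff_le[OF conn_f[OF k, unfolded f_def] range_diagonal[OF conn k], of "t * q k"]) auto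
    moreover have "measure lebesgue (\<Union>k<n. range (f k)) = (\<Sum>k<n. measure lebesgue (range (f k)))"
    proof (rule measure_finite_Union)
      show "finite {..<n}" by simp
      show "(\<lambda>k. range (f k)) ` {..<n} \<subseteq> sets lebesgue"
        using connected_measure_eq(1)[OF conn_f bdd_f] by (auto intro: fmeasurableD)
      show "emeasure lebesgue (range (f k)) \<noteq> \<infinity>" if "k \<in> {..<n}" for k
        unfolding infinity_ennreal_def using that
        by (intro fmeasurableD2 connected_measure_eq(1) conn_f bdd_f) auto
      have disj: "range (f i) \<inter> range (f j) = {}" if "i < j" "j < n" for i j
      proof (rule ccontr)
        assume "range (f i) \<inter> range (f j) \<noteq> {}"
        then obtain \<theta> \<theta>' where "f i \<theta> = f j \<theta>'" by auto
        with near_f[of i \<theta>] near_f[of j \<theta>'] gap[of t i j] that t show False by auto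
      qed
      then show "disjoint_family_on (\<lambda>k. range (f k)) {..<n}"
        unfolding disjoint_family_on_def by (metis inf_commute lessThan_iff linorder_neqE_nat)
    qed
    ultimately show ?thesis unfolding f_def by auto
  qed
  then show ?thesis using K by (intro exI[of _ "2 * K"] conjI exI[of _ "max t1 (max t2 t3)"]) auto
qed

end

section \<open>Local operators on square-summable functions\<close>

lemma l2_vanish: "f \<in> l2 V \<Longrightarrow> v \<notin> V \<Longrightarrow> f v = 0"
  by (simp add: l2_def)

lemma L2_set_le_l2norm:
  assumes "f \<in> l2 V" "finite F" "F \<subseteq> V"
  shows "L2_set (\<lambda>v. cmod (f v)) F \<le> l2norm V f"
  using assms unfolding L2_set_def l2norm_def l2_def
  by (intro real_sqrt_le_mono finite_sum_le_infsum) auto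

text \<open>Membership and the norm bound are both tested on finite subsets through
  \<open>L2_set\<close>. Minkowski's inequality for finite sums thus serves for l2, and infinite
  sums need not be manipulated.\<close>

lemma l2I:
  assumes "\<And>v. v \<notin> V \<Longrightarrow> f v = 0"
    and bound: "\<And>F. finite F \<Longrightarrow> F \<subseteq> V \<Longrightarrow> L2_set (\<lambda>v. cmod (f v)) F \<le> K"
  shows "f \<in> l2 V" "l2norm V f \<le> K"
proof -
  have K: "0 \<le> K" using bound[of "{}"] by simp
  have le: "(\<Sum>v\<in>F. (cmod (f v))\<^sup>2) \<le> K\<^sup>2" if "finite F" "F \<subseteq> V" for F
  proof -
    have "(\<Sum>v\<in>F. (cmod (f v))\<^sup>2) = (L2_set (\<lambda>v. cmod (f v)) F)\<^sup>2"
      unfolding L2_set_def by (simp add: sum_nonneg)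
    also have "\<dots> \<le> K\<^sup>2" using bound[OF that] by (intro power_mono) auto
    finally show ?thesis .
  qed
  have summable: "(\<lambda>v. (cmod (f v))\<^sup>2) summable_on V"
    using le by (intro nonneg_bdd_above_summable_on) (auto intro!: bdd_aboveI[of _ "K\<^sup>2"])
  then show "f \<in> l2 V" using assms(1) by (simp add: l2_def)
  have "(\<Sum>\<^sub>\<infinity>v\<in>V. (cmod (f v))\<^sup>2) \<le> K\<^sup>2"
    using le by (intro infsum_le_finite_sums[OF summable])
  then show "l2norm V f \<le> K"
    unfolding l2norm_def using K by (simp add: real_le_lsqrt)
qed

lemma l2norm_nonneg: "0 \<le> l2norm V f"
  unfolding l2norm_def by (intro real_sqrt_ge_zero infsum_nonneg) auto

lemma norm_le_l2norm:
  assumes "f \<in> l2 V"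
  shows "cmod (f v) \<le> l2norm V f"
proof (cases "v \<in> V")
  case True
  then show ?thesis using L2_set_le_l2norm[OF assms, of "{v}"] by simp
next
  case False
  then show ?thesis using l2_vanish[OF assms False] l2norm_nonneg[of V f] by simp
qed

lemma L2_set_norm_add:
  "L2_set (\<lambda>v. cmod (f v + g v)) F \<le> L2_set (\<lambda>v. cmod (f v)) F + L2_set (\<lambda>v. cmod (g v)) F"
proof -
  have "L2_set (\<lambda>v. cmod (f v + g v)) F \<le> L2_set (\<lambda>v. cmod (f v) + cmod (g v)) F"
    by (intro L2_set_mono norm_triangle_ineq norm_ge_zero)
  also have "\<dots> \<le> L2_set (\<lambda>v. cmod (f v)) F + L2_set (\<lambda>v. cmod (g v)) F"
    by (rule L2_set_triangle_ineq)
  finally show ?thesis .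
qed

lemma L2_set_norm_scale: "L2_set (\<lambda>v. cmod (c * f v)) F = cmod c * L2_set (\<lambda>v. cmod (f v)) F"
  by (simp add: norm_mult L2_set_right_distrib)

lemma L2_set_norm_sum:
  fixes N :: nat
  shows "L2_set (\<lambda>v. cmod (\<Sum>i<N. f i v)) F \<le> (\<Sum>i<N. L2_set (\<lambda>v. cmod (f i v)) F)"
proof (induction N)
  case (Suc N)
  have "L2_set (\<lambda>v. cmod (\<Sum>i<Suc N. f i v)) F
      \<le> L2_set (\<lambda>v. cmod (\<Sum>i<N. f i v)) F + L2_set (\<lambda>v. cmod (f N v)) F"
    using L2_set_norm_add[of "\<lambda>v. \<Sum>i<N. f i v" "f N"] by simp
  with Suc.IH show ?case by simp
qed (simp add: L2_set_0')

lemma l2_scale: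
  assumes "f \<in> l2 V"
  shows "(\<lambda>v. c * f v) \<in> l2 V"
  using L2_set_le_l2norm[OF assms] l2_vanish[OF assms]
  by (intro l2I(1)[where K = "cmod c * l2norm V f"]) (auto simp: L2_set_norm_scale intro!: mult_left_mono)

lemma l2_diff:
  assumes "f \<in> l2 V" "g \<in> l2 V"
  shows "(\<lambda>v. f v - g v) \<in> l2 V"
proof (rule l2I(1)[where K = "l2norm V f + l2norm V g"])
  fix F assume F: "finite F" "F \<subseteq> V"
  have "L2_set (\<lambda>v. cmod (f v - g v)) F \<le> L2_set (\<lambda>v. cmod (f v)) F + L2_set (\<lambda>v. cmod (g v)) F"
    using L2_set_norm_add[of f "\<lambda>v. - g v" F] by simp
  also have "\<dots> \<le> l2norm V f + l2norm V g"
    using assms F by (intro add_mono L2_set_le_l2norm)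
  finally show "L2_set (\<lambda>v. cmod (f v - g v)) F \<le> l2norm V f + l2norm V g" .
qed (simp add: l2_vanish[OF assms(1)] l2_vanish[OF assms(2)])

text \<open>Models \<open>T - x\<close> for a finite range operator \<open>T\<close>. The condition
  \<open>sums\<close> is continuity for pointwise convergence, needed to apply \<open>B\<close> to a
  Neumann series that is known to converge only at each point.\<close>

locale local_operator =
  fixes V :: "'v set" and B :: "('v \<Rightarrow> complex) \<Rightarrow> 'v \<Rightarrow> complex"
  assumes diff: "B (\<lambda>v. f v - g v) v = B f v - B g v"
    and scale: "B (\<lambda>v. c * f v) v = c * B f v"
    and vanish: "v \<notin> V \<Longrightarrow> f v = 0 \<Longrightarrow> B f v = 0"
    and local: "v \<in> V \<Longrightarrow> \<exists>F. finite F \<and> F \<subseteq> V \<and> (\<forall>f g. (\<forall>u\<in>F. f u = g u) \<longrightarrow> B f v = B g v)"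
    and sums: "(\<And>u. (\<lambda>i. a i u) sums s u) \<Longrightarrow> (\<lambda>i. B (a i) v) sums B s v"
begin

lemma local_set:
  assumes "finite G" "G \<subseteq> V"
  shows "\<exists>F. finite F \<and> F \<subseteq> V \<and> G \<subseteq> F \<and> (\<forall>f g. (\<forall>u\<in>F. f u = g u) \<longrightarrow> (\<forall>v\<in>G. B f v = B g v))"
proof -
  have "\<forall>v\<in>G. \<exists>F. finite F \<and> F \<subseteq> V \<and> (\<forall>f g. (\<forall>u\<in>F. f u = g u) \<longrightarrow> B f v = B g v)"
    using local assms(2) by blast
  from bchoice[OF this] obtain \<Phi> where \<Phi>: "\<forall>v\<in>G. finite (\<Phi> v) \<and> \<Phi> v \<subseteq> V \<and>
      (\<forall>f g. (\<forall>u\<in>\<Phi> v. f u = g u) \<longrightarrow> B f v = B g v)" by blast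
  show ?thesis
  proof (intro exI[of _ "G \<union> \<Union> (\<Phi> ` G)"] conjI allI impI ballI)
    fix f g :: "'v \<Rightarrow> complex" and v
    assume fg: "\<forall>u\<in>G \<union> \<Union> (\<Phi> ` G). f u = g u" and v: "v \<in> G"
    then have "\<forall>u\<in>\<Phi> v. f u = g u" by blast
    then show "B f v = B g v" using \<Phi> v by blast
  qed (use \<Phi> assms in auto)
qed

text \<open>Locality turns a bound on finitely supported functions into one on \<open>l2\<close>: on a finite set,
  the image of a function only depends on its restriction to a larger finite set.\<close>

lemma extend_bound:
  assumes f: "f \<in> l2 V" and "0 \<le> K"
    and P_vanish: "\<And>v. v \<notin> V \<Longrightarrow> P f v = 0"
    and P_local: "\<And>G. finite G \<Longrightarrow> G \<subseteq> V \<Longrightarrow>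
      \<exists>F. finite F \<and> F \<subseteq> V \<and> (\<forall>f g. (\<forall>u\<in>F. f u = g u) \<longrightarrow> (\<forall>v\<in>G. P f v = P g v))"
    and P_bound: "\<And>f F G. finite F \<Longrightarrow> F \<subseteq> V \<Longrightarrow> (\<And>v. v \<notin> F \<Longrightarrow> f v = 0) \<Longrightarrow> finite G \<Longrightarrow> G \<subseteq> V \<Longrightarrow>
      L2_set (\<lambda>v. cmod (P f v)) G \<le> K * L2_set (\<lambda>v. cmod (f v)) F"
  shows "P f \<in> l2 V" "l2norm V (P f) \<le> K * l2norm V f"
proof -
  have "L2_set (\<lambda>v. cmod (P f v)) G \<le> K * l2norm V f" if G: "finite G" "G \<subseteq> V" for G
  proof -
    obtain F where F: "finite F" "F \<subseteq> V"
      and eq: "\<forall>f g. (\<forall>u\<in>F. f u = g u) \<longrightarrow> (\<forall>v\<in>G. P f v = P g v)"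
      using P_local[OF G] by (elim exE conjE) (rule that)
    define h where "h v = (if v \<in> F then f v else 0)" for v
    have "L2_set (\<lambda>v. cmod (P f v)) G = L2_set (\<lambda>v. cmod (P h v)) G"
      using eq[rule_format, of f h] by (intro L2_set_cong) (auto simp: h_def)
    also have "\<dots> \<le> K * L2_set (\<lambda>v. cmod (h v)) F"
      using F G by (intro P_bound) (auto simp: h_def)
    also have "L2_set (\<lambda>v. cmod (h v)) F = L2_set (\<lambda>v. cmod (f v)) F"
      by (intro L2_set_cong) (auto simp: h_def)
    also have "K * \<dots> \<le> K * l2norm V f"
      using L2_set_le_l2norm[OF f F] \<open>0 \<le> K\<close> by (rule mult_left_mono)
    finally show ?thesis .
  qed
  then show "P f \<in> l2 V" "l2norm V (P f) \<le> K * l2norm V f"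
    using l2I[of V "P f"] P_vanish by blast+
qed

text \<open>Put A = 1 - B^2 / M. The Neumann series u = g + A g + A^2 g + ... satisfies B (B u) / M
  = g, so B u / M is a preimage of \<open>g\<close> under \<open>B\<close>. The lower bound follows
  by absorbing \<rho> |f| in |f| \<le> |A f| + |B (B f)| / |M|. The square is taken because the
  spectrum of \<open>B\<close> may lie on both sides of 0, where no multiple of \<open>B\<close>
  itself is close to 1.\<close>

theorem invertible:
  assumes K: "0 \<le> K" and \<rho>: "0 \<le> \<rho>" "\<rho> < 1" and M: "M \<noteq> 0"
    and B_bound: "\<And>f F G. finite F \<Longrightarrow> F \<subseteq> V \<Longrightarrow> (\<And>v. v \<notin> F \<Longrightarrow> f v = 0) \<Longrightarrow> finite G \<Longrightarrow> G \<subseteq> V \<Longrightarrow>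
      L2_set (\<lambda>v. cmod (B f v)) G \<le> K * L2_set (\<lambda>v. cmod (f v)) F"
    and contraction: "\<And>f F G. finite F \<Longrightarrow> F \<subseteq> V \<Longrightarrow> (\<And>v. v \<notin> F \<Longrightarrow> f v = 0) \<Longrightarrow> finite G \<Longrightarrow> G \<subseteq> V \<Longrightarrow>
      L2_set (\<lambda>v. cmod (f v - B (B f) v / M)) G \<le> \<rho> * L2_set (\<lambda>v. cmod (f v)) F"
  shows "bij_betw B (l2 V) (l2 V)" "\<exists>C. \<forall>f\<in>l2 V. l2norm V f \<le> C * l2norm V (B f)"
proof -
  define A where "A f v = f v - B (B f) v / M" for f v
  have B: "B f \<in> l2 V" "l2norm V (B f) \<le> K * l2norm V f" if "f \<in> l2 V" for f
  proof -
    have "\<exists>F. finite F \<and> F \<subseteq> V \<and> (\<forall>f g. (\<forall>u\<in>F. f u = g u) \<longrightarrow> (\<forall>v\<in>G. B f v = B g v))"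
      if "finite G" "G \<subseteq> V" for G
      using local_set[OF that] by blast
    note ext = extend_bound[of f K B, OF that K _ this B_bound]
    show "B f \<in> l2 V" by (rule ext) (use that in \<open>auto intro: vanish l2_vanish\<close>)
    show "l2norm V (B f) \<le> K * l2norm V f" by (rule ext) (use that in \<open>auto intro: vanish l2_vanish\<close>)
  qed
  have A: "A f \<in> l2 V" "l2norm V (A f) \<le> \<rho> * l2norm V f" if f: "f \<in> l2 V" for f
  proof -
    have loc: "\<exists>F. finite F \<and> F \<subseteq> V \<and> (\<forall>f g. (\<forall>u\<in>F. f u = g u) \<longrightarrow> (\<forall>v\<in>G. A f v = A g v))"
      if G: "finite G" "G \<subseteq> V" for G
    proof -
      obtain F where F: "finite F" "F \<subseteq> V" "G \<subseteq> F"
        and eqF: "\<forall>f g. (\<forall>u\<in>F. f u = g u) \<longrightarrow> (\<forall>v\<in>G. B f v = B g v)"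
        using local_set[OF G] by blast
      \<comment> \<open>Locality is used twice because \<open>A\<close> contains the square of
        \<open>B\<close>.\<close>
      obtain F' where F': "finite F'" "F' \<subseteq> V" "F \<subseteq> F'"
        and eqF': "\<forall>f g. (\<forall>u\<in>F'. f u = g u) \<longrightarrow> (\<forall>v\<in>F. B f v = B g v)"
        using local_set[OF F(1,2)] by blast
      have "A f v = A g v" if "\<forall>u\<in>F'. f u = g u" "v \<in> G" for f g v
      proof -
        have "\<forall>u\<in>F. B f u = B g u" using eqF' that(1) by blast
        then have "B (B f) v = B (B g) v" using eqF that(2) by blast
        moreover have "f v = g v" using that F(3) F'(3) by blast
        ultimately show ?thesis by (simp add: A_def)
      qed
      then show ?thesis using F' by blast
    qed
    have van: "A f v = 0" if "v \<notin> V" for v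
      using that l2_vanish[OF f that] vanish[OF that] vanish[OF that, of "B f"] by (simp add: A_def)
    show "A f \<in> l2 V"
      by (rule extend_bound[of f \<rho> A, OF f \<rho>(1) van loc]) (auto simp: A_def intro!: contraction)
    show "l2norm V (A f) \<le> \<rho> * l2norm V f"
      by (rule extend_bound[of f \<rho> A, OF f \<rho>(1) van loc]) (auto simp: A_def intro!: contraction)
  qed
  have lower: "l2norm V f \<le> K / cmod M / (1 - \<rho>) * l2norm V (B f)" if f: "f \<in> l2 V" for f
  proof -
    have "l2norm V f \<le> \<rho> * l2norm V f + K / cmod M * l2norm V (B f)"
    proof (rule l2I(2))
      fix F assume F: "finite F" "F \<subseteq> V"
      have "L2_set (\<lambda>v. cmod (f v)) F \<le> L2_set (\<lambda>v. cmod (A f v)) F + L2_set (\<lambda>v. cmod (1 / M * B (B f) v)) F"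
        using L2_set_norm_add[of "A f" "\<lambda>v. 1 / M * B (B f) v" F] by (simp add: A_def)
      also have "\<dots> = L2_set (\<lambda>v. cmod (A f v)) F + 1 / cmod M * L2_set (\<lambda>v. cmod (B (B f) v)) F"
        by (simp only: L2_set_norm_scale norm_divide norm_one)
      also have "\<dots> \<le> l2norm V (A f) + 1 / cmod M * l2norm V (B (B f))"
        using F f by (intro add_mono mult_left_mono L2_set_le_l2norm A B) auto
      also have "\<dots> \<le> \<rho> * l2norm V f + 1 / cmod M * (K * l2norm V (B f))"
        using f by (intro add_mono mult_left_mono A B) auto
      finally show "L2_set (\<lambda>v. cmod (f v)) F \<le> \<rho> * l2norm V f + K / cmod M * l2norm V (B f)" by simp
    qed (use l2_vanish[OF f] in auto)
    then have "(1 - \<rho>) * l2norm V f \<le> K / cmod M * l2norm V (B f)" by (simp add: algebra_simps)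
    then have "l2norm V f \<le> (K / cmod M * l2norm V (B f)) / (1 - \<rho>)"
      using \<rho> by (subst pos_le_divide_eq) (simp_all only: diff_gt_0_iff_gt mult.commute)
    then show ?thesis by simp
  qed
  then show "\<exists>C. \<forall>f\<in>l2 V. l2norm V f \<le> C * l2norm V (B f)" by blast
  have inj: "inj_on B (l2 V)"
  proof (rule inj_onI)
    fix f g assume fg: "f \<in> l2 V" "g \<in> l2 V" "B f = B g"
    define h where "h v = f v - g v" for v
    have h: "h \<in> l2 V" unfolding h_def by (rule l2_diff[OF fg(1,2)])
    have "B h = (\<lambda>v. 0)" unfolding h_def using fg(3) by (auto simp: diff fun_eq_iff)
    then have "l2norm V (B h) = 0" by (simp add: l2norm_def)
    with lower[OF h] have "l2norm V h \<le> 0" by simp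
    then have "cmod (h v) \<le> 0" for v
      by (rule order_trans[OF norm_le_l2norm[OF h]])
    then have "h v = 0" for v by simp
    then show "f = g" by (auto simp: h_def fun_eq_iff)
  qed
  have surj: "\<exists>f\<in>l2 V. B f = g" if g: "g \<in> l2 V" for g
  proof -
    define a where "a i = (A ^^ i) g" for i
    have a: "a i \<in> l2 V \<and> l2norm V (a i) \<le> \<rho> ^ i * l2norm V g" for i
    proof (induction i)
      case (Suc i)
      have "l2norm V (a (Suc i)) \<le> \<rho> * l2norm V (a i)" using A(2)[of "a i"] Suc by (simp add: a_def)
      also have "\<dots> \<le> \<rho> * (\<rho> ^ i * l2norm V g)" using Suc \<rho> by (intro mult_left_mono) auto
      finally show ?case using A(1)[of "a i"] Suc by (simp add: a_def mult_ac)
    qed (use g in \<open>simp add: a_def\<close>)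
    have "summable (\<lambda>i. a i v)" for v
    proof (rule summable_comparison_test'[of "\<lambda>i. \<rho> ^ i * l2norm V g" 0])
      show "summable (\<lambda>i. \<rho> ^ i * l2norm V g)"
        using \<rho> by (intro summable_mult2 summable_geometric) auto
      show "norm (a i v) \<le> \<rho> ^ i * l2norm V g" for i
        using norm_le_l2norm[of "a i" V v] a[of i] by linarith
    qed
    then obtain u where u: "\<And>v. (\<lambda>i. a i v) sums u v" unfolding summable_def by metis
    \<comment> \<open>The limit \<open>u\<close> is known only pointwise. On a finite set the bounds
      for the partial sums pass to the limit, and this puts \<open>u\<close> into l2.\<close>
    have "L2_set (\<lambda>v. cmod (u v)) G \<le> l2norm V g / (1 - \<rho>)" if G: "finite G" "G \<subseteq> V" for G
    proof (rule LIMSEQ_le_const2)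
      show "(\<lambda>N. L2_set (\<lambda>v. cmod (\<Sum>i<N. a i v)) G) \<longlonglongrightarrow> L2_set (\<lambda>v. cmod (u v)) G"
        using u unfolding L2_set_def sums_def by (intro tendsto_intros)
      have "L2_set (\<lambda>v. cmod (\<Sum>i<N. a i v)) G \<le> l2norm V g / (1 - \<rho>)" for N
      proof -
        have "L2_set (\<lambda>v. cmod (\<Sum>i<N. a i v)) G \<le> (\<Sum>i<N. L2_set (\<lambda>v. cmod (a i v)) G)"
          by (rule L2_set_norm_sum)
        also have "\<dots> \<le> (\<Sum>i<N. \<rho> ^ i * l2norm V g)"
          using a L2_set_le_l2norm[OF _ G] by (intro sum_mono) (meson order_trans)
        also have "\<dots> \<le> (\<Sum>i. \<rho> ^ i * l2norm V g)"
          using \<rho> by (intro sum_le_suminf summable_mult2 summable_geometric) (auto simp: l2norm_nonneg)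
        also have "\<dots> = l2norm V g / (1 - \<rho>)"
          using \<rho> by (simp add: suminf_mult2[symmetric] suminf_geometric summable_geometric)
        finally show ?thesis .
      qed
      then show "\<exists>N. \<forall>n\<ge>N. L2_set (\<lambda>v. cmod (\<Sum>i<n. a i v)) G \<le> l2norm V g / (1 - \<rho>)" by blast
    qed
    moreover have "u v = 0" if "v \<notin> V" for v
    proof -
      have "a i v = 0" for i using l2_vanish[of "a i" V v] a[of i] that by simp
      then show ?thesis using u[of v] by (simp add: sums_iff)
    qed
    ultimately have "u \<in> l2 V" by (intro l2I(1)) auto
    have "B (B u) v / M = g v" for v
    proof -
      have "(\<lambda>i. B (B (a i)) v) sums B (B u) v" using u by (intro sums)
      then have "(\<lambda>i. a i v - B (B (a i)) v / M) sums (u v - B (B u) v / M)"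
        using u by (intro sums_diff sums_divide)
      then have "(\<lambda>i. a (Suc i) v) sums (u v - B (B u) v / M)" by (simp add: a_def A_def)
      \<comment> \<open>Dropping the first term \<open>g\<close> of the series has the same effect
        as applying \<open>A\<close> to every term, whence u - g = A u.\<close>
      moreover have "(\<lambda>i. a (Suc i) v) sums (u v - a 0 v)"        using u[of v] sums_Suc_iff[of "\<lambda>i. a i v" "u v - a 0 v"] by simp
      ultimately have "u v - B (B u) v / M = u v - a 0 v" by (rule sums_unique2)
      then show ?thesis by (simp add: a_def)
    qed
    then have "B (\<lambda>v. 1 / M * B u v) = g" by (simp only: scale fun_eq_iff) simp
    moreover have "(\<lambda>v. 1 / M * B u v) \<in> l2 V" using \<open>u \<in> l2 V\<close> by (intro l2_scale B)
    ultimately show ?thesis by blast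
  qed
  show "bij_betw B (l2 V) (l2 V)"
    unfolding bij_betw_def using inj surj B(1) by (auto simp: image_iff)
qed

end

section \<open>Spectra of periodic operators\<close>

definition chr :: "int ^ 'd \<Rightarrow> real ^ ('d::finite) \<Rightarrow> complex" where
  "chr m \<theta> = exp (\<i> * of_real (\<Sum>s\<in>UNIV. of_int (m $ s) * \<theta> $ s))"

lemma chr_add: "chr (m + k) \<theta> = chr m \<theta> * chr k \<theta>"
  by (simp add: chr_def exp_add[symmetric] sum.distrib ring_distribs)

lemma chr_0 [simp]: "chr 0 \<theta> = 1"
  by (simp add: chr_def)

lemma norm_chr [simp]: "cmod (chr m \<theta>) = 1"
  unfolding chr_def by (rule norm_exp_i_times)

lemma chr_minus: "chr (- m) \<theta> = cnj (chr m \<theta>)"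
  by (simp add: chr_def exp_cnj sum_negf)



lemma chr_diff: "chr (m - k) \<theta> = chr m \<theta> * cnj (chr k \<theta>)"
  using chr_add[of m "- k"] by (simp add: chr_minus)



lemma continuous_on_chr: "continuous_on UNIV (chr m)"
  unfolding chr_def[abs_def] by (intro continuous_intros)

text \<open>Gives access to compactness of the torus although \<theta> ranges over all of R^d. A
  single \<theta>' serves all characters at once, so a whole matrix of trigonometric polynomials can
  be moved into the cell.\<close>

lemma chr_periodic:
  "\<exists>\<theta>'\<in>cbox 0 (\<chi> s. 2 * pi). \<forall>m. chr m \<theta>' = chr m (\<theta> :: real ^ 'd::finite)"
proof -
  define k where "k s = \<lfloor>\<theta> $ s / (2 * pi)\<rfloor>" for s
  define \<theta>' :: "real ^ 'd" where "\<theta>' = (\<chi> s. \<theta> $ s - 2 * pi * of_int (k s))"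
  have "0 \<le> \<theta>' $ s \<and> \<theta>' $ s \<le> 2 * pi" for s
  proof -
    have "of_int (k s) \<le> \<theta> $ s / (2 * pi)" "\<theta> $ s / (2 * pi) \<le> of_int (k s) + 1"
      unfolding k_def by linarith+
    then show ?thesis
      by (simp add: \<theta>'_def pos_le_divide_eq pos_divide_le_eq algebra_simps)
  qed
  then have "\<theta>' \<in> cbox 0 (\<chi> s. 2 * pi)" by (simp add: mem_box_cart)
  moreover have "chr m \<theta>' = chr m \<theta>" for m :: "int ^ 'd"
  proof -
    define j where "j = (\<Sum>s\<in>UNIV. m $ s * k s)"
    have "(\<Sum>s\<in>UNIV. real_of_int (m $ s) * \<theta> $ s)
        = (\<Sum>s\<in>UNIV. of_int (m $ s) * \<theta>' $ s + 2 * pi * of_int (m $ s * k s))"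
      by (intro sum.cong refl) (simp add: \<theta>'_def algebra_simps)
    also have "\<dots> = (\<Sum>s\<in>UNIV. of_int (m $ s) * \<theta>' $ s) + 2 * pi * of_int j"
      by (simp add: sum.distrib j_def sum_distrib_left)
    finally have "chr m \<theta> = exp (\<i> * of_real (\<Sum>s\<in>UNIV. of_int (m $ s) * \<theta>' $ s) + \<i> * of_real (2 * pi * of_int j))"
      unfolding chr_def by (simp only: of_real_add distrib_left)
    also have "\<dots> = chr m \<theta>' * exp (\<i> * of_real (2 * pi * of_int j))"
      by (simp only: exp_add chr_def)
    also have "exp (\<i> * of_real (2 * pi * of_int j)) = 1"
      by (subst exp_eq_1) auto
    finally show ?thesis by simp
  qed
  ultimately show ?thesis by blast
qed

text \<open>Sampling at the \<open>L\<close>-th roots of unity replaces the integral over the torus in Plancherel's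
  identity, as soon as \<open>L\<close> exceeds the diameter of the support.\<close>

lemma root_of_unity_sum:
  fixes k :: int and L :: nat
  assumes "L > 0" "\<not> int L dvd k"
  shows "(\<Sum>r<L. exp (\<i> * of_real (of_int k * (2 * pi * real r / real L)))) = 0"
proof -
  define w where "w = exp (\<i> * of_real (of_int k * (2 * pi / real L)))"
  have pow: "exp (\<i> * of_real (of_int k * (2 * pi * real r / real L))) = w ^ r" for r
    unfolding w_def exp_of_nat_mult[symmetric] by (simp add: mult_ac)
  have "w \<noteq> 1"
  proof
    assume "w = 1"
    then obtain n :: int where "of_int k * (2 * pi / real L) = of_int (2 * n) * pi"
      unfolding w_def exp_eq_1 by auto
    then have "of_int k = of_int n * real L" using assms(1) by (simp add: field_simps)
    then have "k = n * int L" by (metis of_int_eq_iff of_int_mult of_int_of_nat_eq)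
    with assms(2) show False by simp
  qed
  moreover have "w ^ L = 1"
    using pow[of L] assms(1) exp_integer_2pi[of "of_int k"] by (simp add: mult_ac)
  ultimately show ?thesis
    unfolding pow by (simp add: sum_gp_strict)
qed

lemma plancherel:
  fixes S :: "(int ^ 'd::finite) set"
  assumes "finite S"
  shows "\<exists>(P :: ('d \<Rightarrow> nat) set) \<theta>. finite P \<and> P \<noteq> {} \<and>
    (\<forall>c. (\<Sum>p\<in>P. (cmod (\<Sum>m\<in>S. c m * chr (- m) (\<theta> p)))\<^sup>2) = real (card P) * (\<Sum>m\<in>S. (cmod (c m))\<^sup>2))"
proof -
  define B where "B = (\<Sum>m\<in>S. \<Sum>s\<in>UNIV. \<bar>(m :: int ^ 'd) $ s\<bar>)"
  \<comment> \<open>All coordinates of points of \<open>S\<close> lie between -B and B, so those of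
    a difference are at most 2 B < L in modulus. A nonzero coordinate of a difference is therefore
    not divisible by \<open>L\<close>.\<close>
  define L where "L = nat (2 * B + 1)"
  have B: "\<bar>m $ s\<bar> \<le> B" if "m \<in> S" for m :: "int ^ 'd" and s
  proof -
    have "\<bar>m $ s\<bar> \<le> (\<Sum>s\<in>UNIV. \<bar>m $ s\<bar>)" by (intro member_le_sum) auto
    also have "\<dots> \<le> B"
      unfolding B_def using assms that       by (intro member_le_sum[of m S "\<lambda>m :: int ^ 'd. \<Sum>s\<in>UNIV. \<bar>m $ s\<bar>"]) (auto intro: sum_nonneg)
    finally show ?thesis .
  qed
  have B0: "0 \<le> B" unfolding B_def by (intro sum_nonneg) auto
  then have L: "L > 0" "int L = 2 * B + 1" by (auto simp: L_def)
  define P where "P = (UNIV :: 'd set) \<rightarrow>\<^sub>E {..<L}"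
  define \<theta> :: "('d \<Rightarrow> nat) \<Rightarrow> real ^ 'd" where "\<theta> p = (\<chi> s. 2 * pi * real (p s) / real L)" for p
  have fin: "finite P" unfolding P_def by (intro finite_PiE) auto
  have ne: "P \<noteq> {}" unfolding P_def using L by (auto simp: PiE_eq_empty_iff)
  have ortho: "(\<Sum>p\<in>P. chr (m' - m) (\<theta> p)) = (if m = m' then of_nat (card P) else 0)"
    if "m \<in> S" "m' \<in> S" for m m' :: "int ^ 'd"
  proof (cases "m = m'")
    case False
    then obtain s where s: "m $ s \<noteq> m' $ s" by (auto simp: Finite_Cartesian_Product.vec_eq_iff)
    have "\<bar>m' $ s - m $ s\<bar> < int L" using B[OF that(1), of s] B[OF that(2), of s] L(2) by linarith
    then have nd: "\<not> int L dvd (m' - m) $ s" using s zdvd_imp_le[of "int L" "\<bar>m' $ s - m $ s\<bar>"] by auto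
    \<comment> \<open>Over a box of sample points the sum of a character factorizes by coordinates,
      and the factor at a coordinate where m and m' differ is a vanishing sum of roots of
      unity.\<close>
    have "(\<Sum>p\<in>P. chr (m' - m) (\<theta> p))
        = (\<Sum>p\<in>P. \<Prod>s\<in>UNIV. exp (\<i> * of_real (of_int ((m' - m) $ s) * (2 * pi * real (p s) / real L))))"
      unfolding chr_def \<theta>_def by (intro sum.cong refl) (simp add: exp_sum sum_distrib_left)
    also have "\<dots> = (\<Prod>s\<in>UNIV. \<Sum>r<L. exp (\<i> * of_real (of_int ((m' - m) $ s) * (2 * pi * real r / real L))))"
      unfolding P_def by (rule prod_sum_PiE[symmetric]) auto
    also have "\<dots> = 0" using root_of_unity_sum[OF L(1) nd] by (intro prod_zero) (auto intro!: exI[of _ s])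
    finally show ?thesis using False by simp
  qed simp
  have "(\<Sum>p\<in>P. (cmod (\<Sum>m\<in>S. c m * chr (- m) (\<theta> p)))\<^sup>2) = real (card P) * (\<Sum>m\<in>S. (cmod (c m))\<^sup>2)" for c
  proof -
    have "complex_of_real (\<Sum>p\<in>P. (cmod (\<Sum>m\<in>S. c m * chr (- m) (\<theta> p)))\<^sup>2)
        = (\<Sum>p\<in>P. \<Sum>m\<in>S. \<Sum>m'\<in>S. c m * cnj (c m') * chr (m' - m) (\<theta> p))"
      unfolding of_real_sum complex_norm_square cnj_sum sum_product
      by (intro sum.cong refl) (simp add: chr_minus chr_diff mult_ac)
    also have "\<dots> = (\<Sum>m\<in>S. \<Sum>p\<in>P. \<Sum>m'\<in>S. c m * cnj (c m') * chr (m' - m) (\<theta> p))"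
      by (rule sum.swap)
    also have "\<dots> = (\<Sum>m\<in>S. \<Sum>m'\<in>S. c m * cnj (c m') * (\<Sum>p\<in>P. chr (m' - m) (\<theta> p)))"
      by (intro sum.cong refl) (subst sum.swap, simp add: sum_distrib_left)
    also have "\<dots> = (\<Sum>m\<in>S. \<Sum>m'\<in>S. if m = m' then c m * cnj (c m) * of_nat (card P) else 0)"
      using ortho by (intro sum.cong refl) auto
    also have "\<dots> = (\<Sum>m\<in>S. c m * cnj (c m) * of_nat (card P))" using assms by simp
    also have "\<dots> = of_real (real (card P) * (\<Sum>m\<in>S. (cmod (c m))\<^sup>2))"
      unfolding of_real_mult of_real_sum complex_norm_square by (simp add: sum_distrib_left mult_ac)
    finally show ?thesis by (simp only: of_real_eq_iff)
  qed
  then show ?thesis using fin ne by blast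
qed

text \<open>\<open>T\<close> is a matrix-valued convolution over the lattice: \<open>a j k r\<close>
  couples component \<open>j\<close> in cell \<open>m\<close> to component \<open>k\<close> in cell
  \<open>m + r\<close>. The function \<open>sym\<close> is its symbol, and \<open>pt\<close> labels
  the points of \<open>V\<close> by component and cell.\<close>

locale periodic_operator =
  fixes n :: nat and N :: "(int ^ 'd::finite) set" and a :: "nat \<Rightarrow> nat \<Rightarrow> int ^ 'd \<Rightarrow> complex"
    and V :: "'v set" and pt :: "nat \<Rightarrow> int ^ 'd \<Rightarrow> 'v"
    and T :: "('v \<Rightarrow> complex) \<Rightarrow> 'v \<Rightarrow> complex" and sym :: "real ^ 'd \<Rightarrow> complex mat"
  assumes finite_N: "finite N"
    and bij: "bij_betw (\<lambda>(j, m). pt j m) ({..<n} \<times> UNIV) V"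
    and T_pt: "j < n \<Longrightarrow> T f (pt j m) = (\<Sum>k<n. \<Sum>r\<in>N. a j k r * f (pt k (m + r)))"
    and T_outside: "v \<notin> V \<Longrightarrow> T f v = 0"
    and sym_carrier: "sym \<theta> \<in> carrier_mat n n"
    and sym_index: "j < n \<Longrightarrow> k < n \<Longrightarrow> sym \<theta> $$ (j, k) = (\<Sum>r\<in>N. a j k r * chr r \<theta>)"
    and sym_hermitian: "hermitian_mat n (sym \<theta>)"
begin

lemma pt_in: "j < n \<Longrightarrow> pt j m \<in> V"
  using bij_betwE[OF bij] by auto

lemma pt_inj: "j < n \<Longrightarrow> k < n \<Longrightarrow> pt j m = pt k r \<Longrightarrow> j = k \<and> m = r"
  using bij_betw_imp_inj_on[OF bij] unfolding inj_on_def by force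

lemma pt_cases:
  assumes "v \<in> V"
  obtains j m where "j < n" "v = pt j m"
proof -
  have "v \<in> (\<lambda>(j, m). pt j m) ` ({..<n} \<times> UNIV)" using assms bij_betw_imp_surj_on[OF bij] by simp
  then show thesis using that by auto
qed

definition supp :: "(int ^ 'd) set \<Rightarrow> ('v \<Rightarrow> complex) \<Rightarrow> bool" where
  "supp S f \<longleftrightarrow> (\<forall>v. v \<notin> V \<longrightarrow> f v = 0) \<and> (\<forall>j<n. \<forall>m. m \<notin> S \<longrightarrow> f (pt j m) = 0)"

text \<open>The Fourier transform of component \<open>j\<close>. With the sign in
  \<open>chr (- m)\<close>, a shift of the cell by \<open>r\<close> becomes multiplication by
  \<open>chr r \<theta>\<close>, in agreement with the symbol. The finite set \<open>S\<close> is
  explicit so that the sum is always finite.\<close>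

definition hat :: "(int ^ 'd) set \<Rightarrow> ('v \<Rightarrow> complex) \<Rightarrow> real ^ 'd \<Rightarrow> nat \<Rightarrow> complex" where
  "hat S f \<theta> j = (\<Sum>m\<in>S. f (pt j m) * chr (- m) \<theta>)"

text \<open>Cells that can be reached by applying \<open>T\<close> once. The set \<open>S\<close>
  itself is included so that \<open>T f - x * f\<close> is covered as well.\<close>

definition spread :: "(int ^ 'd) set \<Rightarrow> (int ^ 'd) set" where
  "spread S = S \<union> (\<lambda>(m, r). m - r) ` (S \<times> N)"

lemma finite_spread: "finite S \<Longrightarrow> finite (spread S)"
  using finite_N by (simp add: spread_def)

lemma hat_mono:
  assumes "supp S f" "finite S'" "S \<subseteq> S'" "j < n"
  shows "hat S' f \<theta> j = hat S f \<theta> j"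
  unfolding hat_def using assms by (intro sum.mono_neutral_right) (auto simp: supp_def)

lemma supp_T:
  assumes "supp S f"
  shows "supp (spread S) (T f)"
  unfolding supp_def
proof (intro conjI allI impI)
  fix j m assume j: "j < n" and m: "m \<notin> spread S"
  have "m + r \<notin> S" if "r \<in> N" for r
    using m that by (force simp: spread_def image_iff)
  then show "T f (pt j m) = 0"
    using assms j by (auto simp: T_pt supp_def intro!: sum.neutral)
qed (rule T_outside)

text \<open>Convolution becomes multiplication by the symbol. The identity is exact for any finite
  \<open>S'\<close> containing the spread, because then no shifted copy of the support is cut off;
  the freedom in \<open>S'\<close> lets several functions be transformed over the same set.\<close>

lemma hat_T:
  assumes f: "supp S f" and S': "finite S'" "spread S \<subseteq> S'" and j: "j < n"
  shows "hat S' (T f) \<theta> j = act n (sym \<theta>) (hat S' f \<theta>) j"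
proof -
  have S: "S \<subseteq> S'" using S'(2) by (auto simp: spread_def)
  have shift: "(\<Sum>m\<in>S'. f (pt k (m + r)) * chr (- m) \<theta>) = chr r \<theta> * hat S' f \<theta> k"
    if k: "k < n" and r: "r \<in> N" for k r
  proof -
    have sub: "(\<lambda>m. m - r) ` S \<subseteq> S'" using S'(2) r by (force simp: spread_def)
    have "(\<Sum>m\<in>S'. f (pt k (m + r)) * chr (- m) \<theta>)
        = (\<Sum>m\<in>(\<lambda>m. m - r) ` S. f (pt k (m + r)) * chr (- m) \<theta>)"
    proof (rule sum.mono_neutral_right[OF S'(1) sub], intro ballI)
      fix m assume "m \<in> S' - (\<lambda>m. m - r) ` S"
      then have "m + r \<notin> S" by (force simp: image_iff)
      then show "f (pt k (m + r)) * chr (- m) \<theta> = 0" using f k by (simp add: supp_def)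
    qed
    also have "\<dots> = (\<Sum>m\<in>S. f (pt k m) * chr (- (m - r)) \<theta>)"
      by (subst sum.reindex) (auto simp: inj_on_def)
    also have "\<dots> = chr r \<theta> * hat S f \<theta> k"
      unfolding hat_def sum_distrib_left
      by (intro sum.cong refl) (simp add: chr_diff chr_minus mult_ac)
    finally show ?thesis using hat_mono[OF f S'(1) S k] by simp
  qed
  have "hat S' (T f) \<theta> j = (\<Sum>m\<in>S'. \<Sum>k<n. \<Sum>r\<in>N. a j k r * (f (pt k (m + r)) * chr (- m) \<theta>))"
    unfolding hat_def using j by (simp add: T_pt sum_distrib_right mult.assoc)
  also have "\<dots> = (\<Sum>k<n. \<Sum>m\<in>S'. \<Sum>r\<in>N. a j k r * (f (pt k (m + r)) * chr (- m) \<theta>))"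
    by (rule sum.swap)
  also have "\<dots> = (\<Sum>k<n. \<Sum>r\<in>N. a j k r * (\<Sum>m\<in>S'. f (pt k (m + r)) * chr (- m) \<theta>))"
    by (rule sum.cong[OF refl], subst sum.swap) (simp add: sum_distrib_left)
  also have "\<dots> = (\<Sum>k<n. \<Sum>r\<in>N. a j k r * (chr r \<theta> * hat S' f \<theta> k))"
    using shift by (intro sum.cong refl) auto
  also have "\<dots> = act n (sym \<theta>) (hat S' f \<theta>) j"
    unfolding act_def using j by (intro sum.cong refl) (auto simp: sym_index sum_distrib_right sum_distrib_left mult_ac)
  finally show ?thesis .
qed

lemma L2_set_supp:
  assumes "supp S f" "finite S"
  shows "finite G \<Longrightarrow> L2_set (\<lambda>v. cmod (f v)) G \<le> sqrt (\<Sum>j<n. \<Sum>m\<in>S. (cmod (f (pt j m)))\<^sup>2)"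
    and "finite F \<Longrightarrow> (\<And>v. v \<notin> F \<Longrightarrow> f v = 0) \<Longrightarrow>
      sqrt (\<Sum>j<n. \<Sum>m\<in>S. (cmod (f (pt j m)))\<^sup>2) \<le> L2_set (\<lambda>v. cmod (f v)) F"
proof -
  define W where "W = (\<lambda>(j, m). pt j m) ` ({..<n} \<times> S)"
  have W: "finite W" using assms(2) by (simp add: W_def)
  have out: "f v = 0" if "v \<notin> W" for v
  proof (cases "v \<in> V")
    case True
    then obtain j m where "j < n" "v = pt j m" by (rule pt_cases)
    then show ?thesis using that assms(1) by (force simp: W_def supp_def)
  next
    case False
    then show ?thesis using assms(1) by (simp add: supp_def)
  qed
  have "inj_on (\<lambda>(j, m). pt j m) ({..<n} \<times> S)"
    using bij_betw_imp_inj_on[OF bij] by (rule inj_on_subset) auto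
  then have eq: "(\<Sum>j<n. \<Sum>m\<in>S. (cmod (f (pt j m)))\<^sup>2) = (\<Sum>v\<in>W. (cmod (f v))\<^sup>2)"
    unfolding W_def by (subst sum.reindex) (auto simp: sum.cartesian_product case_prod_unfold intro!: sum.cong)
  have le: "(\<Sum>v\<in>G. (cmod (f v))\<^sup>2) \<le> (\<Sum>v\<in>F. (cmod (f v))\<^sup>2)"
    if "finite G" "finite F" "\<And>v. v \<notin> F \<Longrightarrow> f v = 0" for F G
  proof -
    have "(\<Sum>v\<in>G. (cmod (f v))\<^sup>2) = (\<Sum>v\<in>G \<inter> F. (cmod (f v))\<^sup>2)"
      using that by (intro sum.mono_neutral_right) auto
    also have "\<dots> \<le> (\<Sum>v\<in>F. (cmod (f v))\<^sup>2)" using that by (intro sum_mono2) auto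
    finally show ?thesis .
  qed
  show "finite G \<Longrightarrow> L2_set (\<lambda>v. cmod (f v)) G \<le> sqrt (\<Sum>j<n. \<Sum>m\<in>S. (cmod (f (pt j m)))\<^sup>2)"
    unfolding L2_set_def eq using le[OF _ W out] by simp
  show "finite F \<Longrightarrow> (\<And>v. v \<notin> F \<Longrightarrow> f v = 0) \<Longrightarrow>
      sqrt (\<Sum>j<n. \<Sum>m\<in>S. (cmod (f (pt j m)))\<^sup>2) \<le> L2_set (\<lambda>v. cmod (f v)) F"
    unfolding L2_set_def eq using le[OF W] by simp
qed

text \<open>Both functions use the same \<open>S\<close>, hence the same sample points of the
  discrete Plancherel identity. Summing the fibrewise inequality over these points and over the
  components gives the bound in position space, and the number of sample points cancels.\<close>

lemma fourier_bound:
  assumes "finite S" "0 \<le> K" and supp: "supp S f" "supp S g"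
    and bound: "\<And>\<theta>. nsq n (hat S g \<theta>) \<le> K\<^sup>2 * nsq n (hat S f \<theta>)"
    and F: "finite F" "\<And>v. v \<notin> F \<Longrightarrow> f v = 0" and G: "finite G"
  shows "L2_set (\<lambda>v. cmod (g v)) G \<le> K * L2_set (\<lambda>v. cmod (f v)) F"
proof -
  obtain P :: "('d \<Rightarrow> nat) set" and \<theta> where P: "finite P" "P \<noteq> {}"
    and pl: "\<And>c. (\<Sum>p\<in>P. (cmod (\<Sum>m\<in>S. c m * chr (- m) (\<theta> p)))\<^sup>2) = real (card P) * (\<Sum>m\<in>S. (cmod (c m))\<^sup>2)"
    using plancherel[OF assms(1)] by blast
  have card: "real (card P) > 0" using P by (simp add: card_gt_0_iff)
  have eq: "(\<Sum>p\<in>P. nsq n (hat S h (\<theta> p))) = real (card P) * (\<Sum>j<n. \<Sum>m\<in>S. (cmod (h (pt j m)))\<^sup>2)" for h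
    unfolding nsq_def hat_def by (subst sum.swap) (simp add: pl sum_distrib_left)
  have "(\<Sum>p\<in>P. nsq n (hat S g (\<theta> p))) \<le> K\<^sup>2 * (\<Sum>p\<in>P. nsq n (hat S f (\<theta> p)))"
    unfolding sum_distrib_left by (intro sum_mono bound)
  then have "real (card P) * (\<Sum>j<n. \<Sum>m\<in>S. (cmod (g (pt j m)))\<^sup>2)
      \<le> real (card P) * (K\<^sup>2 * (\<Sum>j<n. \<Sum>m\<in>S. (cmod (f (pt j m)))\<^sup>2))"
    unfolding eq by (simp add: mult_ac)
  then have le: "(\<Sum>j<n. \<Sum>m\<in>S. (cmod (g (pt j m)))\<^sup>2) \<le> K\<^sup>2 * (\<Sum>j<n. \<Sum>m\<in>S. (cmod (f (pt j m)))\<^sup>2)"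
    using card by simp
  have "L2_set (\<lambda>v. cmod (g v)) G \<le> sqrt (\<Sum>j<n. \<Sum>m\<in>S. (cmod (g (pt j m)))\<^sup>2)"
    using L2_set_supp(1)[OF supp(2) assms(1) G] .
  also have "\<dots> \<le> sqrt (K\<^sup>2 * (\<Sum>j<n. \<Sum>m\<in>S. (cmod (f (pt j m)))\<^sup>2))" using le by simp
  also have "\<dots> = K * sqrt (\<Sum>j<n. \<Sum>m\<in>S. (cmod (f (pt j m)))\<^sup>2)"
    using \<open>0 \<le> K\<close> by (simp add: real_sqrt_mult)
  also have "\<dots> \<le> K * L2_set (\<lambda>v. cmod (f v)) F"
    using L2_set_supp(2)[OF supp(1) assms(1) F] \<open>0 \<le> K\<close> by (rule mult_left_mono)
  finally show ?thesis .
qed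

end

context periodic_operator
begin

lemma T_diff: "T (\<lambda>v. f v - g v) v = T f v - T g v"
proof (cases "v \<in> V")
  case True
  then obtain j m where "j < n" "v = pt j m" by (rule pt_cases)
  then show ?thesis by (simp add: T_pt right_diff_distrib sum_subtractf)
qed (simp add: T_outside)

lemma T_scale: "T (\<lambda>v. c * f v) v = c * T f v"
proof (cases "v \<in> V")
  case True
  then obtain j m where "j < n" "v = pt j m" by (rule pt_cases)
  then show ?thesis by (simp add: T_pt sum_distrib_left mult_ac)
qed (simp add: T_outside)

lemma local_operator_shift: "local_operator V (\<lambda>f v. T f v - x * f v)"
proof
  fix f g v c
  show "T (\<lambda>v. f v - g v) v - x * (f v - g v) = T f v - x * f v - (T g v - x * g v)"
    by (simp add: T_diff algebra_simps)
  show "T (\<lambda>v. c * f v) v - x * (c * f v) = c * (T f v - x * f v)"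
    by (simp add: T_scale algebra_simps)
next
  fix v and f :: "'v \<Rightarrow> complex" assume "v \<notin> V" "f v = 0"
  then show "T f v - x * f v = 0" by (simp add: T_outside)
next
  fix v assume v: "v \<in> V"
  then obtain j m where jm: "j < n" "v = pt j m" by (rule pt_cases)
  define F where "F = insert v ((\<lambda>(k, r). pt k (m + r)) ` ({..<n} \<times> N))"
  have "finite F" "F \<subseteq> V" using finite_N pt_in v by (auto simp: F_def)
  moreover have "T f v - x * f v = T g v - x * g v" if "\<forall>u\<in>F. f u = g u" for f g
  proof -
    have "T f v = T g v"
      unfolding jm(2) T_pt[OF jm(1)] using that by (intro sum.cong refl) (auto simp: F_def)
    then show ?thesis using that by (simp add: F_def)
  qed
  ultimately show "\<exists>F. finite F \<and> F \<subseteq> V \<and>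
      (\<forall>f g. (\<forall>u\<in>F. f u = g u) \<longrightarrow> T f v - x * f v = T g v - x * g v)" by blast
next
  fix a' :: "nat \<Rightarrow> 'v \<Rightarrow> complex" and s v assume s: "\<And>u. (\<lambda>i. a' i u) sums s u"
  have "(\<lambda>i. T (a' i) v) sums T s v"
  proof (cases "v \<in> V")
    case True
    then obtain j m where "j < n" "v = pt j m" by (rule pt_cases)
    then show ?thesis by (simp add: T_pt) (intro sums_sum sums_mult s)
  qed (simp add: T_outside)
  then show "(\<lambda>i. T (a' i) v - x * a' i v) sums (T s v - x * s v)"
    by (intro sums_diff sums_mult s)
qed

lemma supp_exists:
  assumes "finite F" "F \<subseteq> V" "\<And>v. v \<notin> F \<Longrightarrow> f v = 0"
  shows "\<exists>S. finite S \<and> supp S f"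
proof (intro exI conjI)
  define W where "W = (\<lambda>(j, m). pt j m) -` F \<inter> ({..<n} \<times> UNIV)"
  have "finite W"
    unfolding W_def using assms(1) bij_betw_imp_inj_on[OF bij] by (rule finite_vimage_IntI)
  then show "finite (snd ` W)" by simp
  show "supp (snd ` W) f"
    unfolding supp_def using assms by (force simp: W_def image_iff)
qed

lemma supp_mono: "supp S f \<Longrightarrow> S \<subseteq> S' \<Longrightarrow> supp S' f"
  unfolding supp_def by blast

lemma spread_superset: "S \<subseteq> spread S"
  by (auto simp: spread_def)

lemma supp_shift:
  assumes "supp S f"
  shows "supp (spread S) (\<lambda>v. T f v - x * f v)"
  using supp_T[OF assms] supp_mono[OF assms spread_superset] by (simp add: supp_def)

lemma hat_shift:
  assumes "supp S f" "finite S'" "spread S \<subseteq> S'" "j < n"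
  shows "hat S' (\<lambda>v. T f v - x * f v) \<theta> j = act n (sym \<theta>) (hat S' f \<theta>) j - x * hat S' f \<theta> j"
  unfolding hat_T[OF assms, symmetric]
  by (simp add: hat_def left_diff_distrib sum_subtractf sum_distrib_left mult.assoc)

text \<open>With \<open>c \<le> |B| \<le> K\<close> on the Fourier side for \<open>B = T - x\<close>, the operator \<open>1 - B\<^sup>2 / K\<^sup>2\<close> is a
  contraction, so that \<open>B\<^sup>2\<close> is inverted by a Neumann series. This avoids Fourier series of
  infinitely supported functions.\<close>

theorem resolvent:
  assumes c: "0 < c" "c \<le> K"
    and ev: "\<And>\<theta> l. eigenvalue (sym \<theta>) (of_real l) \<Longrightarrow> c \<le> \<bar>l - x\<bar> \<and> \<bar>l - x\<bar> \<le> K"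
  shows "complex_of_real x \<notin> l2_spectrum V T"
proof -
  define \<xi> where "\<xi> = complex_of_real x"
  define M where "M = complex_of_real (K\<^sup>2)"
  define \<rho> where "\<rho> = 1 - c\<^sup>2 / K\<^sup>2"
  interpret local_operator V "\<lambda>f v. T f v - \<xi> * f v" by (rule local_operator_shift)
  have "c\<^sup>2 \<le> K\<^sup>2" using c by (intro power_mono) auto
  then have \<rho>: "0 \<le> \<rho>" "\<rho> < 1" using c by (auto simp: \<rho>_def divide_le_eq)
  have bound: "nsq n (\<lambda>j. act n (sym \<theta>) y j - \<xi> * y j) \<le> K\<^sup>2 * nsq n y" for \<theta> y
  proof (rule hermitian_bound[OF sym_hermitian])
    fix l :: real assume "eigenvalue (sym \<theta>) (of_real l)"
    from ev[OF this] show "cmod (of_real l - \<xi>) \<le> K"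
      unfolding \<xi>_def of_real_diff[symmetric] norm_of_real by simp
  qed (use c in auto)
  have contr: "nsq n (\<lambda>j. y j - (act n (sym \<theta>) (\<lambda>j. act n (sym \<theta>) y j - \<xi> * y j) j
      - \<xi> * (act n (sym \<theta>) y j - \<xi> * y j)) / M) \<le> \<rho>\<^sup>2 * nsq n y" for \<theta> y
  proof (rule hermitian_contraction[OF sym_hermitian \<rho>(1)])
    fix l :: real assume "eigenvalue (sym \<theta>) (of_real l)"
    from ev[OF this] have l: "c\<^sup>2 \<le> (l - x)\<^sup>2" "(l - x)\<^sup>2 \<le> K\<^sup>2"
      using c by (auto simp: abs_le_square_iff[symmetric])
    have "cmod (1 - (of_real l - \<xi>)\<^sup>2 / M) = \<bar>1 - (l - x)\<^sup>2 / K\<^sup>2\<bar>"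
      unfolding \<xi>_def M_def of_real_diff[symmetric] of_real_power[symmetric] of_real_divide[symmetric]
        of_real_1[symmetric, where 'a = complex] norm_of_real ..
    also have "\<dots> = 1 - (l - x)\<^sup>2 / K\<^sup>2" using l c by (auto simp: divide_le_eq)
    also have "\<dots> \<le> \<rho>" unfolding \<rho>_def using l c by (simp add: divide_right_mono)
    finally show "cmod (1 - (of_real l - \<xi>)\<^sup>2 / M) \<le> \<rho>" .
  qed
  have bounds: "L2_set (\<lambda>v. cmod (T f v - \<xi> * f v)) G \<le> K * L2_set (\<lambda>v. cmod (f v)) F"
    "L2_set (\<lambda>v. cmod (f v - (T (\<lambda>v. T f v - \<xi> * f v) v - \<xi> * (T f v - \<xi> * f v)) / M)) G
      \<le> \<rho> * L2_set (\<lambda>v. cmod (f v)) F"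
    if F: "finite F" "F \<subseteq> V" "\<And>v. v \<notin> F \<Longrightarrow> f v = 0" and G: "finite G"
    for f :: "'v \<Rightarrow> complex" and F G :: "'v set"
  proof -
    define g where "g v = T f v - \<xi> * f v" for v
    define h where "h v = T g v - \<xi> * g v" for v
    have "\<exists>S. finite S \<and> supp S f" by (rule supp_exists[OF F])
    then obtain S where S: "finite S" "supp S f" by (elim exE conjE)
    \<comment> \<open>One enlargement of the support for each application of \<open>T\<close>:
      \<open>g\<close> lives on \<open>S1\<close> and \<open>h\<close>, which involves the square,
      on \<open>S2\<close>.\<close>
    define S1 S2 where "S1 = spread S" and "S2 = spread S1"
    have fin: "finite S1" "finite S2" using S by (auto simp: S1_def S2_def finite_spread)
    have sub: "S \<subseteq> S1" "S1 \<subseteq> S2" using spread_superset by (auto simp: S1_def S2_def)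
    have g: "supp S1 g" unfolding g_def S1_def by (rule supp_shift[OF S(2)])
    have h: "supp S2 h" unfolding h_def S2_def by (rule supp_shift[OF g])
    have f1: "supp S1 f" and f2: "supp S2 f" using supp_mono[OF S(2)] sub by auto
    have hat_g: "hat S' g \<theta> j = act n (sym \<theta>) (hat S' f \<theta>) j - \<xi> * hat S' f \<theta> j"
      if "finite S'" "S1 \<subseteq> S'" "j < n" for S' \<theta> j
      unfolding g_def using that by (intro hat_shift[OF S(2)]) (auto simp: S1_def)
    have hat_h: "hat S2 h \<theta> j = act n (sym \<theta>) (hat S2 g \<theta>) j - \<xi> * hat S2 g \<theta> j"
      if "j < n" for \<theta> j
      unfolding h_def using that fin by (intro hat_shift[OF g]) (auto simp: S2_def)
    have "nsq n (hat S1 g \<theta>) \<le> K\<^sup>2 * nsq n (hat S1 f \<theta>)" for \<theta>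
    proof -
      have "nsq n (hat S1 g \<theta>) = nsq n (\<lambda>j. act n (sym \<theta>) (hat S1 f \<theta>) j - \<xi> * hat S1 f \<theta> j)"
        using hat_g fin by (intro nsq_cong) auto
      then show ?thesis using bound by simp
    qed
    then have "L2_set (\<lambda>v. cmod (g v)) G \<le> K * L2_set (\<lambda>v. cmod (f v)) F"
      using c F G by (intro fourier_bound[OF fin(1) _ f1 g]) auto
    then show "L2_set (\<lambda>v. cmod (T f v - \<xi> * f v)) G \<le> K * L2_set (\<lambda>v. cmod (f v)) F"
      by (simp add: g_def)
    define u where "u v = f v - h v / M" for v
    have u: "supp S2 u" using f2 h by (simp add: supp_def u_def)
    have "nsq n (hat S2 u \<theta>) \<le> \<rho>\<^sup>2 * nsq n (hat S2 f \<theta>)" for \<theta>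
    proof -
      have "hat S2 u \<theta> j = hat S2 f \<theta> j - hat S2 h \<theta> j / M" for j
        by (simp add: hat_def u_def left_diff_distrib sum_subtractf sum_divide_distrib)
      moreover have "act n (sym \<theta>) (hat S2 g \<theta>) j
          = act n (sym \<theta>) (\<lambda>j. act n (sym \<theta>) (hat S2 f \<theta>) j - \<xi> * hat S2 f \<theta> j) j" for j
        using hat_g fin sub by (intro act_cong) auto
      ultimately have "nsq n (hat S2 u \<theta>) = nsq n (\<lambda>j. hat S2 f \<theta> j -
          (act n (sym \<theta>) (\<lambda>j. act n (sym \<theta>) (hat S2 f \<theta>) j - \<xi> * hat S2 f \<theta> j) j
          - \<xi> * (act n (sym \<theta>) (hat S2 f \<theta>) j - \<xi> * hat S2 f \<theta> j)) / M)"
        using hat_h hat_g fin sub by (intro nsq_cong) auto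
      then show ?thesis using contr by simp
    qed
    then have "L2_set (\<lambda>v. cmod (u v)) G \<le> \<rho> * L2_set (\<lambda>v. cmod (f v)) F"
      using \<rho> F G by (intro fourier_bound[OF fin(2) _ f2 u]) auto
    then show "L2_set (\<lambda>v. cmod (f v - (T (\<lambda>v. T f v - \<xi> * f v) v - \<xi> * (T f v - \<xi> * f v)) / M)) G
        \<le> \<rho> * L2_set (\<lambda>v. cmod (f v)) F"
      by (simp add: u_def h_def g_def[abs_def])
  qed
  have "0 \<le> K" "M \<noteq> 0" using c by (auto simp: M_def)
  note inv = invertible[OF this(1) \<rho> this(2) bounds(1) bounds(2)]
  have "bij_betw (\<lambda>f v. T f v - \<xi> * f v) (l2 V) (l2 V)" by (rule inv)
  moreover have "\<exists>C. \<forall>f\<in>l2 V. l2norm V f \<le> C * l2norm V (\<lambda>v. T f v - \<xi> * f v)" by (rule inv)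
  ultimately show ?thesis unfolding l2_spectrum_def \<xi>_def by blast
qed

section \<open>Regularity of the symbol and distance to its eigenvalues\<close>

lemma sym_bounded: "\<exists>R\<ge>0. \<forall>\<theta>. \<forall>i<n. \<forall>j<n. cmod (sym \<theta> $$ (i, j)) \<le> R"
proof (intro exI conjI allI impI)
  define R where "R = (\<Sum>i<n. \<Sum>j<n. \<Sum>r\<in>N. cmod (a i j r))"
  show "0 \<le> R" unfolding R_def by (intro sum_nonneg) auto
  fix \<theta> i j assume i: "i < n" and j: "j < n"
  have "cmod (sym \<theta> $$ (i, j)) \<le> (\<Sum>r\<in>N. cmod (a i j r))"
    unfolding sym_index[OF i j] by (intro sum_norm_le) (simp add: norm_mult)
  also have "\<dots> \<le> (\<Sum>j<n. \<Sum>r\<in>N. cmod (a i j r))"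
    using j by (intro member_le_sum[of j "{..<n}" "\<lambda>j. \<Sum>r\<in>N. cmod (a i j r)"]) (auto intro: sum_nonneg)
  also have "\<dots> \<le> R"
    unfolding R_def using i
    by (intro member_le_sum[of i "{..<n}" "\<lambda>i. \<Sum>j<n. \<Sum>r\<in>N. cmod (a i j r)"]) (auto intro!: sum_nonneg)
  finally show "cmod (sym \<theta> $$ (i, j)) \<le> R" .
qed

lemma sym_continuous: "i < n \<Longrightarrow> j < n \<Longrightarrow> continuous_on UNIV (\<lambda>\<theta>. sym \<theta> $$ (i, j))"
  by (simp add: sym_index) (intro continuous_intros continuous_on_chr)

lemma sym_periodic: "\<exists>\<theta>'\<in>cbox 0 (\<chi> s. 2 * pi). sym \<theta>' = sym \<theta>"
proof -
  obtain \<theta>' where "\<theta>' \<in> cbox 0 (\<chi> s. 2 * pi)" and eq: "\<And>m. chr m \<theta>' = chr m \<theta>"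
    using chr_periodic by blast
  moreover have "sym \<theta>' = sym \<theta>"
    using sym_carrier[of \<theta>] sym_carrier[of \<theta>'] by (intro eq_matI) (auto simp: sym_index eq)
  ultimately show ?thesis by blast
qed

text \<open>By the Leibniz formula the determinant is a polynomial in the entries. Joint continuity
  in \<theta> and the spectral parameter makes the set of pairs where the latter is an eigenvalue
  closed.\<close>

lemma char_det_continuous:
  "continuous_on UNIV (\<lambda>z :: (real ^ 'd) \<times> real. det (char_matrix (sym (fst z)) (of_real (snd z))))"
proof -
  have C: "char_matrix (sym \<theta>) k \<in> carrier_mat n n" for \<theta> k
    using sym_carrier[of \<theta>] by (simp add: char_matrix_def)
  have entry: "char_matrix (sym \<theta>) k $$ (i, j) = sym \<theta> $$ (i, j) - (if i = j then k else 0)"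
    if "i < n" "j < n" for i j \<theta> k
    using that sym_carrier[of \<theta>] by (auto simp: char_matrix_def)
  have cont: "continuous_on UNIV (\<lambda>z :: (real ^ 'd) \<times> real. sym (fst z) $$ (i, j))"
    if "i < n" "j < n" for i j
    using continuous_on_compose2[OF sym_continuous[OF that] continuous_on_fst[OF continuous_on_id]] by simp
  have ent: "continuous_on UNIV (\<lambda>z :: (real ^ 'd) \<times> real.
      char_matrix (sym (fst z)) (of_real (snd z)) $$ (i, j))" if "i < n" "j < n" for i j
    unfolding entry[OF that] using cont[OF that] by (cases "i = j") (auto intro!: continuous_intros)
  have perm: "p i < n" if "p permutes {0..<n}" "i < n" for p i
    using permutes_in_image[OF that(1), of i] that(2) by simp
  show ?thesis
    unfolding det_def'[OF C]
  proof (rule continuous_on_sum)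
    fix p assume "p \<in> {p. p permutes {0..<n}}"
    then have p: "p permutes {0..<n}" by simp
    have "continuous_on UNIV (\<lambda>z :: (real ^ 'd) \<times> real.
        \<Prod>i = 0..<n. char_matrix (sym (fst z)) (of_real (snd z)) $$ (i, p i))"
      by (rule continuous_on_prod, rule ent) (use perm[OF p] in auto)
    then show "continuous_on UNIV (\<lambda>z :: (real ^ 'd) \<times> real.
        signof p * (\<Prod>i = 0..<n. char_matrix (sym (fst z)) (of_real (snd z)) $$ (i, p i)))"
      by (intro continuous_on_mult continuous_on_const)
  qed
qed

text \<open>The pairs of a \<theta> in a period cell and an eigenvalue within 1 of \<open>x\<close>
  form a compact set, and its projection to the real line is a closed set missing \<open>x\<close>.
  Eigenvalues outside this window are at distance more than 1, which explains
  \<open>min e 1\<close>.\<close>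

lemma eigenvalues_isolated_from:
  assumes "\<And>\<theta>. \<not> eigenvalue (sym \<theta>) (of_real x)"
  shows "\<exists>c>0. \<forall>\<theta> l. eigenvalue (sym \<theta>) (of_real l) \<longrightarrow> c \<le> \<bar>l - x\<bar>"
proof -
  define D where "D z = det (char_matrix (sym (fst z)) (of_real (snd z)))" for z :: "(real ^ 'd) \<times> real"
  define E where "E = {z \<in> cbox 0 (\<chi> s. 2 * pi) \<times> {x - 1..x + 1}. D z = 0}"
  have D_iff: "D (\<theta>, l) = 0 \<longleftrightarrow> eigenvalue (sym \<theta>) (of_real l)" for \<theta> l
    unfolding D_def by (simp add: eigenvalue_det[OF sym_carrier])
  have "closed {z. D z = 0}"
  proof -
    have "continuous_on UNIV D" unfolding D_def[abs_def] by (rule char_det_continuous)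
    then have "closed (D -` {0})"
      by (intro continuous_closed_vimage) (auto simp: continuous_on_eq_continuous_at)
    moreover have "D -` {0} = {z. D z = 0}" by auto
    ultimately show ?thesis by simp
  qed
  moreover have "E = (cbox 0 (\<chi> s. 2 * pi) \<times> {x - 1..x + 1}) \<inter> {z. D z = 0}" by (auto simp: E_def)
  ultimately have "compact E" by (auto intro!: compact_Int_closed compact_Times)
  then have "compact (snd ` E)" by (intro compact_continuous_image continuous_intros)
  then have "open (- snd ` E)" by (simp add: compact_imp_closed open_Compl)
  moreover have "x \<in> - snd ` E" using assms D_iff by (auto simp: E_def)
  ultimately obtain e where e: "e > 0" "ball x e \<subseteq> - snd ` E"
    unfolding open_contains_ball by blast
  have "min e 1 \<le> \<bar>l - x\<bar>" if ev: "eigenvalue (sym \<theta>) (of_real l)" for \<theta> l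
  proof (rule ccontr)
    assume *: "\<not> min e 1 \<le> \<bar>l - x\<bar>"
    obtain \<theta>' where \<theta>': "\<theta>' \<in> cbox 0 (\<chi> s. 2 * pi)" "sym \<theta>' = sym \<theta>" using sym_periodic by blast
    then have "D (\<theta>', l) = 0" using ev by (simp add: D_iff)
    then have "(\<theta>', l) \<in> E" using \<theta>'(1) * by (auto simp: E_def)
    then have "l \<in> snd ` E" by force
    moreover have "l \<in> ball x e" using * by (auto simp: dist_real_def)
    ultimately show False using e(2) by blast
  qed
  then show ?thesis using e(1) by (intro exI[of _ "min e 1"]) auto
qed

lemma not_eigenvalue_not_spectrum:
  assumes "\<And>\<theta>. \<not> eigenvalue (sym \<theta>) (of_real x)"
  shows "complex_of_real x \<notin> l2_spectrum V T"
proof -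
  obtain c where c: "c > 0" "\<And>\<theta> l. eigenvalue (sym \<theta>) (of_real l) \<Longrightarrow> c \<le> \<bar>l - x\<bar>"
    using eigenvalues_isolated_from[OF assms] by blast
  obtain R where R: "R \<ge> 0" "\<And>\<theta> i j. i < n \<Longrightarrow> j < n \<Longrightarrow> cmod (sym \<theta> $$ (i, j)) \<le> R"
    using sym_bounded by blast
  define K where "K = max c (real n * R + \<bar>x\<bar>)"
  show ?thesis
  proof (rule resolvent[of c K])
    fix \<theta> l assume ev: "eigenvalue (sym \<theta>) (of_real l)"
    have "\<bar>l\<bar> \<le> real n * R"
      using eigenvalue_norm_le[OF sym_carrier ev R(2) R(1)] by simp
    then show "c \<le> \<bar>l - x\<bar> \<and> \<bar>l - x\<bar> \<le> K" using c(2)[OF ev] by (auto simp: K_def)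
  qed (use c in \<open>auto simp: K_def\<close>)
qed

end

section \<open>Exponential weights on the lattice\<close>

definition l1norm :: "int ^ 'd::finite \<Rightarrow> nat" where
  "l1norm m = (\<Sum>s\<in>UNIV. nat \<bar>m $ s\<bar>)"

lemma l1norm_triangle: "l1norm (m + k) \<le> l1norm m + l1norm k"
  unfolding l1norm_def sum.distrib[symmetric] by (intro sum_mono) auto

lemma l1norm_minus: "l1norm (- m) = l1norm m"
  by (simp add: l1norm_def)

lemma geometric_sum_symmetric:
  fixes b :: real
  assumes "0 \<le> b" "b < 1"
  shows "(\<Sum>k\<in>{-L..L::int}. b ^ nat \<bar>k\<bar>) \<le> 2 / (1 - b)"
proof -
  have sub: "{-L..L} \<subseteq> int ` {..nat L} \<union> (\<lambda>k. - int k) ` {..nat L}"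
  proof
    fix k assume "k \<in> {-L..L}"
    then have "k = int (nat k) \<and> nat k \<le> nat L \<or> k = - int (nat (- k)) \<and> nat (- k) \<le> nat L"
      by (cases "0 \<le> k") auto
    then show "k \<in> int ` {..nat L} \<union> (\<lambda>k. - int k) ` {..nat L}" by blast
  qed
  have half: "(\<Sum>k\<le>nat L. b ^ k) \<le> 1 / (1 - b)"
    using sum_le_suminf[of "\<lambda>k. b ^ k" "{..nat L}"] assms
    by (simp add: summable_geometric suminf_geometric)
  have "(\<Sum>k\<in>{-L..L}. b ^ nat \<bar>k\<bar>) \<le> (\<Sum>k\<in>int ` {..nat L} \<union> (\<lambda>k. - int k) ` {..nat L}. b ^ nat \<bar>k\<bar>)"
    using assms by (intro sum_mono2 sub) auto
  also have "\<dots> \<le> (\<Sum>k\<in>int ` {..nat L}. b ^ nat \<bar>k\<bar>) + (\<Sum>k\<in>(\<lambda>k. - int k) ` {..nat L}. b ^ nat \<bar>k\<bar>)"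
    using assms by (subst sum.union_inter[symmetric]) (auto intro!: sum_nonneg)
  also have "\<dots> = 2 * (\<Sum>k\<le>nat L. b ^ k)"
    by (simp add: sum.reindex inj_on_def)
  also have "\<dots> \<le> 2 / (1 - b)" using half by simp
  finally show ?thesis .
qed

text \<open>The weight is a product over coordinates and a finite set fits into a box, where the sum
  factorizes into geometric sums. Each factor is at most 2 / (1 - b) whatever the size of the
  box.\<close>

lemma weight_sum_bounded:
  fixes b :: real
  assumes "0 \<le> b" "b < 1"
  shows "\<exists>C. \<forall>S :: (int ^ 'd::finite) set. finite S \<longrightarrow> (\<Sum>m\<in>S. b ^ l1norm m) \<le> C"
proof (intro exI allI impI)
  fix S :: "(int ^ 'd) set" assume S: "finite S"
  define L where "L = (\<Sum>m\<in>S. int (l1norm m))"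
  have L: "\<bar>m $ s\<bar> \<le> L" if "m \<in> S" for m :: "int ^ 'd" and s
  proof -
    have "nat \<bar>m $ s\<bar> \<le> l1norm m" unfolding l1norm_def by (intro member_le_sum) auto
    moreover have "int (l1norm m) \<le> L" unfolding L_def using S that by (intro member_le_sum) auto
    ultimately show ?thesis by linarith
  qed
  define P where "P = (UNIV :: 'd set) \<rightarrow>\<^sub>E {-L..L}"
  have finP: "finite P" unfolding P_def by (intro finite_PiE) auto
  have "S \<subseteq> (\<lambda>p. \<chi> s. p s) ` P"
  proof
    fix m assume "m \<in> S"
    then have "(\<lambda>s. m $ s) \<in> P" using L by (force simp: P_def abs_le_iff)
    moreover have "m = (\<chi> s. m $ s)" by simp
    ultimately show "m \<in> (\<lambda>p. \<chi> s. p s) ` P" by (metis image_eqI)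
  qed
  then have "(\<Sum>m\<in>S. b ^ l1norm m) \<le> (\<Sum>m\<in>(\<lambda>p. \<chi> s. p s) ` P. b ^ l1norm m)"
    using finP assms by (intro sum_mono2) auto
  also have "\<dots> = (\<Sum>p\<in>P. \<Prod>s\<in>UNIV. b ^ nat \<bar>p s\<bar>)"
    by (subst sum.reindex) (auto simp: inj_on_def Finite_Cartesian_Product.vec_eq_iff l1norm_def power_sum)
  also have "\<dots> = (\<Prod>s\<in>(UNIV :: 'd set). \<Sum>k\<in>{-L..L}. b ^ nat \<bar>k\<bar>)"
    unfolding P_def by (rule prod_sum_PiE[symmetric]) auto
  also have "\<dots> \<le> (\<Prod>s\<in>(UNIV :: 'd set). 2 / (1 - b))"
    using geometric_sum_symmetric[OF assms] assms by (intro prod_mono) (auto intro: sum_nonneg)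
  finally show "(\<Sum>m\<in>S. b ^ l1norm m) \<le> (\<Prod>s\<in>(UNIV :: 'd set). 2 / (1 - b))" .
qed

text \<open>By the triangle inequality a step \<open>r\<close> changes the exponent by at most W, so
  the weight changes by a factor between \<eta>^-W and \<eta>^W. The inequality 2 - y \<le> 1 / y
  for positive y brings the lower deviation under the same bound \<eta>^W - 1 as the upper
  one.\<close>

lemma weight_ratio:
  fixes \<eta> :: real
  assumes "1 \<le> \<eta>" "l1norm r \<le> W"
  shows "\<bar>(1 / \<eta>) ^ l1norm (m + r) - (1 / \<eta>) ^ l1norm m\<bar> \<le> (\<eta> ^ W - 1) * (1 / \<eta>) ^ l1norm m"
proof -
  define b where "b = 1 / \<eta>"
  have b: "0 < b" "b \<le> 1" "b * \<eta> = 1" using assms by (auto simp: b_def)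
  have inv: "b ^ k * \<eta> ^ k = 1" for k using b(3) by (simp flip: power_mult_distrib)
  have le: "l1norm (m + r) \<le> l1norm m + l1norm r" "l1norm m \<le> l1norm (m + r) + l1norm r"
    using l1norm_triangle[of m r] l1norm_triangle[of "m + r" "- r"] by (auto simp: l1norm_minus)
  have W: "\<eta> ^ l1norm r \<le> \<eta> ^ W" using assms by (intro power_increasing) auto
  have "b ^ (l1norm (m + r) + l1norm r) \<le> b ^ l1norm m"
    using le(2) b by (intro power_decreasing) auto
  then have "b ^ l1norm (m + r) * (b ^ l1norm r * \<eta> ^ l1norm r) \<le> b ^ l1norm m * \<eta> ^ l1norm r"
    using assms by (simp add: power_add mult_right_mono flip: mult.assoc)
  then have up: "b ^ l1norm (m + r) \<le> b ^ l1norm m * \<eta> ^ l1norm r" by (simp add: inv)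
  also have "\<dots> \<le> b ^ l1norm m * \<eta> ^ W" using W b by (intro mult_left_mono) auto
  finally have 1: "b ^ l1norm (m + r) - b ^ l1norm m \<le> (\<eta> ^ W - 1) * b ^ l1norm m"
    by (simp add: algebra_simps)
  have "b ^ l1norm m * b ^ l1norm r \<le> b ^ l1norm (m + r)"
    unfolding power_add[symmetric] using le(1) b by (intro power_decreasing) auto
  moreover have "2 - \<eta> ^ W \<le> b ^ l1norm r"
  proof -
    define y where "y = \<eta> ^ l1norm r"
    have y: "y > 0" "b ^ l1norm r = 1 / y"
      using assms inv[of "l1norm r"] by (auto simp: y_def field_simps)
    have "0 \<le> (y - 1)\<^sup>2" by simp
    then have "2 - y \<le> 1 / y" using y(1) by (simp add: field_simps power2_eq_square)
    then show ?thesis using W y by (simp add: y_def)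
  qed
  then have "b ^ l1norm m * (2 - \<eta> ^ W) \<le> b ^ l1norm m * b ^ l1norm r"
    using b by (intro mult_left_mono) auto
  ultimately have "b ^ l1norm m - b ^ l1norm (m + r) \<le> (\<eta> ^ W - 1) * b ^ l1norm m"
    by (simp add: algebra_simps)
  with 1 show ?thesis by (simp add: b_def abs_le_iff)
qed

context periodic_operator
begin

lemma sum_cover:
  assumes "finite G" "G \<subseteq> V"
  shows "\<exists>S. finite S \<and> (\<forall>h :: 'v \<Rightarrow> real. (\<forall>v. 0 \<le> h v) \<longrightarrow> sum h G \<le> (\<Sum>j<n. \<Sum>m\<in>S. h (pt j m)))"
proof -
  define W where "W = (\<lambda>(j, m). pt j m) -` G \<inter> ({..<n} \<times> UNIV)"
  have "finite W"
    unfolding W_def using assms(1) bij_betw_imp_inj_on[OF bij] by (rule finite_vimage_IntI)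
  then have fin: "finite (snd ` W)" by simp
  have inj: "inj_on (\<lambda>(j, m). pt j m) ({..<n} \<times> snd ` W)"
    using bij_betw_imp_inj_on[OF bij] by (rule inj_on_subset) auto
  have sub: "G \<subseteq> (\<lambda>(j, m). pt j m) ` ({..<n} \<times> snd ` W)"
  proof
    fix v assume v: "v \<in> G"
    then have "v \<in> V" using assms by blast
    then obtain j m where "j < n" "v = pt j m" by (rule pt_cases)
    then show "v \<in> (\<lambda>(j, m). pt j m) ` ({..<n} \<times> snd ` W)" using v by (force simp: W_def image_iff)
  qed
  have "sum h G \<le> (\<Sum>j<n. \<Sum>m\<in>snd ` W. h (pt j m))" if "\<forall>v. 0 \<le> h v" for h :: "'v \<Rightarrow> real"
  proof -
    have "sum h G \<le> sum h ((\<lambda>(j, m). pt j m) ` ({..<n} \<times> snd ` W))"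
      using sub fin that by (intro sum_mono2) auto
    also have "\<dots> = (\<Sum>j<n. \<Sum>m\<in>snd ` W. h (pt j m))"
      using inj by (subst sum.reindex) (auto simp: sum.cartesian_product case_prod_unfold intro!: sum.cong)
    finally show ?thesis .
  qed
  then show ?thesis using fin by blast
qed

text \<open>The Bloch wave of an eigenvector, damped by the slowly decaying weight \<open>\<eta>\<^sup>-\<^sup>|\<^sup>m\<^sup>|\<close>, is an
  approximate eigenfunction in \<open>l2\<close>, with relative error \<open>O(\<eta>\<^sup>W - 1)\<close>.\<close>

lemma eigenvalue_spectrum:
  assumes ev: "eigenvalue (sym \<theta>) (of_real x)"
  shows "complex_of_real x \<in> l2_spectrum V T"
proof (rule ccontr)
  assume "complex_of_real x \<notin> l2_spectrum V T"
  then obtain C where C: "\<And>f. f \<in> l2 V \<Longrightarrow> l2norm V f \<le> C * l2norm V (\<lambda>v. T f v - of_real x * f v)"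
    unfolding l2_spectrum_def by blast
  obtain y j0 where j0: "j0 < n" "y j0 \<noteq> 0" and y: "\<forall>i<n. act n (sym \<theta>) y i = of_real x * y i"
    using ev unfolding eigenvalue_iff_act[OF sym_carrier] by blast
  define W where "W = (\<Sum>r\<in>N. l1norm r)"
  have W: "l1norm r \<le> W" if "r \<in> N" for r
    unfolding W_def using finite_N that by (intro member_le_sum) auto
  define D where "D = (\<Sum>j<n. \<Sum>k<n. \<Sum>r\<in>N. cmod (a j k r) * cmod (y k))"
  have D0: "0 \<le> D" unfolding D_def by (intro sum_nonneg) auto
  \<comment> \<open>The error is estimated by the sum of squared weights, and this sum is recovered
    from \<open>f\<close> through the single component \<open>j0\<close>, where the eigenvector does
    not vanish. Hence the division by \<open>cmod (y j0)\<close>.\<close>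
  define E where "E = D * sqrt (real n) / cmod (y j0)"
  have E0: "0 \<le> E" using D0 by (simp add: E_def)
  \<comment> \<open>The relative error tends to 0 as the damping is removed, while \<open>C\<close>
    and \<open>E\<close> stay fixed. Some \<epsilon> > 0 thus contradicts the bounded inverse, and
    for it the damped wave is still square-summable.\<close>
  have "((\<lambda>\<epsilon>. \<bar>C\<bar> * (((1 + \<epsilon>) ^ W - 1) * E)) \<longlongrightarrow> \<bar>C\<bar> * (((1 + 0) ^ W - 1) * E)) (at_right 0)"
    by (intro tendsto_intros)
  then have "\<forall>\<^sub>F \<epsilon> in at_right (0::real). \<bar>C\<bar> * (((1 + \<epsilon>) ^ W - 1) * E) < 1"
    by (rule order_tendstoD) simp
  then obtain \<epsilon> :: real where \<epsilon>: "\<epsilon> > 0" "\<bar>C\<bar> * (((1 + \<epsilon>) ^ W - 1) * E) < 1"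
    unfolding eventually_at_right_field by (metis dense)
  define \<eta> where "\<eta> = 1 + \<epsilon>"
  define \<delta> where "\<delta> = \<eta> ^ W - 1"
  have \<eta>: "\<eta> > 1" using \<epsilon> by (simp add: \<eta>_def)
  have \<delta>0: "0 \<le> \<delta>" using \<eta> by (simp add: \<delta>_def)
  define \<phi> where "\<phi> m = (1 / \<eta>) ^ l1norm m" for m :: "int ^ 'd"
  have \<phi>0: "0 < \<phi> m" for m using \<eta> by (simp add: \<phi>_def)
  have \<phi>_ratio: "\<bar>\<phi> (m + r) - \<phi> m\<bar> \<le> \<delta> * \<phi> m" if "r \<in> N" for m r
    unfolding \<phi>_def \<delta>_def using \<eta> W[OF that] by (intro weight_ratio) auto
  obtain B where B: "\<And>S. finite S \<Longrightarrow> (\<Sum>m\<in>S. (\<phi> m)\<^sup>2) \<le> B"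
  proof -
    have "(1 / \<eta>)\<^sup>2 < 1" using \<eta> by (simp add: power_divide one_less_power)
    then have "\<exists>C. \<forall>S :: (int ^ 'd) set. finite S \<longrightarrow> (\<Sum>m\<in>S. ((1 / \<eta>)\<^sup>2) ^ l1norm m) \<le> C"
      by (intro weight_sum_bounded) auto
    moreover have "((1 / \<eta>)\<^sup>2) ^ l1norm m = (\<phi> m)\<^sup>2" for m :: "int ^ 'd"
      by (simp add: \<phi>_def mult.commute flip: power_mult)
    ultimately show ?thesis using that by auto
  qed
  define ix where "ix = the_inv_into ({..<n} \<times> UNIV) (\<lambda>(j, m). pt j m)"
  have ix: "ix (pt j m) = (j, m)" if "j < n" for j m
    unfolding ix_def using the_inv_into_f_f[OF bij_betw_imp_inj_on[OF bij], of "(j, m)"] that by simp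
  define f where "f v = (if v \<in> V then (case ix v of (j, m) \<Rightarrow> y j * chr m \<theta> * of_real (\<phi> m)) else 0)" for v
  have f_pt: "f (pt j m) = y j * chr m \<theta> * of_real (\<phi> m)" if "j < n" for j m
    using that pt_in ix by (simp add: f_def)
  define g where "g v = T f v - of_real x * f v" for v
  have f_sq: "(cmod (f (pt j m)))\<^sup>2 = (cmod (y j))\<^sup>2 * (\<phi> m)\<^sup>2" if "j < n" for j m
    using that by (simp add: f_pt norm_mult power_mult_distrib)
  have f_l2: "f \<in> l2 V"
  proof (rule l2I(1))
    fix G assume G: "finite G" "G \<subseteq> V"
    obtain S where S: "finite S" and le: "\<forall>h :: 'v \<Rightarrow> real. (\<forall>v. 0 \<le> h v) \<longrightarrow> sum h G \<le> (\<Sum>j<n. \<Sum>m\<in>S. h (pt j m))"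
      using sum_cover[OF G] by blast
    have "(\<Sum>v\<in>G. (cmod (f v))\<^sup>2) \<le> (\<Sum>j<n. \<Sum>m\<in>S. (cmod (f (pt j m)))\<^sup>2)"
      by (rule le[rule_format]) simp
    also have "\<dots> = (\<Sum>j<n. (cmod (y j))\<^sup>2 * (\<Sum>m\<in>S. (\<phi> m)\<^sup>2))"
      by (intro sum.cong refl) (simp add: f_sq sum_distrib_left)
    also have "\<dots> \<le> (\<Sum>j<n. (cmod (y j))\<^sup>2 * B)"
      using B[OF S] by (intro sum_mono mult_left_mono) auto
    finally show "L2_set (\<lambda>v. cmod (f v)) G \<le> sqrt (\<Sum>j<n. (cmod (y j))\<^sup>2 * B)"
      unfolding L2_set_def by simp
  qed (simp add: f_def)
  have g_le: "cmod (g (pt j m)) \<le> \<delta> * D * \<phi> m" if j: "j < n" for j m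
  proof -
    have "(\<Sum>k<n. \<Sum>r\<in>N. a j k r * chr r \<theta> * y k) = act n (sym \<theta>) y j"
      unfolding act_def using j by (intro sum.cong refl) (simp add: sym_index sum_distrib_right)
    then have xy: "of_real x * y j = (\<Sum>k<n. \<Sum>r\<in>N. a j k r * chr r \<theta> * y k)" using y j by simp
    have "g (pt j m) = (\<Sum>k<n. \<Sum>r\<in>N. a j k r * (y k * chr (m + r) \<theta> * of_real (\<phi> (m + r))))
        - (of_real x * y j) * (chr m \<theta> * of_real (\<phi> m))"
      using j by (simp add: g_def T_pt f_pt)
    \<comment> \<open>Without damping the wave would satisfy the eigenvalue equation exactly, so
      only differences of weights remain.\<close>
    also have "\<dots> = (\<Sum>k<n. \<Sum>r\<in>N. a j k r * y k * chr (m + r) \<theta> * of_real (\<phi> (m + r) - \<phi> m))"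
      unfolding xy sum_distrib_right sum_subtractf[symmetric]
      by (intro sum.cong refl) (simp add: chr_add algebra_simps)
    also have "cmod \<dots> \<le> (\<Sum>k<n. \<Sum>r\<in>N. cmod (a j k r) * cmod (y k) * (\<delta> * \<phi> m))"
      using \<phi>_ratio
      by (intro sum_norm_le) (auto simp: norm_mult simp del: of_real_diff intro!: mult_left_mono)
    also have "\<dots> = (\<Sum>k<n. \<Sum>r\<in>N. cmod (a j k r) * cmod (y k)) * (\<delta> * \<phi> m)"
      by (simp add: sum_distrib_right)
    also have "\<dots> \<le> D * (\<delta> * \<phi> m)"
    proof (rule mult_right_mono)
      show "(\<Sum>k<n. \<Sum>r\<in>N. cmod (a j k r) * cmod (y k)) \<le> D"
        unfolding D_def using j
        by (intro member_le_sum[of j "{..<n}" "\<lambda>j. \<Sum>k<n. \<Sum>r\<in>N. cmod (a j k r) * cmod (y k)"])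
          (auto intro!: sum_nonneg)
      show "0 \<le> \<delta> * \<phi> m" using \<delta>0 \<phi>0[of m] by simp
    qed
    finally show ?thesis by (simp add: mult_ac)
  qed
  have g_norm: "l2norm V g \<le> \<delta> * E * l2norm V f"
  proof (rule l2I(2))
    fix G assume G: "finite G" "G \<subseteq> V"
    obtain S where S: "finite S" and le: "\<forall>h :: 'v \<Rightarrow> real. (\<forall>v. 0 \<le> h v) \<longrightarrow> sum h G \<le> (\<Sum>j<n. \<Sum>m\<in>S. h (pt j m))"
      using sum_cover[OF G] by blast
    \<comment> \<open>The sites of component \<open>j0\<close> in the cells \<open>S\<close>. Their
      contribution is a lower bound for the norm of \<open>f\<close> and is proportional to the sum
      of squared weights.\<close>
    define F where "F = pt j0 ` S"
    have F: "finite F" "F \<subseteq> V" using S pt_in j0 by (auto simp: F_def)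
    have "inj_on (pt j0) S" using pt_inj[OF j0(1) j0(1)] by (auto simp: inj_on_def)
    then have "(\<Sum>v\<in>F. (cmod (f v))\<^sup>2) = (cmod (y j0))\<^sup>2 * (\<Sum>m\<in>S. (\<phi> m)\<^sup>2)"
      unfolding F_def using j0 by (simp add: sum.reindex f_sq sum_distrib_left)
    then have \<phi>_sum: "(\<Sum>m\<in>S. (\<phi> m)\<^sup>2) = (\<Sum>v\<in>F. (cmod (f v))\<^sup>2) / (cmod (y j0))\<^sup>2"
      using j0(2) by simp
    have "(\<Sum>v\<in>G. (cmod (g v))\<^sup>2) \<le> (\<Sum>j<n. \<Sum>m\<in>S. (cmod (g (pt j m)))\<^sup>2)"
      by (rule le[rule_format]) simp
    also have "\<dots> \<le> (\<Sum>j<n. \<Sum>m\<in>S. (\<delta> * D * \<phi> m)\<^sup>2)"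
      using g_le by (intro sum_mono power_mono) auto
    also have "\<dots> = real n * ((\<delta> * D)\<^sup>2 * (\<Sum>m\<in>S. (\<phi> m)\<^sup>2))"
      by (simp add: power_mult_distrib sum_distrib_left)
    also have "\<dots> = (\<delta> * E)\<^sup>2 * (\<Sum>v\<in>F. (cmod (f v))\<^sup>2)"
      unfolding \<phi>_sum by (simp add: E_def power_mult_distrib power_divide)
    finally have "L2_set (\<lambda>v. cmod (g v)) G \<le> sqrt ((\<delta> * E)\<^sup>2 * (\<Sum>v\<in>F. (cmod (f v))\<^sup>2))"
      unfolding L2_set_def by simp
    also have "\<dots> = \<delta> * E * L2_set (\<lambda>v. cmod (f v)) F"
      unfolding L2_set_def using \<delta>0 E0 by (simp add: real_sqrt_mult)
    also have "\<dots> \<le> \<delta> * E * l2norm V f"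
      using L2_set_le_l2norm[OF f_l2 F] \<delta>0 E0 by (intro mult_left_mono) auto
    finally show "L2_set (\<lambda>v. cmod (g v)) G \<le> \<delta> * E * l2norm V f" .
  qed (simp add: g_def T_outside f_def)
  have "0 < cmod (f (pt j0 0))" using f_pt[OF j0(1), of 0] j0(2) \<phi>0[of 0] by simp
  also have "\<dots> \<le> l2norm V f" by (rule norm_le_l2norm[OF f_l2])
  finally have pos: "0 < l2norm V f" .
  have "l2norm V f \<le> C * l2norm V g" using C[OF f_l2] by (simp add: g_def[abs_def])
  also have "\<dots> \<le> \<bar>C\<bar> * l2norm V g" by (intro mult_right_mono l2norm_nonneg) auto
  also have "\<dots> \<le> \<bar>C\<bar> * (\<delta> * E * l2norm V f)" using g_norm by (intro mult_left_mono) auto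
  also have "\<dots> = (\<bar>C\<bar> * (\<delta> * E)) * l2norm V f" by simp
  also have "\<dots> < 1 * l2norm V f"
    using \<epsilon>(2) pos unfolding \<delta>_def \<eta>_def by (rule mult_strict_right_mono)
  finally show False by simp
qed

theorem spectrum_iff: "complex_of_real x \<in> l2_spectrum V T \<longleftrightarrow> (\<exists>\<theta>. eigenvalue (sym \<theta>) (of_real x))"
  using eigenvalue_spectrum not_eigenvalue_not_spectrum by blast

end

section \<open>Periodic graphs\<close>

text \<open>Loops count twice, once for each orientation, as in \<open>degree_at\<close>.\<close>

definition edge_count :: "('d::finite) pgraph \<Rightarrow> real ^ 'd \<Rightarrow> real ^ 'd \<Rightarrow> nat" where
  "edge_count G u v = card {e \<in> edges G. ends G e = {u, v}} * (if u = v then 2 else 1)"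

lemma edge_count_commute: "edge_count G u v = edge_count G v u"
  by (simp add: edge_count_def insert_commute)

locale periodic_graph =
  fixes G :: "('d::finite) pgraph"
  assumes graph: "zd_periodic_graph G"
begin

section \<open>Lattice coordinates and translations\<close>

definition comb :: "real ^ 'd \<Rightarrow> real ^ 'd" where
  "comb c = (\<Sum>s\<in>UNIV. (c $ s) *\<^sub>R period G s)"

lemma linear_comb: "linear comb"
  by (rule linearI) (simp_all add: comb_def scaleR_left_distrib sum.distrib scaleR_sum_right)

lemma inj_comb: "inj comb"
proof (rule linear_injective_0[OF linear_comb, THEN iffD2], intro allI impI)
  fix c assume c: "comb c = 0"
  have inj: "inj (period G)" and ind: "independent (range (period G))"
    using graph by (auto simp: zd_periodic_graph_def)
  \<comment> \<open>Independence speaks of the set of periods, so the coefficients are re-indexed by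
    vectors; injectivity of \<open>period G\<close> keeps distinct coordinates apart.\<close>
  define a where "a v = c $ inv_into UNIV (period G) v" for v
  have a: "a (period G s) = c $ s" for s by (simp add: a_def inv_into_f_f[OF inj UNIV_I])
  have "(\<Sum>v\<in>range (period G). a v *\<^sub>R v) = comb c"
    unfolding comb_def by (simp add: sum.reindex[OF inj] a)
  then have "(\<Sum>v\<in>range (period G). a v *\<^sub>R v) = 0" using c by simp
  then have "a (period G s) = 0" for s
    by (rule independentD[OF ind finite_imageI[OF finite] order_refl]) simp
  then have "c $ s = 0" for s by (simp add: a)
  then show "c = 0" by (simp add: Finite_Cartesian_Product.vec_eq_iff)
qed

lemma surj_comb: "surj comb"
  using linear_inj_imp_surj[OF linear_comb inj_comb] .

text \<open>The definite description in \<open>coord\<close> has exactly one witness, because d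
  independent vectors form a basis of R^d.\<close>

lemma comb_coord: "x = origin G + comb (coord G x)"
proof -
  obtain c where c: "x - origin G = comb c" using surj_comb by (metis surjD)
  have "coord G x = c"
    unfolding coord_def comb_def[symmetric]
  proof (rule the_equality)
    show "x = origin G + comb c" using c by (simp add: algebra_simps)
    fix c' assume "x = origin G + comb c'"
    then have "comb c' = comb c" using c by (simp add: algebra_simps)
    then show "c' = c" using inj_comb by (simp add: inj_def)
  qed
  then show ?thesis using c by (simp add: algebra_simps)
qed

lemma coord_eqI: "x = origin G + comb c \<Longrightarrow> coord G x = c"
  using comb_coord[of x] inj_comb by (metis add_left_cancel injD)

lemma lattice_vec_comb: "lattice_vec G m = comb (\<chi> s. of_int (m $ s))"
  by (simp add: lattice_vec_def comb_def)

lemma lattice_vec_add: "lattice_vec G (m + k) = lattice_vec G m + lattice_vec G k"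
  by (simp add: lattice_vec_def scaleR_left_distrib sum.distrib)

lemma lattice_vec_0 [simp]: "lattice_vec G 0 = 0"
  by (simp add: lattice_vec_def)

lemma lattice_vec_minus: "lattice_vec G (- m) = - lattice_vec G m"
  by (simp add: lattice_vec_def sum_negf)

lemma lattice_vec_eq_iff [simp]: "lattice_vec G m = lattice_vec G k \<longleftrightarrow> m = k"
proof
  assume "lattice_vec G m = lattice_vec G k"
  then have "(\<chi> s. real_of_int (m $ s)) = (\<chi> s. of_int (k $ s))"
    unfolding lattice_vec_comb using inj_comb by (simp only: inj_eq)
  then show "m = k" by (simp add: Finite_Cartesian_Product.vec_eq_iff)
qed simp

lemma coord_shift: "coord G (x + lattice_vec G m) = coord G x + (\<chi> s. of_int (m $ s))"
proof (rule coord_eqI)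
  show "x + lattice_vec G m = origin G + comb (coord G x + (\<chi> s. of_int (m $ s)))"
    using comb_coord[of x] by (simp add: lattice_vec_comb linear_add[OF linear_comb] algebra_simps)
qed

lemma int_part_shift: "int_part G (x + lattice_vec G m) = int_part G x + m"
  by (simp add: int_part_def coord_shift Finite_Cartesian_Product.vec_eq_iff)

lemma frac_part_shift: "frac_part G (x + lattice_vec G m) = frac_part G x"
  by (simp add: frac_part_def int_part_shift lattice_vec_add)

lemma frac_int_part: "frac_part G x + lattice_vec G (int_part G x) = x"
  by (simp add: frac_part_def)

lemma fund_verts_iff: "v \<in> fund_verts G \<longleftrightarrow> v \<in> verts G \<and> int_part G v = 0"
  unfolding fund_verts_def int_part_def
  by (auto simp: Finite_Cartesian_Product.vec_eq_iff floor_eq_iff)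

lemma frac_part_fund: "v \<in> fund_verts G \<Longrightarrow> frac_part G v = v"
  by (simp add: fund_verts_iff frac_part_def)

text \<open>Invariance of the graph is given for the periods only. Packaged as a property of a
  vector it is closed under sums and negation, and so reaches every lattice vector.\<close>

definition translation :: "real ^ 'd \<Rightarrow> bool" where
  "translation x \<longleftrightarrow> (\<lambda>y. y + x) ` verts G = verts G \<and> (\<lambda>e. (\<lambda>y. y + x) ` e) ` edges G = edges G"

lemma translation_add:
  assumes "translation x" "translation z"
  shows "translation (x + z)"
proof -
  have v: "(\<lambda>y. y + (x + z)) ` verts G = (\<lambda>y. y + z) ` (\<lambda>y. y + x) ` verts G"
    by (simp add: image_image add.assoc)
  have e: "(\<lambda>e. (\<lambda>y. y + (x + z)) ` e) ` edges G
      = (\<lambda>e. (\<lambda>y. y + z) ` e) ` (\<lambda>e. (\<lambda>y. y + x) ` e) ` edges G"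
    by (simp add: image_image add.assoc)
  show ?thesis using assms unfolding translation_def v e by simp
qed

lemma translation_minus:
  assumes "translation x"
  shows "translation (- x)"
proof -
  have id: "(\<lambda>y. y + - x) ` (\<lambda>y. y + x) ` e = e" for e :: "(real ^ 'd) set"
    by (simp add: image_image)
  have "(\<lambda>y. y + - x) ` verts G = verts G"
    using assms id[of "verts G"] by (simp only: translation_def)
  moreover have "(\<lambda>e. (\<lambda>y. y + - x) ` e) ` (\<lambda>e. (\<lambda>y. y + x) ` e) ` edges G = edges G"
    unfolding image_image[of "\<lambda>e. (\<lambda>y. y + - x) ` e"] id by simp
  then have "(\<lambda>e. (\<lambda>y. y + - x) ` e) ` edges G = edges G"
    using assms by (simp only: translation_def)
  ultimately show ?thesis by (simp only: translation_def)
qed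

lemma translation_0: "translation 0"
  by (simp add: translation_def)

lemma translation_period: "translation (of_int k *\<^sub>R period G s)"
proof -
  have p: "translation (period G s)" using graph by (simp add: zd_periodic_graph_def translation_def)
  have n: "translation (real j *\<^sub>R period G s)" for j :: nat
  proof (induction j)
    case (Suc j)
    have "real (Suc j) *\<^sub>R period G s = real j *\<^sub>R period G s + period G s"
      by (simp add: scaleR_left_distrib)
    then show ?case using translation_add[OF Suc p] by simp
  qed (simp add: translation_0)
  show ?thesis
  proof (cases "0 \<le> k")
    case True
    then show ?thesis using n[of "nat k"] by simp
  next
    case False
    then show ?thesis using translation_minus[OF n[of "nat (- k)"]] by simp
  qed
qed

lemma translation_lattice: "translation (lattice_vec G m)"
proof -
  have "translation (\<Sum>s\<in>A. of_int (m $ s) *\<^sub>R period G s)" if "finite A" for A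
    using that by induction (auto simp: translation_0 intro: translation_add translation_period)
  then show ?thesis by (simp add: lattice_vec_def)
qed

lemma verts_shift [simp]: "v + lattice_vec G m \<in> verts G \<longleftrightarrow> v \<in> verts G"
proof
  assume "v \<in> verts G"
  then show "v + lattice_vec G m \<in> verts G"
    using translation_lattice[of m] unfolding translation_def by blast
next
  assume "v + lattice_vec G m \<in> verts G"
  then have "(v + lattice_vec G m) + lattice_vec G (- m) \<in> verts G"
    using translation_lattice[of "- m"] unfolding translation_def by blast
  then show "v \<in> verts G" by (simp add: lattice_vec_minus)
qed

lemma edges_shift: "e \<in> edges G \<Longrightarrow> (\<lambda>y. y + lattice_vec G m) ` e \<in> edges G"
  using translation_lattice[of m] unfolding translation_def by blast

lemma ends_shift: "ends G ((\<lambda>y. y + lattice_vec G m) ` e) = (\<lambda>y. y + lattice_vec G m) ` ends G e"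
  unfolding ends_def by auto

lemma frac_part_verts: "v \<in> verts G \<Longrightarrow> frac_part G v \<in> fund_verts G"
proof -
  assume "v \<in> verts G"
  moreover have "v = frac_part G v + lattice_vec G (int_part G v)" by (simp add: frac_int_part)
  ultimately have "frac_part G v \<in> verts G" by (metis verts_shift)
  moreover have "int_part G (frac_part G v) = 0"
    using int_part_shift[of v "- int_part G v"] by (simp add: frac_part_def lattice_vec_minus)
  ultimately show "frac_part G v \<in> fund_verts G" by (simp add: fund_verts_iff)
qed

lemma bij_verts:
  assumes w: "bij_betw w {..<n} (fund_verts G)"
  shows "bij_betw (\<lambda>(j, m). w j + lattice_vec G m) ({..<n} \<times> UNIV) (verts G)"
  unfolding bij_betw_def
proof
  have fund: "w j \<in> fund_verts G" if "j < n" for j using bij_betwE[OF w] that by auto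
  show "inj_on (\<lambda>(j, m). w j + lattice_vec G m) ({..<n} \<times> UNIV)"
  proof (rule inj_onI)
    fix p p' assume p: "p \<in> {..<n} \<times> UNIV" "p' \<in> {..<n} \<times> UNIV"
      and pp: "(\<lambda>(j, m). w j + lattice_vec G m) p = (\<lambda>(j, m). w j + lattice_vec G m) p'"
    obtain j m k r where jk: "p = (j, m)" "p' = (k, r)" by (cases p, cases p')
    have j: "j < n" and k: "k < n" and eq: "w j + lattice_vec G m = w k + lattice_vec G r"
      using p pp by (auto simp: jk)
    have "frac_part G (w j + lattice_vec G m) = frac_part G (w k + lattice_vec G r)" using eq by simp
    then have "w j = w k" using fund j k by (simp add: frac_part_shift frac_part_fund)
    then show "p = p'" using eq w j k by (auto simp: jk bij_betw_def inj_on_def)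
  qed
  show "(\<lambda>(j, m). w j + lattice_vec G m) ` ({..<n} \<times> UNIV) = verts G"
  proof
    show "(\<lambda>(j, m). w j + lattice_vec G m) ` ({..<n} \<times> UNIV) \<subseteq> verts G"
      using fund by (auto simp: fund_verts_iff)
    show "verts G \<subseteq> (\<lambda>(j, m). w j + lattice_vec G m) ` ({..<n} \<times> UNIV)"
    proof
      fix v assume "v \<in> verts G"
      then obtain j where "j < n" "frac_part G v = w j"
        using frac_part_verts bij_betw_imp_surj_on[OF w] by force
      then have "v = (\<lambda>(j, m). w j + lattice_vec G m) (j, int_part G v)"
        using frac_int_part[of v] by simp
      then show "v \<in> (\<lambda>(j, m). w j + lattice_vec G m) ` ({..<n} \<times> UNIV)"
        using \<open>j < n\<close> by blast
    qed
  qed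
qed

section \<open>Edge counts, degrees and the Laplacian\<close>

lemma edge_count_shift: "edge_count G (u + lattice_vec G m) (v + lattice_vec G m) = edge_count G u v"
proof -
  define S where "S k e = (\<lambda>y. y + lattice_vec G k) ` e" for k and e :: "(real ^ 'd) set"
  have inv: "S (- k) (S k e) = e" "S k (S (- k) e) = e" for k e
    by (auto simp: S_def image_image lattice_vec_minus)
  have "bij_betw (S m) {e \<in> edges G. ends G e = {u, v}}
      {e \<in> edges G. ends G e = {u + lattice_vec G m, v + lattice_vec G m}}"
  proof (rule bij_betw_byWitness[where f' = "S (- m)"])
    show "S m ` {e \<in> edges G. ends G e = {u, v}}
        \<subseteq> {e \<in> edges G. ends G e = {u + lattice_vec G m, v + lattice_vec G m}}"
      using edges_shift by (auto simp: S_def ends_shift)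
    have "ends G (S (- m) e) = {u, v}" if "ends G e = {u + lattice_vec G m, v + lattice_vec G m}" for e
      unfolding S_def ends_shift that by (simp add: lattice_vec_minus)
    moreover have "S (- m) e \<in> edges G" if "e \<in> edges G" for e
      unfolding S_def using that by (rule edges_shift)
    ultimately show "S (- m) ` {e \<in> edges G. ends G e = {u + lattice_vec G m, v + lattice_vec G m}}
        \<subseteq> {e \<in> edges G. ends G e = {u, v}}"
      by blast
  qed (auto simp: inv)
  then show ?thesis by (simp add: edge_count_def bij_betw_same_card)
qed

text \<open>Reversing an edge negates its index. This symmetry makes the Floquet matrices
  Hermitian.\<close>

lemma edge_count_reverse: "edge_count G u (v + lattice_vec G (- m)) = edge_count G v (u + lattice_vec G m)"
  using edge_count_shift[of u m "v + lattice_vec G (- m)"]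
  by (simp add: edge_count_commute[of G v] lattice_vec_minus)

lemma degree_shift: "degree_at G (v + lattice_vec G m) = degree_at G v"
proof -
  define S where "S k e = (\<lambda>y. y + lattice_vec G k) ` e" for k and e :: "(real ^ 'd) set"
  have inv: "S (- k) (S k e) = e" "S k (S (- k) e) = e" for k e
    by (auto simp: S_def image_image lattice_vec_minus)
  have S_in: "S k e \<in> edges G" if "e \<in> edges G" for k e
    unfolding S_def using that by (rule edges_shift)
  have S_ends: "v + lattice_vec G k \<in> ends G (S k e)" if "v \<in> ends G e" for k e v
    unfolding S_def ends_shift using that by blast
  have unshift: "v \<in> ends G (S (- m) e)" if "v + lattice_vec G m \<in> ends G e" for e
    using S_ends[OF that, of "- m"] by (simp add: lattice_vec_minus)
  have "bij_betw (S m) {e \<in> edges G. v \<in> ends G e} {e \<in> edges G. v + lattice_vec G m \<in> ends G e}"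
    by (rule bij_betw_byWitness[where f' = "S (- m)"]) (use inv S_in S_ends unshift in auto)
  moreover have "card {e \<in> edges G. ends G e = {v + lattice_vec G m}} = card {e \<in> edges G. ends G e = {v}}"
    using edge_count_shift[of v m v] by (simp add: edge_count_def)
  ultimately show ?thesis by (simp add: degree_at_def bij_betw_same_card)
qed

lemma edge_ends:
  assumes "e \<in> edges G"
  shows "\<exists>x\<in>verts G. \<exists>y\<in>verts G. ends G e = {x, y}"
proof -
  have "\<forall>e\<in>edges G. \<exists>g. simple_path g \<and> path_image g = e \<and> e \<inter> verts G = {pathstart g, pathfinish g}"
    using graph unfolding zd_periodic_graph_def by (elim conjE)
  then obtain g where g: "e \<inter> verts G = {pathstart g, pathfinish g}"
    using assms by (elim ballE exE conjE) auto
  then have "pathstart g \<in> verts G" "pathfinish g \<in> verts G" by auto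
  then show ?thesis using g unfolding ends_def by blast
qed

lemma finite_edges_at: "v \<in> verts G \<Longrightarrow> finite {e \<in> edges G. v \<in> ends G e}"
proof -
  have "\<forall>v\<in>verts G. finite {e \<in> edges G. v \<in> ends G e}"
    using graph unfolding zd_periodic_graph_def by (elim conjE)
  then show "v \<in> verts G \<Longrightarrow> finite {e \<in> edges G. v \<in> ends G e}" by (rule bspec)
qed

lemma finite_edges_between: "v \<in> verts G \<Longrightarrow> finite {e \<in> edges G. ends G e = {v, u}}"
  by (rule finite_subset[OF _ finite_edges_at]) auto

lemma finite_edges_heads: "v \<in> verts G \<Longrightarrow> finite {(e, u). e \<in> edges G \<and> ends G e = {v, u}}"
proof -
  assume v: "v \<in> verts G"
  have "{(e, u). e \<in> edges G \<and> ends G e = {v, u}} \<subseteq> (SIGMA e:{e \<in> edges G. v \<in> ends G e}. ends G e)"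
    by auto
  moreover have "finite (SIGMA e:{e \<in> edges G. v \<in> ends G e}. ends G e)"
    using finite_edges_at[OF v] edge_ends by (intro finite_SigmaI) force+
  ultimately show ?thesis by (rule finite_subset)
qed

lemma edge_count_eq_0: "v \<in> verts G \<Longrightarrow> edge_count G v u = 0 \<longleftrightarrow> (\<forall>e\<in>edges G. ends G e \<noteq> {v, u})"
  using finite_edges_between[of v u] by (auto simp: edge_count_def card_eq_0_iff)

lemma finite_neighbours: "v \<in> verts G \<Longrightarrow> finite {u. edge_count G v u \<noteq> 0}"
proof -
  assume v: "v \<in> verts G"
  have "{u. edge_count G v u \<noteq> 0} \<subseteq> snd ` {(e, u). e \<in> edges G \<and> ends G e = {v, u}}"
  proof
    fix u assume "u \<in> {u. edge_count G v u \<noteq> 0}"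
    then obtain e where "e \<in> edges G" "ends G e = {v, u}"
      using edge_count_eq_0[OF v, of u] by auto
    then have "(e, u) \<in> {(e, u). e \<in> edges G \<and> ends G e = {v, u}}" by simp
    then show "u \<in> snd ` {(e, u). e \<in> edges G \<and> ends G e = {v, u}}" by (rule rev_image_eqI) simp
  qed
  then show ?thesis using finite_edges_heads[OF v] by (meson finite_imageI finite_subset)
qed

text \<open>A loop occurs once in the sum defining \<open>laplacian\<close> and contributes 0 there;
  it is counted twice in \<open>degree_at\<close> and twice in \<open>edge_count\<close>, and these
  contributions cancel. The set \<open>U\<close> may exceed the neighbours, so that it can later be
  chosen with a lattice labelling.\<close>

lemma laplacian_edge_count:
  assumes v: "v \<in> verts G" and U: "finite U" "{u. edge_count G v u \<noteq> 0} \<subseteq> U"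
  shows "laplacian G f v = of_nat (degree_at G v) * f v - (\<Sum>u\<in>U. of_nat (edge_count G v u) * f u)"
proof -
  define E where "E = {(e, u). e \<in> edges G \<and> ends G e = {v, u}}"
  define B where "B u = {e \<in> edges G. ends G e = {v, u}}" for u
  have finE: "finite E" unfolding E_def by (rule finite_edges_heads[OF v])
  have finB: "finite (B u)" for u unfolding B_def by (rule finite_edges_between[OF v])
  have mem: "u \<in> U" if "e \<in> edges G" "ends G e = {v, u}" for e u
    using edge_count_eq_0[OF v, of u] that U(2) by auto
  then have out: "B u = {}" if "u \<notin> U" for u
    using that by (auto simp: B_def)
  have cardE: "card E = card {e \<in> edges G. v \<in> ends G e}"
  proof -
    have "inj_on fst E"
      unfolding E_def by (rule inj_onI) (auto simp: doubleton_eq_iff)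
    moreover have "fst ` E = {e \<in> edges G. v \<in> ends G e}"
    proof
      show "{e \<in> edges G. v \<in> ends G e} \<subseteq> fst ` E"
      proof
        fix e assume e: "e \<in> {e \<in> edges G. v \<in> ends G e}"
        then obtain x y where "ends G e = {x, y}" using edge_ends by blast
        then have "\<exists>u. ends G e = {v, u}" using e by auto
        then show "e \<in> fst ` E" using e by (force simp: E_def)
      qed
    qed (auto simp: E_def)
    ultimately show ?thesis by (metis card_image)
  qed
  have "laplacian G f v = (\<Sum>(e, u)\<in>E. f v - f u)" by (simp add: laplacian_def E_def)
  also have "\<dots> = (\<Sum>p\<in>E. f v) - (\<Sum>p\<in>E. f (snd p))"
    unfolding sum_subtractf[symmetric] by (intro sum.cong) auto
  also have "(\<Sum>p\<in>E. f (snd p)) = (\<Sum>p\<in>(SIGMA u:U. B u). f (fst p))"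
    by (rule sum.reindex_bij_witness[where i = prod.swap and j = prod.swap])
      (auto simp: E_def B_def mem)
  also have "\<dots> = (\<Sum>u\<in>U. of_nat (card (B u)) * f u)"
    using sum.Sigma[of U B "\<lambda>u e. f u"] U(1) finB by (simp add: case_prod_unfold)
  also have "\<dots> = (\<Sum>u\<in>U. of_nat (edge_count G v u) * f u - (if u = v then of_nat (card (B v)) * f v else 0))"
    by (intro sum.cong refl) (auto simp: edge_count_def B_def algebra_simps)
  also have "\<dots> = (\<Sum>u\<in>U. of_nat (edge_count G v u) * f u) - of_nat (card (B v)) * f v"
    using U(1) out[of v] by (simp add: sum_subtractf)
  finally show ?thesis
    by (simp add: cardE degree_at_def B_def algebra_simps)
qed

section \<open>Orbits of oriented edges\<close>

definition orbit_rel :: "('d oedge \<times> 'd oedge) set" where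
  "orbit_rel = {(x, y). x \<in> oriented_edges G \<and> y \<in> oriented_edges G \<and>
     (\<exists>m. y = oedge_shift (lattice_vec G m) x)}"

lemma oedge_shift_in: "x \<in> oriented_edges G \<Longrightarrow> oedge_shift (lattice_vec G m) x \<in> oriented_edges G"
  by (cases x) (auto simp: oriented_edges_def ends_shift edges_shift)

lemma orbit_image:
  assumes "x \<in> oriented_edges G"
  shows "orbit_rel `` {x} = range (\<lambda>m. oedge_shift (lattice_vec G m) x)"
  using assms oedge_shift_in[OF assms] by (auto simp: orbit_rel_def)

lemma oedge_shift_add: "oedge_shift y (oedge_shift x z) = oedge_shift (x + y) z"
  by (cases z) (simp add: image_image add.assoc)

lemma oedge_shift_0: "oedge_shift 0 z = z"
  by (cases z) simp

lemma orbit_shift: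
  assumes "x \<in> oriented_edges G"
  shows "orbit_rel `` {oedge_shift (lattice_vec G m) x} = orbit_rel `` {x}"
proof -
  have "range (\<lambda>k. oedge_shift (lattice_vec G k) (oedge_shift (lattice_vec G m) x))
      = (\<lambda>k. oedge_shift (lattice_vec G k) x) ` range (\<lambda>k. m + k)"
    unfolding image_image by (simp add: oedge_shift_add lattice_vec_add)
  also have "range (\<lambda>k. m + k) = UNIV" by (simp add: surj_plus)
  finally show ?thesis
    using assms oedge_shift_in[OF assms] by (simp add: orbit_image)
qed

text \<open>A common lattice shift changes the integer parts of both endpoints equally and leaves
  their fractional parts alone. The images to which \<open>the_elem\<close> is applied are therefore
  singletons.\<close>

lemma orbit_values:
  assumes "x \<in> oriented_edges G"
  shows "fund_index G (orbit_rel `` {x}) = oedge_index G x"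
    and "fund_tail G (orbit_rel `` {x}) = frac_part G (oedge_tail x)"
    and "fund_head G (orbit_rel `` {x}) = frac_part G (oedge_head x)"
proof -
  obtain e u v b where x: "x = (e, u, v, b)" by (cases x)
  have "oedge_index G ` orbit_rel `` {x} = {oedge_index G x}"
    unfolding orbit_image[OF assms] by (auto simp: x image_image int_part_shift)
  then show "fund_index G (orbit_rel `` {x}) = oedge_index G x" by (simp add: fund_index_def)
  have "(\<lambda>x. frac_part G (oedge_tail x)) ` orbit_rel `` {x} = {frac_part G (oedge_tail x)}"
    unfolding orbit_image[OF assms] by (auto simp: x image_image frac_part_shift)
  then show "fund_tail G (orbit_rel `` {x}) = frac_part G (oedge_tail x)" by (simp add: fund_tail_def)
  have "(\<lambda>x. frac_part G (oedge_head x)) ` orbit_rel `` {x} = {frac_part G (oedge_head x)}"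
    unfolding orbit_image[OF assms] by (auto simp: x image_image frac_part_shift)
  then show "fund_head G (orbit_rel `` {x}) = frac_part G (oedge_head x)" by (simp add: fund_head_def)
qed

lemma fund_oedges_orbit: "fund_oedges G = (\<lambda>x. orbit_rel `` {x}) ` oriented_edges G"
  by (auto simp: fund_oedges_def quotient_def orbit_rel_def)

text \<open>Every orbit in \<open>X\<close> has exactly one representative with tail
  \<open>u\<close> itself, obtained by translating the tail back to the fundamental cell; its head
  is then \<open>v + lattice_vec G m\<close>. A loop has two representatives, one for each tag,
  which matches the factor 2 in \<open>edge_count\<close>.\<close>

lemma fund_oedges_card:
  fixes m :: "int ^ 'd"
  assumes u: "u \<in> fund_verts G" and v: "v \<in> fund_verts G"
  defines "X \<equiv> {c \<in> fund_oedges G. fund_tail G c = u \<and> fund_head G c = v \<and> fund_index G c = m}"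
  shows "finite X" "card X = edge_count G u (v + lattice_vec G m)"
proof -
  define O' where "O' = {x \<in> oriented_edges G. oedge_tail x = u \<and> oedge_head x = v + lattice_vec G m}"
  have frac: "frac_part G u = u" "frac_part G v = v" "int_part G u = 0" "int_part G v = 0"
    using u v by (auto simp: frac_part_fund fund_verts_iff)
  have bij: "bij_betw (\<lambda>x. orbit_rel `` {x}) O' X"
    unfolding bij_betw_def
  proof
    show "inj_on (\<lambda>x. orbit_rel `` {x}) O'"
    proof (rule inj_onI)
      fix x y assume x: "x \<in> O'" and y: "y \<in> O'" and eq: "orbit_rel `` {x} = orbit_rel `` {y}"
      have "y \<in> orbit_rel `` {y}"
        using y by (auto simp: O'_def orbit_image oedge_shift_0 intro!: range_eqI[of _ _ 0])
      then obtain k where k: "y = oedge_shift (lattice_vec G k) x"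
        using orbit_image[of x] x unfolding eq[symmetric] O'_def by blast
      then have "lattice_vec G k = lattice_vec G 0"
        using x y by (cases x) (auto simp: O'_def)
      then have "k = 0" by (simp only: lattice_vec_eq_iff)
      then show "x = y" using k by (simp add: oedge_shift_0)
    qed
    show "(\<lambda>x. orbit_rel `` {x}) ` O' = X"
    proof
      show "(\<lambda>x. orbit_rel `` {x}) ` O' \<subseteq> X"
      proof
        fix c assume "c \<in> (\<lambda>x. orbit_rel `` {x}) ` O'"
        then obtain x where x: "x \<in> O'" "c = orbit_rel `` {x}" by blast
        then have xo: "x \<in> oriented_edges G" by (simp add: O'_def)
        have "oedge_index G x = m"
          using x frac by (cases x) (auto simp: O'_def int_part_shift)
        then show "c \<in> X"
          using x xo frac by (auto simp: X_def orbit_values fund_oedges_orbit O'_def frac_part_shift)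
      qed
      show "X \<subseteq> (\<lambda>x. orbit_rel `` {x}) ` O'"
      proof
        fix c assume c: "c \<in> X"
        then obtain x where x: "x \<in> oriented_edges G" "c = orbit_rel `` {x}"
          by (auto simp: X_def fund_oedges_orbit)
        obtain e a b t where xe: "x = (e, a, b, t)" by (cases x)
        have vals: "frac_part G a = u" "frac_part G b = v" "int_part G b - int_part G a = m"
          using c x orbit_values[OF x(1)] by (auto simp: X_def xe)
        define y where "y = oedge_shift (lattice_vec G (- int_part G a)) x"
        have "oedge_tail y = u" using vals(1) by (simp add: y_def xe frac_part_def lattice_vec_minus)
        moreover have "oedge_head y = v + lattice_vec G m"
        proof -
          have "v + lattice_vec G (int_part G b) = b" using vals(2) frac_int_part[of b] by simp
          then have "b + lattice_vec G (- int_part G a) = v + (lattice_vec G (int_part G b) + lattice_vec G (- int_part G a))"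
            by (simp add: add.assoc[symmetric])
          also have "\<dots> = v + lattice_vec G m"
            unfolding lattice_vec_add[symmetric] vals(3)[symmetric] by simp
          finally show ?thesis by (simp add: y_def xe)
        qed
        ultimately have "y \<in> O'" using oedge_shift_in[OF x(1)] by (simp add: O'_def y_def)
        moreover have "c = orbit_rel `` {y}" using x orbit_shift[OF x(1)] by (simp add: y_def)
        ultimately show "c \<in> (\<lambda>x. orbit_rel `` {x}) ` O'" by blast
      qed
    qed
  qed
  have O': "O' = (\<lambda>(e, t). (e, u, v + lattice_vec G m, t)) `
      ({e \<in> edges G. ends G e = {u, v + lattice_vec G m}} \<times> (if u = v + lattice_vec G m then UNIV else {False}))"
  proof -
    define v' where "v' = v + lattice_vec G m"
    have "x \<in> O' \<longleftrightarrow> x \<in> (\<lambda>(e, t). (e, u, v', t)) `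
      ({e \<in> edges G. ends G e = {u, v'}} \<times> (if u = v' then UNIV else {False}))" for x
      by (cases x) (auto simp: O'_def oriented_edges_def v'_def[symmetric])
    then show ?thesis unfolding v'_def by blast
  qed
  have fin: "finite {e \<in> edges G. ends G e = {u, v + lattice_vec G m}}"
    using u by (intro finite_edges_between) (simp add: fund_verts_iff)
  then have finO: "finite O'" unfolding O' by (intro finite_imageI finite_cartesian_product) auto
  then show "finite X" using bij_betw_finite[OF bij] by simp
  have "card O' = edge_count G u (v + lattice_vec G m)"
    unfolding O' edge_count_def
    by (subst card_image) (auto simp: inj_on_def card_cartesian_product)
  then show "card X = edge_count G u (v + lattice_vec G m)" using bij_betw_same_card[OF bij] by simp
qed

lemma fund_oedges_sum:
  assumes u: "u \<in> fund_verts G" and v: "v \<in> fund_verts G"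
    and N: "finite N" "{m. edge_count G u (v + lattice_vec G m) \<noteq> 0} \<subseteq> N"
  shows "(\<Sum>c \<in> {c \<in> fund_oedges G. fund_tail G c = u \<and> fund_head G c = v}.
      exp (\<i> * of_real (\<Sum>s\<in>UNIV. of_int (fund_index G c $ s) * \<theta> $ s)))
    = (\<Sum>m\<in>N. of_nat (edge_count G u (v + lattice_vec G m)) * chr m \<theta>)"
proof -
  define X where "X m = {c \<in> fund_oedges G. fund_tail G c = u \<and> fund_head G c = v \<and> fund_index G c = m}" for m
  have X: "finite (X m)" "card (X m) = edge_count G u (v + lattice_vec G m)" for m
    using fund_oedges_card[OF u v, of m] by (simp_all add: X_def)
  have "{c \<in> fund_oedges G. fund_tail G c = u \<and> fund_head G c = v} = (\<Union>m\<in>N. X m)"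
  proof -
    have "fund_index G c \<in> N" if "c \<in> fund_oedges G" "fund_tail G c = u" "fund_head G c = v" for c
    proof -
      have "c \<in> X (fund_index G c)" using that by (simp add: X_def)
      then have "card (X (fund_index G c)) \<noteq> 0" using X(1) by (auto simp: card_eq_0_iff)
      then show ?thesis using N(2) X(2) by auto
    qed
    then show ?thesis by (auto simp: X_def)
  qed
  then have "(\<Sum>c \<in> {c \<in> fund_oedges G. fund_tail G c = u \<and> fund_head G c = v}. chr (fund_index G c) \<theta>)
      = (\<Sum>m\<in>N. \<Sum>c\<in>X m. chr (fund_index G c) \<theta>)"
    using N(1) X(1) by (simp only:) (intro sum.UNION_disjoint, auto simp: X_def)
  also have "\<dots> = (\<Sum>m\<in>N. \<Sum>c\<in>X m. chr m \<theta>)"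
    by (intro sum.cong refl) (simp add: X_def)
  also have "\<dots> = (\<Sum>m\<in>N. of_nat (edge_count G u (v + lattice_vec G m)) * chr m \<theta>)"
    by (simp add: X(2))
  finally show ?thesis by (simp only: chr_def)
qed

end

section \<open>Floquet matrices of a periodic graph\<close>

locale floquet_setup = periodic_graph G
  for G :: "('d::finite) pgraph" +
  fixes w :: "nat \<Rightarrow> real ^ 'd" and n :: nat
  assumes n: "n = card (fund_verts G)"
    and numbering: "bij_betw w {..<n} (fund_verts G)"
begin

text \<open>The indices that occur on the fundamental graph. The index 0 is always included, to give
  the diagonal term of the convolution kernel a place.\<close>

definition steps :: "(int ^ 'd) set" where
  "steps = insert 0 {m. \<exists>j<n. \<exists>k<n. edge_count G (w j) (w k + lattice_vec G m) \<noteq> 0}"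

lemma w_fund: "j < n \<Longrightarrow> w j \<in> fund_verts G"
  using bij_betwE[OF numbering] by auto

lemma w_verts: "j < n \<Longrightarrow> w j \<in> verts G"
  using w_fund by (simp add: fund_verts_iff)

lemma finite_steps: "finite steps"
proof -
  have "finite {m. edge_count G (w j) (w k + lattice_vec G m) \<noteq> 0}" if "j < n" for j k
  proof -
    have "inj (\<lambda>m. w k + lattice_vec G m)" by (simp add: inj_def)
    then have "finite ((\<lambda>m. w k + lattice_vec G m) -` {u. edge_count G (w j) u \<noteq> 0})"
      using finite_neighbours[OF w_verts[OF that]] by (intro finite_vimageI)
    then show ?thesis by (simp add: vimage_def)
  qed
  then have "finite (\<Union>j<n. \<Union>k<n. {m. edge_count G (w j) (w k + lattice_vec G m) \<noteq> 0})" by auto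
  moreover have "steps = insert 0 (\<Union>j<n. \<Union>k<n. {m. edge_count G (w j) (w k + lattice_vec G m) \<noteq> 0})"
    by (auto simp: steps_def)
  ultimately show ?thesis by simp
qed

lemma uminus_steps: "m \<in> steps \<Longrightarrow> - m \<in> steps"
  using edge_count_reverse by (fastforce simp: steps_def)

lemma laplacian_index:
  assumes j: "j < n" and k: "k < n"
  shows "floquet_laplacian G w \<theta> $$ (j, k) = (if j = k then of_nat (degree_at G (w j)) else 0) -
    (\<Sum>m\<in>steps. of_nat (edge_count G (w j) (w k + lattice_vec G m)) * chr m \<theta>)"
proof -
  have "{m. edge_count G (w j) (w k + lattice_vec G m) \<noteq> 0} \<subseteq> steps"
    using j k by (auto simp: steps_def)
  from fund_oedges_sum[OF w_fund[OF j] w_fund[OF k] finite_steps this]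
  show ?thesis using j k n by (simp add: floquet_laplacian_def)
qed

lemma laplacian_carrier: "floquet_laplacian G w \<theta> \<in> carrier_mat n n"
  by (simp add: floquet_laplacian_def n)

lemma laplacian_hermitian: "hermitian_mat n (floquet_laplacian G w \<theta>)"
proof -
  have "floquet_laplacian G w \<theta> $$ (k, j) = cnj (floquet_laplacian G w \<theta> $$ (j, k))"
    if j: "j < n" and k: "k < n" for j k
  proof -
    have "(\<Sum>m\<in>steps. of_nat (edge_count G (w k) (w j + lattice_vec G m)) * chr m \<theta>)
        = (\<Sum>m\<in>steps. of_nat (edge_count G (w k) (w j + lattice_vec G (- m))) * chr (- m) \<theta>)"
      by (rule sum.reindex_bij_witness[where i = uminus and j = uminus]) (auto intro: uminus_steps)
    also have "\<dots> = cnj (\<Sum>m\<in>steps. of_nat (edge_count G (w j) (w k + lattice_vec G m)) * chr m \<theta>)"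
      by (simp add: edge_count_reverse chr_minus)
    finally show ?thesis using j k by (simp add: laplacian_index)
  qed
  then show ?thesis unfolding hermitian_mat_def using laplacian_carrier by blast
qed

lemma laplacian_continuous:
  assumes "j < n" "k < n"
  shows "continuous_on UNIV (\<lambda>\<theta>. floquet_laplacian G w \<theta> $$ (j, k))"
  unfolding laplacian_index[OF assms] by (intro continuous_intros continuous_on_chr)

definition entry_bound :: real where
  "entry_bound = (\<Sum>j<n. \<Sum>k<n. real (degree_at G (w j)) +
     (\<Sum>m\<in>steps. real (edge_count G (w j) (w k + lattice_vec G m))))"

lemma entry_bound_nonneg: "0 \<le> entry_bound"
  unfolding entry_bound_def by (intro sum_nonneg add_nonneg_nonneg) auto

lemma laplacian_bounded:
  assumes j: "j < n" and k: "k < n"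
  shows "cmod (floquet_laplacian G w \<theta> $$ (j, k)) \<le> entry_bound"
proof -
  have "cmod (floquet_laplacian G w \<theta> $$ (j, k)) \<le> cmod (if j = k then of_nat (degree_at G (w j)) else 0) +
      cmod (\<Sum>m\<in>steps. of_nat (edge_count G (w j) (w k + lattice_vec G m)) * chr m \<theta>)"
    unfolding laplacian_index[OF assms] by (rule norm_triangle_ineq4)
  also have "\<dots> \<le> real (degree_at G (w j)) + (\<Sum>m\<in>steps. real (edge_count G (w j) (w k + lattice_vec G m)))"
    by (intro add_mono sum_norm_le) (auto simp: norm_mult)
  also have "\<dots> \<le> (\<Sum>k<n. real (degree_at G (w j)) + (\<Sum>m\<in>steps. real (edge_count G (w j) (w k + lattice_vec G m))))"
    using k by (intro member_le_sum[of k "{..<n}" "\<lambda>k. real (degree_at G (w j)) +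
      (\<Sum>m\<in>steps. real (edge_count G (w j) (w k + lattice_vec G m)))"]) (auto intro!: add_nonneg_nonneg sum_nonneg)
  also have "\<dots> \<le> entry_bound"
    unfolding entry_bound_def using j
    by (intro member_le_sum[of j "{..<n}" "\<lambda>j. \<Sum>k<n. real (degree_at G (w j)) +
      (\<Sum>m\<in>steps. real (edge_count G (w j) (w k + lattice_vec G m)))"]) (auto intro!: add_nonneg_nonneg sum_nonneg)
  finally show ?thesis .
qed

text \<open>The Schroedinger operator as a convolution in the labelling of vertices by pairs (j, m).
  The degree and the potential act inside one cell and one component, hence sit at
  \<open>j = k\<close> and \<open>m = 0\<close>.\<close>

definition kernel :: "(real ^ 'd \<Rightarrow> real) \<Rightarrow> real \<Rightarrow> nat \<Rightarrow> nat \<Rightarrow> int ^ 'd \<Rightarrow> complex" where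
  "kernel Q t j k m = (if j = k \<and> m = 0 then of_nat (degree_at G (w j)) + of_real (t * Q (w j)) else 0) -
     of_nat (edge_count G (w j) (w k + lattice_vec G m))"

lemma sum_diagonal:
  assumes "j < n"
  shows "(\<Sum>k<n. \<Sum>m\<in>steps. (if j = k \<and> m = 0 then c else 0) * (g k m :: complex)) = c * g j 0"
proof -
  have "(\<Sum>m\<in>steps. (if j = k \<and> m = 0 then c else 0) * g k m) = (if j = k then c * g j 0 else 0)" for k
  proof -
    have "(\<Sum>m\<in>steps. (if j = k \<and> m = 0 then c else 0) * g k m)
        = (\<Sum>m\<in>steps. if m = 0 then (if j = k then c * g j 0 else 0) else 0)"
      by (intro sum.cong) auto
    then show ?thesis using finite_steps by (simp add: steps_def)
  qed
  then show ?thesis using assms by simp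
qed

lemma schroedinger_pt:
  assumes Q: "periodic_potential G Q" and j: "j < n"
  shows "schroedinger G Q t f (w j + lattice_vec G m) =
    (\<Sum>k<n. \<Sum>r\<in>steps. kernel Q t j k r * f (w k + lattice_vec G (m + r)))"
proof -
  define v where "v = w j + lattice_vec G m"
  define \<psi> where "\<psi> = (\<lambda>(k, r). w k + lattice_vec G (m + r))"
  \<comment> \<open>The sites reached from cell \<open>m\<close> by the indices in
    \<open>steps\<close>. They contain all neighbours of \<open>v\<close>, and the labelling is
    injective, so the sum over \<open>U\<close> is the double sum of a convolution.\<close>
  define U where "U = \<psi> ` ({..<n} \<times> steps)"
  have v: "v \<in> verts G" using w_verts[OF j] by (simp add: v_def)
  have inj: "inj_on \<psi> ({..<n} \<times> steps)"
  proof (rule inj_onI)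
    fix p p' assume p: "p \<in> {..<n} \<times> steps" "p' \<in> {..<n} \<times> steps" and eq: "\<psi> p = \<psi> p'"
    obtain k r k' r' where pp: "p = (k, r)" "p' = (k', r')" by (cases p, cases p')
    have "(k, m + r) = (k', m + r')"
      using p eq bij_betw_imp_inj_on[OF bij_verts[OF numbering]]
      by (intro inj_onD[of "\<lambda>(j, m). w j + lattice_vec G m" "{..<n} \<times> UNIV"]) (auto simp: pp \<psi>_def)
    then show "p = p'" by (simp add: pp)
  qed
  have count: "edge_count G v (\<psi> (k, r)) = edge_count G (w j) (w k + lattice_vec G r)" for k r
    using edge_count_shift[of "w j" m "w k + lattice_vec G r"]
    by (simp add: v_def \<psi>_def lattice_vec_add add_ac)
  have "{u. edge_count G v u \<noteq> 0} \<subseteq> U"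
  proof
    fix u assume "u \<in> {u. edge_count G v u \<noteq> 0}"
    then have u: "edge_count G v u \<noteq> 0" by simp
    then obtain e where e: "e \<in> edges G" "ends G e = {v, u}" using edge_count_eq_0[OF v, of u] by auto
    then have "u \<in> verts G" by (auto simp: ends_def)
    then have "u \<in> (\<lambda>(j, m). w j + lattice_vec G m) ` ({..<n} \<times> UNIV)"
      using bij_betw_imp_surj_on[OF bij_verts[OF numbering]] by simp
    then obtain k r where k: "k < n" and r: "u = w k + lattice_vec G r" by auto
    have "u = \<psi> (k, r - m)" by (simp add: \<psi>_def r)
    moreover have "r - m \<in> steps" using u j k count[of k "r - m"] unfolding calculation steps_def by auto
    ultimately show "u \<in> U" using k by (auto simp: U_def)
  qed
  moreover have "finite U" using finite_steps by (simp add: U_def)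
  ultimately have "laplacian G f v = of_nat (degree_at G v) * f v - (\<Sum>u\<in>U. of_nat (edge_count G v u) * f u)"
    by (intro laplacian_edge_count[OF v])
  also have "(\<Sum>u\<in>U. of_nat (edge_count G v u) * f u)
      = (\<Sum>k<n. \<Sum>r\<in>steps. of_nat (edge_count G v (\<psi> (k, r))) * f (\<psi> (k, r)))"
    unfolding U_def by (simp add: sum.reindex[OF inj] sum.cartesian_product)
  finally have "schroedinger G Q t f v = (of_nat (degree_at G (w j)) + of_real (t * Q (w j))) * f v -
      (\<Sum>k<n. \<Sum>r\<in>steps. of_nat (edge_count G (w j) (w k + lattice_vec G r)) * f (w k + lattice_vec G (m + r)))"
    using v Q w_verts[OF j] unfolding count
    by (simp add: schroedinger_def \<psi>_def periodic_potential_def degree_shift v_def algebra_simps)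
  also have "(of_nat (degree_at G (w j)) + of_real (t * Q (w j))) * f v
      = (\<Sum>k<n. \<Sum>r\<in>steps. (if j = k \<and> r = 0 then of_nat (degree_at G (w j)) + of_real (t * Q (w j)) else 0) *
          f (w k + lattice_vec G (m + r)))"
    by (subst sum_diagonal[OF j]) (simp add: v_def)
  finally show ?thesis
    by (simp add: v_def kernel_def left_diff_distrib sum_subtractf)
qed

end

section \<open>The graph operator as a strongly coupled family, and its spectrum\<close>

locale floquet_potential = floquet_setup G w n
  for G :: "('d::finite) pgraph" and w n +
  fixes Q :: "real ^ 'd \<Rightarrow> real" and q :: "nat \<Rightarrow> real"
  assumes potential: "periodic_potential G Q"
    and q: "q j = Q (w j)"
    and increasing: "j < k \<Longrightarrow> k < n \<Longrightarrow> q j < q k"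
begin

sublocale continuous_strong_coupling "floquet_laplacian G w" n q entry_bound
proof
  show "\<And>\<theta>. hermitian_mat n (floquet_laplacian G w \<theta>)" by (rule laplacian_hermitian)
qed (use laplacian_bounded entry_bound_nonneg increasing laplacian_continuous in auto)

lemma H_floquet: "H \<theta> t = floquet_matrix G Q w \<theta> t"
  by (simp only: H_def floquet_matrix_def q flip: n)

lemma floquet_index:
  assumes j: "j < n" and k: "k < n"
  shows "floquet_matrix G Q w \<theta> t $$ (j, k) = (\<Sum>m\<in>steps. kernel Q t j k m * chr m \<theta>)"
proof -
  define c where "c = complex_of_nat (degree_at G (w j)) + of_real (t * Q (w j))"
  have "(\<Sum>m\<in>steps. (if j = k \<and> m = 0 then c else 0) * chr m \<theta>)
      = (\<Sum>m\<in>steps. if m = 0 then (if j = k then c else 0) else 0)"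
    by (intro sum.cong) auto
  also have "\<dots> = (if j = k then c else 0)" using finite_steps by (simp add: steps_def)
  finally have "(\<Sum>m\<in>steps. kernel Q t j k m * chr m \<theta>) = (if j = k then c else 0) -
      (\<Sum>m\<in>steps. of_nat (edge_count G (w j) (w k + lattice_vec G m)) * chr m \<theta>)"
    unfolding kernel_def c_def[symmetric] left_diff_distrib sum_subtractf by simp
  then show ?thesis
    unfolding H_floquet[symmetric] by (simp add: H_index[OF j k] laplacian_index[OF j k] c_def q)
qed

lemma spectrum_eigenvalue:
  "x \<in> schroedinger_spectrum G Q t \<longleftrightarrow> (\<exists>\<theta>. eigenvalue (H \<theta> t) (of_real x))"
proof -
  interpret periodic_operator n steps "kernel Q t" "verts G" "\<lambda>j m. w j + lattice_vec G m"
    "schroedinger G Q t" "\<lambda>\<theta>. H \<theta> t"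
  proof
    show "schroedinger G Q t f v = 0" if "v \<notin> verts G" for f v
      using that by (simp add: schroedinger_def)
  qed (use finite_steps bij_verts[OF numbering] schroedinger_pt[OF potential] H_hermitian
      hermitian_carrier[OF H_hermitian] floquet_index in \<open>auto simp: H_floquet\<close>)
  show ?thesis by (simp add: schroedinger_spectrum_def spectrum_iff)
qed

text \<open>At each \<theta> the ordered list exhausts the eigenvalues, so this holds for every real
  \<open>t\<close>; large coupling enters only when the bands have to be disjoint.\<close>

lemma spectrum_bands: "schroedinger_spectrum G Q t = (\<Union>k<n. spectral_band G Q w k t)"
proof -
  have "eigenvalue (H \<theta> t) (of_real x) \<longleftrightarrow> (\<exists>k<n. x = nth_eigenvalue (H \<theta> t) k)" for \<theta> x
    using eigenvalue_nth[of \<theta> t x] nth_eigenvalue_eigenvalue[of _ \<theta> t] by (auto simp: nth_eigenvalue_list)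
  then show ?thesis
    unfolding spectral_band_def band_function_def H_floquet[symmetric] set_eq_iff spectrum_eigenvalue
    by (simp add: image_iff) blast
qed

end

section \<open>Diagonal entries and bridge-loops\<close>

context floquet_setup
begin

lemma diagonal_entry:
  assumes "k < n"
  shows "Re (floquet_laplacian G w \<theta> $$ (k, k)) = real (degree_at G (w k)) -
    (\<Sum>m\<in>steps. real (edge_count G (w k) (w k + lattice_vec G m)) * Re (chr m \<theta>))"
  by (simp add: laplacian_index[OF assms assms])

text \<open>Bridge-loops are exactly the nonconstant Fourier modes of the diagonal entries, which is
  the form in which they affect the diagonal ranges.\<close>

lemma bridge_loops_iff:
  "bridge_loops G \<noteq> {} \<longleftrightarrow> (\<exists>k<n. \<exists>m. m \<noteq> 0 \<and> edge_count G (w k) (w k + lattice_vec G m) \<noteq> 0)"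
proof
  assume "bridge_loops G \<noteq> {}"
  then obtain c where c: "c \<in> fund_oedges G" "fund_index G c \<noteq> 0" "fund_tail G c = fund_head G c"
    by (auto simp: bridge_loops_def bridges_def)
  then obtain x where x: "x \<in> oriented_edges G" "c = orbit_rel `` {x}"
    by (auto simp: fund_oedges_orbit)
  have "oedge_tail x \<in> verts G" using x(1) by (cases x) (auto simp: oriented_edges_def ends_def)
  then have "fund_tail G c \<in> fund_verts G"
    using frac_part_verts orbit_values(2)[OF x(1)] x(2) by simp
  then obtain k where k: "k < n" "fund_tail G c = w k"
    using bij_betw_imp_surj_on[OF numbering] by force
  have "c \<in> {c' \<in> fund_oedges G. fund_tail G c' = w k \<and> fund_head G c' = w k \<and> fund_index G c' = fund_index G c}"
    using c k by simp
  then have "card {c' \<in> fund_oedges G. fund_tail G c' = w k \<and> fund_head G c' = w k \<and> fund_index G c' = fund_index G c} \<noteq> 0"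
    using fund_oedges_card(1)[OF w_fund[OF k(1)] w_fund[OF k(1)]] by (auto simp only: card_eq_0_iff)
  then have "edge_count G (w k) (w k + lattice_vec G (fund_index G c)) \<noteq> 0"
    using fund_oedges_card(2)[OF w_fund[OF k(1)] w_fund[OF k(1)]] by simp
  then show "\<exists>k<n. \<exists>m. m \<noteq> 0 \<and> edge_count G (w k) (w k + lattice_vec G m) \<noteq> 0"
    using c(2) k(1) by blast
next
  assume "\<exists>k<n. \<exists>m. m \<noteq> 0 \<and> edge_count G (w k) (w k + lattice_vec G m) \<noteq> 0"
  then obtain k m where k: "k < n" and m: "m \<noteq> 0" "edge_count G (w k) (w k + lattice_vec G m) \<noteq> 0"
    by blast
  then have "card {c \<in> fund_oedges G. fund_tail G c = w k \<and> fund_head G c = w k \<and> fund_index G c = m} \<noteq> 0"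
    using fund_oedges_card(2)[OF w_fund[OF k] w_fund[OF k], of m] by simp
  then have "{c \<in> fund_oedges G. fund_tail G c = w k \<and> fund_head G c = w k \<and> fund_index G c = m} \<noteq> {}"
    by (metis card.empty)
  then obtain c where "c \<in> fund_oedges G" "fund_tail G c = w k" "fund_head G c = w k" "fund_index G c = m"
    by blast
  then have "c \<in> bridge_loops G" using m(1) by (simp add: bridge_loops_def bridges_def)
  then show "bridge_loops G \<noteq> {}" by blast
qed

lemma connected_diag_range:
  assumes "k < n"
  shows "connected (diag_range G w k)" "bounded (diag_range G w k)"
proof -
  have "connected (range (\<lambda>\<theta>. Re (floquet_laplacian G w \<theta> $$ (k, k))))"
    using laplacian_continuous[OF assms assms]
    by (intro connected_continuous_image continuous_intros convex_connected convex_UNIV)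
  then show "connected (diag_range G w k)" by (simp add: diag_range_def)
  show "bounded (diag_range G w k)"
    unfolding bounded_iff diag_range_def
    using order_trans[OF abs_Re_le_cmod laplacian_bounded[OF assms assms]] by auto
qed

lemma diag_range_constant:
  assumes k: "k < n" and no: "\<And>m. m \<noteq> 0 \<Longrightarrow> edge_count G (w k) (w k + lattice_vec G m) = 0"
  shows "measure lebesgue (diag_range G w k) = 0"
proof -
  have "Re (floquet_laplacian G w \<theta> $$ (k, k)) = real (degree_at G (w k)) - real (edge_count G (w k) (w k))" for \<theta>
  proof -
    have "(\<Sum>m\<in>steps. real (edge_count G (w k) (w k + lattice_vec G m)) * Re (chr m \<theta>))
        = (\<Sum>m\<in>{0}. real (edge_count G (w k) (w k + lattice_vec G m)) * Re (chr m \<theta>))"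
      using finite_steps no by (intro sum.mono_neutral_right) (auto simp: steps_def)
    then show ?thesis by (simp add: diagonal_entry[OF k])
  qed
  then have "diag_range G w k = {real (degree_at G (w k)) - real (edge_count G (w k) (w k))}"
    by (auto simp: diag_range_def)
  then show ?thesis by simp
qed

text \<open>All modes enter the diagonal entry with nonpositive coefficients, so it is smallest at
  \<theta> = 0, where every character is 1. A point where the character of \<open>m\<close> equals
  -1 gives a strictly larger value, and two values in a connected range force positive
  length.\<close>

lemma diag_range_positive:
  assumes k: "k < n" and m: "m \<noteq> 0" "edge_count G (w k) (w k + lattice_vec G m) \<noteq> 0"
  shows "0 < measure lebesgue (diag_range G w k)"
proof -
  obtain s where s: "m $ s \<noteq> 0" using m(1) by (auto simp: Finite_Cartesian_Product.vec_eq_iff)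
  \<comment> \<open>The whole phase is put into one coordinate where \<open>m\<close> is nonzero, so
    that the pairing of m with \<theta> is pi.\<close>
  define \<theta> :: "real ^ 'd" where "\<theta> = (\<chi> i. if i = s then pi / of_int (m $ s) else 0)"
  define f where "f \<theta> = Re (floquet_laplacian G w \<theta> $$ (k, k))" for \<theta>
  have m_in: "m \<in> steps" using k m by (auto simp: steps_def)
  have "(\<Sum>i\<in>UNIV. of_int (m $ i) * \<theta> $ i) = (\<Sum>i\<in>UNIV. if i = s then pi else 0)"
    using s by (intro sum.cong) (auto simp: \<theta>_def)
  then have "chr m \<theta> = exp (\<i> * of_real pi)" by (simp add: chr_def)
  then have minus_one: "Re (chr m \<theta>) = -1" by (simp add: exp_pi_i')
  have "(\<Sum>r\<in>steps. real (edge_count G (w k) (w k + lattice_vec G r)) * Re (chr r \<theta>))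
      < (\<Sum>r\<in>steps. real (edge_count G (w k) (w k + lattice_vec G r)) * Re (chr r 0))"
  proof (rule sum_strict_mono_ex1[OF finite_steps])
    have le: "Re (chr r \<theta>) \<le> 1" for r
      using complex_Re_le_cmod[of "chr r \<theta>"] by simp
    show "\<forall>r\<in>steps. real (edge_count G (w k) (w k + lattice_vec G r)) * Re (chr r \<theta>)
        \<le> real (edge_count G (w k) (w k + lattice_vec G r)) * Re (chr r 0)"
      using le by (auto simp: chr_def[of _ 0] mult_left_le)
    show "\<exists>r\<in>steps. real (edge_count G (w k) (w k + lattice_vec G r)) * Re (chr r \<theta>)
        < real (edge_count G (w k) (w k + lattice_vec G r)) * Re (chr r 0)"
      using m_in m(2) minus_one by (intro bexI[of _ m]) (auto simp: chr_def[of _ 0])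
  qed
  then have lt: "f 0 < f \<theta>" by (simp add: f_def diagonal_entry[OF k])
  have range: "diag_range G w k = range f" by (simp add: diag_range_def f_def)
  note c = connected_diag_range[OF k, unfolded range]
  have "bdd_above (range f)" "bdd_below (range f)"
    using c(2) by (auto simp: bounded_imp_bdd_above bounded_imp_bdd_below)
  then have "Inf (range f) \<le> f 0" "f \<theta> \<le> Sup (range f)" by (auto intro: cINF_lower cSUP_upper)
  then show ?thesis using lt connected_measure_eq(2)[OF c] by (simp add: range)
qed

end

theorem theorem2p2:
  fixes G :: "('d::finite) pgraph" and Q :: "real ^ 'd \<Rightarrow> real"
    and w :: "nat \<Rightarrow> real ^ 'd" and \<nu> :: nat and q :: "nat \<Rightarrow> real" and C :: real
  assumes graph: "zd_periodic_graph G"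
    and potential: "periodic_potential G Q"
    and \<nu>: "\<nu> = card (fund_verts G)"
    and numbering: "bij_betw w {..<\<nu>} (fund_verts G)"
    and q: "\<And>j. q j = Q (w j)"
    and increasing: "\<And>j k. j < k \<Longrightarrow> k < \<nu> \<Longrightarrow> q j < q k"
    and C: "C = (\<Sum>n<\<nu>. measure lebesgue (diag_range G w n))"
  shows
    "(\<forall>n<\<nu>. \<exists>K. \<forall>\<^sub>F t in at_top. \<forall>\<theta>.
        cmod (of_real (band_function G Q w n \<theta> t) -
              (of_real (t * q n) + floquet_laplacian G w \<theta> $$ (n, n) -
               of_real (1 / t * (\<Sum>j \<in> {..<\<nu>} - {n}.
                 (cmod (floquet_laplacian G w \<theta> $$ (j, n)))\<^sup>2 / (q j - q n))))) \<le> K / t\<^sup>2) \<and>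
     (\<forall>n<\<nu>. (\<lambda>t. measure lebesgue (spectral_band G Q w n t) - measure lebesgue (diag_range G w n))
        \<in> O[at_top](\<lambda>t. 1 / t)) \<and>
     (\<lambda>t. measure lebesgue (schroedinger_spectrum G Q t) - C) \<in> O[at_top](\<lambda>t. 1 / t) \<and>
     (bridge_loops G \<noteq> {} \<longrightarrow> C > 0) \<and>
     (bridge_loops G = {} \<longrightarrow> C = 0)"
proof -
  interpret floquet_potential G w \<nu> Q q
    using graph potential \<nu> numbering q increasing by unfold_locales auto
  have band: "band_function G Q w k \<theta> t = nth_eigenvalue (H \<theta> t) k" for k \<theta> t
    by (simp add: band_function_def H_floquet)
  have band_range: "spectral_band G Q w k t = range (\<lambda>\<theta>. nth_eigenvalue (H \<theta> t) k)" for k t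
    by (simp add: spectral_band_def band)
  obtain K t0 where expansion: "\<And>t \<theta> k. t0 \<le> t \<Longrightarrow> k < \<nu> \<Longrightarrow>
     cmod (of_real (nth_eigenvalue (H \<theta> t) k) - (of_real (t * q k) + floquet_laplacian G w \<theta> $$ (k, k) -
       of_real (1 / t * (\<Sum>j\<in>{..<\<nu>} - {k}. (cmod (floquet_laplacian G w \<theta> $$ (j, k)))\<^sup>2 / (q j - q k))))) \<le> K / t\<^sup>2"
    using eigenvalue_expansion by blast
  have "connected (UNIV :: (real ^ 'd) set)" by (intro convex_connected convex_UNIV)
  from band_measures[OF this] obtain L t1 where L: "L \<ge> 0" "t1 \<ge> 1"
    and bands: "\<And>t k. t1 \<le> t \<Longrightarrow> k < \<nu> \<Longrightarrow>
      \<bar>measure lebesgue (spectral_band G Q w k t) - measure lebesgue (diag_range G w k)\<bar> \<le> L / t"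
    and union: "\<And>t. t1 \<le> t \<Longrightarrow> measure lebesgue (\<Union>k<\<nu>. spectral_band G Q w k t) =
      (\<Sum>k<\<nu>. measure lebesgue (spectral_band G Q w k t))"
    unfolding band_range[symmetric] diag_range_def[symmetric] by blast
  have 1: "\<forall>n<\<nu>. \<exists>K. \<forall>\<^sub>F t in at_top. \<forall>\<theta>.
        cmod (of_real (band_function G Q w n \<theta> t) -
              (of_real (t * q n) + floquet_laplacian G w \<theta> $$ (n, n) -
               of_real (1 / t * (\<Sum>j \<in> {..<\<nu>} - {n}.
                 (cmod (floquet_laplacian G w \<theta> $$ (j, n)))\<^sup>2 / (q j - q n))))) \<le> K / t\<^sup>2"
  proof (intro allI impI exI)
    fix k assume k: "k < \<nu>"
    show "\<forall>\<^sub>F t in at_top. \<forall>\<theta>.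
        cmod (of_real (band_function G Q w k \<theta> t) -
              (of_real (t * q k) + floquet_laplacian G w \<theta> $$ (k, k) -
               of_real (1 / t * (\<Sum>j \<in> {..<\<nu>} - {k}.
                 (cmod (floquet_laplacian G w \<theta> $$ (j, k)))\<^sup>2 / (q j - q k))))) \<le> K / t\<^sup>2"
      unfolding band using expansion[OF _ k] by (intro eventually_at_top_linorderI[of t0]) blast
  qed
  have 2: "(\<lambda>t. measure lebesgue (spectral_band G Q w k t) - measure lebesgue (diag_range G w k))
      \<in> O[at_top](\<lambda>t. 1 / t)" if k: "k < \<nu>" for k
  proof (rule bigoI[of _ L], rule eventually_at_top_linorderI[of t1])
    fix t assume t: "t1 \<le> t"
    then show "norm (measure lebesgue (spectral_band G Q w k t) - measure lebesgue (diag_range G w k))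
        \<le> L * norm (1 / t)"
      using bands[OF t k] L(2) by simp
  qed
  \<comment> \<open>From \<open>t1\<close> on the bands are disjoint, so the length of the spectrum
    minus \<open>C\<close> is a finite sum of band errors, each O(1 / t).\<close>
  have 3: "(\<lambda>t. measure lebesgue (schroedinger_spectrum G Q t) - C) \<in> O[at_top](\<lambda>t. 1 / t)"
  proof -
    have "(\<lambda>t. \<Sum>k<\<nu>. measure lebesgue (spectral_band G Q w k t) - measure lebesgue (diag_range G w k))
        \<in> O[at_top](\<lambda>t. 1 / t)"
      using 2 by (intro big_sum_in_bigo) auto
    moreover have "\<forall>\<^sub>F t in at_top. (\<Sum>k<\<nu>. measure lebesgue (spectral_band G Q w k t) - measure lebesgue (diag_range G w k))
        = measure lebesgue (schroedinger_spectrum G Q t) - C"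
      by (rule eventually_at_top_linorderI[of t1]) (simp add: spectrum_bands union C sum_subtractf)
    ultimately show ?thesis by (simp cong: landau_o.big.in_cong)
  qed
  have 4: "C > 0" if loops: "bridge_loops G \<noteq> {}"
  proof -
    obtain k m where k: "k < \<nu>" and "m \<noteq> 0" "edge_count G (w k) (w k + lattice_vec G m) \<noteq> 0"
      using loops bridge_loops_iff by blast
    then have "0 < measure lebesgue (diag_range G w k)" by (intro diag_range_positive)
    also have "\<dots> \<le> C" unfolding C using k by (intro member_le_sum) auto
    finally show ?thesis .
  qed
  have 5: "C = 0" if "bridge_loops G = {}"
    unfolding C using that bridge_loops_iff by (intro sum.neutral ballI diag_range_constant) auto
  show ?thesis using 1 2 3 4 5 by blast
qed

end
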